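(* Let $p\in(1,\infty)$, $k\in\{1,\dots,n-1\}$, $-\infty<a_i<b_i<\infty$ for $i=1,\dots,n-k$, $D=\mathbb R^k\times\prod_{i=1}^{n-k}(a_i,b_i)\subseteq\mathbb R^n$, and let $I$ be the canonical embedding $W_0^{1,p}(D)\hookrightarrow L^p(D)$. Then for every strict $s$-number $s$ and every $m\in\mathbb N$, $$s_m(I)=e_m(I)=\|I\|=\Big(1+\pi_p^p(p-1)\sum_{i=1}^{n-k}(b_i-a_i)^{-p}\Big)^{-1/p}.$$ In particular this holds for the approximation, Bernstein, Gelfand, Kolmogorov, isomorphism and Mityagin numbers, and $I$ is maximally noncompact.
   Context: Throughout, $n\ge2$. $W_0^{1,p}(D)$ is the closure of $\mathcal C_0^\infty(D)$ in $W^{1,p}(D)$ normed by $\|u\|_{W^{1,p}(D)}=\big(\|u\|_{L^p(D)}^p+\||\nabla u|_{\ell^p}\|_{L^p(D)}^p\big)^{1/p}$, $|\nabla u|_{\ell^p}=\big(\sum_{i=1}^n|\partial u/\partial x_i|^p\big)^{1/p}$. $\pi_p=2\int_0^1(1-s^p)^{-1/p}\,ds$. A strict $s$-number is a rule assigning to each bounded linear operator $T\colon X\to Y$ between Banach spaces a sequence $(s_m(T))_{m\ge1}$ of nonnegative numbers such that for every $m$: (S1) $\|T\|=s_1(T)\ge s_2(T)\ge\dots\ge0$; (S2) $s_m(S+T)\le s_m(S)+\|T\|$ for bounded $S\colon X\to Y$; (S3) $s_m(BTA)\le\|B\|s_m(T)\|A\|$ for bounded $A\colon W\to X$, $B\colon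 Y\to Z$; (S4) $s_m(\mathrm{id}_E)=1$ for every Banach space $E$ with $\dim E\ge m$; (S5) $s_m(T)=0$ if $\operatorname{rank}T<m$. The isomorphism numbers are $i_m(T)=\sup\|A\|^{-1}\|B\|^{-1}$ over all Banach spaces $G$ with $\dim G\ge m$ and bounded $A\colon Y\to G$, $B\colon G\to X$ with $ATB=\mathrm{id}_G$. Entropy numbers: $e_m(T)=\inf\{\varepsilon>0:\exists y_1,\dots,y_{2^{m-1}}\in Y,\ T(B_X)\subseteq\bigcup_j(y_j+\varepsilon B_Y)\}$; $T$ is maximally noncompact if $\lim_m e_m(T)=\|T\|$. *)

theory Defs
  imports "HOL-Analysis.Analysis"
begin

record 'a nspace =
  vcarrier :: "'a set"
  vzero :: 'a
  vadd :: "'a \<Rightarrow> 'a \<Rightarrow> 'a"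
  vscale :: "real \<Rightarrow> 'a \<Rightarrow> 'a"
  vnorm :: "'a \<Rightarrow> real"

definition vsub :: "'a nspace \<Rightarrow> 'a \<Rightarrow> 'a \<Rightarrow> 'a" where
  "vsub X x y = vadd X x (vscale X (-1) y)"

definition banach :: "'a nspace \<Rightarrow> bool" where
  "banach X \<longleftrightarrow>
     vzero X \<in> vcarrier X \<and>
     (\<forall>x\<in>vcarrier X. \<forall>y\<in>vcarrier X. vadd X x y \<in> vcarrier X) \<and>
     (\<forall>c. \<forall>x\<in>vcarrier X. vscale X c x \<in> vcarrier X) \<and>
     (\<forall>x\<in>vcarrier X. \<forall>y\<in>vcarrier X. \<forall>z\<in>vcarrier X.
        vadd X (vadd X x y) z = vadd X x (vadd X y z)) \<and>
     (\<forall>x\<in>vcarrier X. \<forall>y\<in>vcarrier X. vadd X x y = vadd X y x) \<and>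
     (\<forall>x\<in>vcarrier X. vadd X (vzero X) x = x) \<and>
     (\<forall>x\<in>vcarrier X. vadd X x (vscale X (-1) x) = vzero X) \<and>
     (\<forall>x\<in>vcarrier X. vscale X 1 x = x) \<and>
     (\<forall>a b. \<forall>x\<in>vcarrier X. vscale X a (vscale X b x) = vscale X (a * b) x) \<and>
     (\<forall>a b. \<forall>x\<in>vcarrier X. vscale X (a + b) x = vadd X (vscale X a x) (vscale X b x)) \<and>
     (\<forall>a. \<forall>x\<in>vcarrier X. \<forall>y\<in>vcarrier X.
        vscale X a (vadd X x y) = vadd X (vscale X a x) (vscale X a y)) \<and>
     (\<forall>x\<in>vcarrier X. 0 \<le> vnorm X x) \<and>
     (\<forall>x\<in>vcarrier X. vnorm X x = 0 \<longleftrightarrow> x = vzero X) \<and>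
     (\<forall>c. \<forall>x\<in>vcarrier X. vnorm X (vscale X c x) = \<bar>c\<bar> * vnorm X x) \<and>
     (\<forall>x\<in>vcarrier X. \<forall>y\<in>vcarrier X. vnorm X (vadd X x y) \<le> vnorm X x + vnorm X y) \<and>
     (\<forall>f. (\<forall>j. f j \<in> vcarrier X) \<and>
          (\<forall>e>0. \<exists>N. \<forall>j\<ge>N. \<forall>k\<ge>N. vnorm X (vsub X (f j) (f k)) < e)
        \<longrightarrow> (\<exists>x\<in>vcarrier X. (\<lambda>j. vnorm X (vsub X (f j) x)) \<longlonglongrightarrow> 0))"

definition bop :: "'a nspace \<Rightarrow> 'a nspace \<Rightarrow> ('a \<Rightarrow> 'a) set" where
  "bop X Y = {T. (\<forall>x\<in>vcarrier X. T x \<in> vcarrier Y) \<and>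
     (\<forall>x\<in>vcarrier X. \<forall>y\<in>vcarrier X. T (vadd X x y) = vadd Y (T x) (T y)) \<and>
     (\<forall>c. \<forall>x\<in>vcarrier X. T (vscale X c x) = vscale Y c (T x)) \<and>
     (\<exists>C. \<forall>x\<in>vcarrier X. vnorm Y (T x) \<le> C * vnorm X x) \<and>
     (\<forall>x. x \<notin> vcarrier X \<longrightarrow> T x = vzero Y)}"

definition opnorm :: "'a nspace \<Rightarrow> 'a nspace \<Rightarrow> ('a \<Rightarrow> 'a) \<Rightarrow> real" where
  "opnorm X Y T = Sup {vnorm Y (T x) | x. x \<in> vcarrier X \<and> vnorm X x \<le> 1}"

definition opadd :: "'a nspace \<Rightarrow> ('a \<Rightarrow> 'a) \<Rightarrow> ('a \<Rightarrow> 'a) \<Rightarrow> 'a \<Rightarrow> 'a" where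
  "opadd Y S T = (\<lambda>x. vadd Y (S x) (T x))"

definition idop :: "'a nspace \<Rightarrow> 'a \<Rightarrow> 'a" where
  "idop E = (\<lambda>x. if x \<in> vcarrier E then x else vzero E)"

primrec lincomb :: "'a nspace \<Rightarrow> (nat \<Rightarrow> real) \<Rightarrow> (nat \<Rightarrow> 'a) \<Rightarrow> nat \<Rightarrow> 'a" where
  "lincomb X c v 0 = vzero X"
| "lincomb X c v (Suc k) = vadd X (lincomb X c v k) (vscale X (c k) (v k))"

definition indep :: "'a nspace \<Rightarrow> 'a set \<Rightarrow> (nat \<Rightarrow> 'a) \<Rightarrow> nat \<Rightarrow> bool" where
  "indep X S v m \<longleftrightarrow> (\<forall>i<m. v i \<in> S) \<and>
     (\<forall>c. lincomb X c v m = vzero X \<longrightarrow> (\<forall>i<m. c i = 0))"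

definition dim_ge :: "'a nspace \<Rightarrow> nat \<Rightarrow> bool" where
  "dim_ge X m \<longleftrightarrow> (\<exists>v. indep X (vcarrier X) v m)"

definition rank_ge :: "'a nspace \<Rightarrow> 'a nspace \<Rightarrow> ('a \<Rightarrow> 'a) \<Rightarrow> nat \<Rightarrow> bool" where
  "rank_ge X Y T m \<longleftrightarrow> (\<exists>v. indep Y (T ` vcarrier X) v m)"

text \<open>Strict s-numbers, for all Banach spaces represented in the universe type 'u.
  Indices m start at 1.\<close>
definition strict_snum ::
  "(nat \<Rightarrow> 'u nspace \<Rightarrow> 'u nspace \<Rightarrow> ('u \<Rightarrow> 'u) \<Rightarrow> real) \<Rightarrow> bool" where
  "strict_snum s \<longleftrightarrow>
    (\<forall>X Y T. banach X \<and> banach Y \<and> T \<in> bop X Y \<longrightarrow>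
       s 1 X Y T = opnorm X Y T \<and>
       (\<forall>m\<ge>1. s (Suc m) X Y T \<le> s m X Y T \<and> 0 \<le> s m X Y T) \<and>
       (\<forall>m\<ge>1. \<forall>S\<in>bop X Y. s m X Y (opadd Y S T) \<le> s m X Y S + opnorm X Y T) \<and>
       (\<forall>m\<ge>1. \<forall>W Z A B. banach W \<and> banach Z \<and> A \<in> bop W X \<and> B \<in> bop Y Z \<longrightarrow>
          s m W Z (B \<circ> T \<circ> A) \<le> opnorm Y Z B * s m X Y T * opnorm W X A) \<and>
       (\<forall>m\<ge>1. \<not> rank_ge X Y T m \<longrightarrow> s m X Y T = 0)) \<and>
    (\<forall>E m. banach E \<and> m \<ge> 1 \<and> dim_ge E m \<longrightarrow> s m E E (idop E) = 1)"

definition entropy :: "nat \<Rightarrow> 'a nspace \<Rightarrow> 'a nspace \<Rightarrow> ('a \<Rightarrow> 'a) \<Rightarrow> real" where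
  "entropy m X Y T = Inf {\<epsilon>. \<epsilon> > 0 \<and>
     (\<exists>y::nat \<Rightarrow> 'a. (\<forall>j<2^(m-1). y j \<in> vcarrier Y) \<and>
          (\<forall>x\<in>vcarrier X. vnorm X x \<le> 1 \<longrightarrow>
             (\<exists>j<2^(m-1). vnorm Y (vsub Y (T x) (y j)) \<le> \<epsilon>)))}"

definition pd :: "'n::finite \<Rightarrow> (real^'n \<Rightarrow> real) \<Rightarrow> real^'n \<Rightarrow> real" where
  "pd i f x = deriv (\<lambda>t. f (x + t *\<^sub>R axis i 1)) 0"

primrec iterpd :: "'n::finite list \<Rightarrow> (real^'n \<Rightarrow> real) \<Rightarrow> real^'n \<Rightarrow> real" where
  "iterpd [] f = f"
| "iterpd (i # is) f = pd i (iterpd is f)"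

definition smooth :: "(real^'n::finite \<Rightarrow> real) \<Rightarrow> bool" where
  "smooth f \<longleftrightarrow> (\<forall>is. continuous_on UNIV (iterpd is f) \<and>
     (\<forall>i x. (\<lambda>t. iterpd is f (x + t *\<^sub>R axis i 1)) differentiable (at 0)))"

definition Ccinf :: "(real^'n::finite) set \<Rightarrow> (real^'n \<Rightarrow> real) \<Rightarrow> bool" where
  "Ccinf D f \<longleftrightarrow> smooth f \<and> compact (closure {x. f x \<noteq> 0}) \<and> closure {x. f x \<noteq> 0} \<subseteq> D"

definition Lint :: "(real^'n::finite) set \<Rightarrow> (real^'n \<Rightarrow> real) \<Rightarrow> real" where
  "Lint D f = (LINT x:D|lebesgue. f x)"

definition memLp :: "(real^'n::finite) set \<Rightarrow> real \<Rightarrow> (real^'n \<Rightarrow> real) \<Rightarrow> bool" where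
  "memLp D p f \<longleftrightarrow> set_borel_measurable lebesgue D f \<and>
     set_integrable lebesgue D (\<lambda>x. \<bar>f x\<bar> powr p)"

definition cls :: "(real^'n::finite) set \<Rightarrow> (real^'n \<Rightarrow> real) \<Rightarrow> (real^'n \<Rightarrow> real) set" where
  "cls D f = {g. AE x in lebesgue. x \<in> D \<longrightarrow> g x = f x}"

definition rep :: "(real^'n::finite \<Rightarrow> real) set \<Rightarrow> real^'n \<Rightarrow> real" where
  "rep C = (SOME f. f \<in> C)"

definition Lpnorm :: "(real^'n::finite) set \<Rightarrow> real \<Rightarrow> (real^'n \<Rightarrow> real) \<Rightarrow> real" where
  "Lpnorm D p f = (Lint D (\<lambda>x. \<bar>f x\<bar> powr p)) powr (1 / p)"

definition Lp_space :: "(real^'n::finite) set \<Rightarrow> real \<Rightarrow> (real^'n \<Rightarrow> real) set nspace" where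
  "Lp_space D p = \<lparr> vcarrier = {cls D f | f. memLp D p f},
     vzero = cls D (\<lambda>_. 0),
     vadd = (\<lambda>C1 C2. cls D (\<lambda>x. rep C1 x + rep C2 x)),
     vscale = (\<lambda>c C. cls D (\<lambda>x. c * rep C x)),
     vnorm = (\<lambda>C. Lpnorm D p (rep C)) \<rparr>"

definition weak_partial :: "(real^'n::finite) set \<Rightarrow> (real^'n \<Rightarrow> real) \<Rightarrow> 'n \<Rightarrow> (real^'n \<Rightarrow> real) \<Rightarrow> bool" where
  "weak_partial D u i g \<longleftrightarrow> (\<forall>\<phi>. Ccinf D \<phi> \<longrightarrow>
     Lint D (\<lambda>x. u x * pd i \<phi> x) = - Lint D (\<lambda>x. g x * \<phi> x))"

definition has_weak_grad :: "(real^'n::finite) set \<Rightarrow> real \<Rightarrow> (real^'n \<Rightarrow> real) \<Rightarrow> ('n \<Rightarrow> real^'n \<Rightarrow> real) \<Rightarrow> bool" where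
  "has_weak_grad D p u G \<longleftrightarrow> memLp D p u \<and> (\<forall>i. memLp D p (G i) \<and> weak_partial D u i (G i))"

definition W1p_norm :: "(real^'n::finite) set \<Rightarrow> real \<Rightarrow> (real^'n \<Rightarrow> real) \<Rightarrow> ('n \<Rightarrow> real^'n \<Rightarrow> real) \<Rightarrow> real" where
  "W1p_norm D p u G = (Lint D (\<lambda>x. \<bar>u x\<bar> powr p) + (\<Sum>i\<in>UNIV. Lint D (\<lambda>x. \<bar>G i x\<bar> powr p))) powr (1 / p)"

definition W0_space :: "(real^'n::finite) set \<Rightarrow> real \<Rightarrow> (real^'n \<Rightarrow> real) set nspace" where
  "W0_space D p = \<lparr> vcarrier = {cls D u | u. \<exists>G. has_weak_grad D p u G \<and>
        (\<exists>\<phi>. (\<forall>j. Ccinf D (\<phi> j)) \<and>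
           (\<lambda>j. W1p_norm D p (\<lambda>x. u x - \<phi> j x) (\<lambda>i x. G i x - pd i (\<phi> j) x)) \<longlonglongrightarrow> 0)},
     vzero = cls D (\<lambda>_. 0),
     vadd = (\<lambda>C1 C2. cls D (\<lambda>x. rep C1 x + rep C2 x)),
     vscale = (\<lambda>c C. cls D (\<lambda>x. c * rep C x)),
     vnorm = (\<lambda>C. W1p_norm D p (rep C) (SOME G. has_weak_grad D p (rep C) G)) \<rparr>"

definition emb :: "'a nspace \<Rightarrow> 'a nspace \<Rightarrow> 'a \<Rightarrow> 'a" where
  "emb X Y = (\<lambda>x. if x \<in> vcarrier X then x else vzero Y)"

definition pi_p :: "real \<Rightarrow> real" where
  "pi_p p = 2 * (LINT s:{0<..<1}|lborel. (1 - s powr p) powr (- 1 / p))"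

end

theory Submission
  imports Defs
begin

text \<open>
  Every s-number satisfies \<open>s\<^sub>m(I) \<le> s\<^sub>1(I) = \<parallel>I\<parallel>\<close>, so the theorem amounts to an upper bound for the norm
  and a matching lower bound for \<open>s\<^sub>m\<close> and for the entropy numbers.

  Upper bound: if \<open>v\<close> solves the Riccati equation \<open>v' = - \<lambda> - (p - 1) \<bar>v\<bar>\<^sup>q\<close> on \<open>(a\<^sub>i, b\<^sub>i)\<close>, Young's
  inequality gives \<open>\<partial>\<^sub>i (\<bar>\<phi>\<bar>\<^sup>p v(x\<^sub>i)) \<le> \<bar>\<partial>\<^sub>i \<phi>\<bar>\<^sup>p - \<lambda> \<bar>\<phi>\<bar>\<^sup>p\<close>, and the left-hand side has integral \<open>0\<close>; such a
  solution lives on an interval of length \<open>b\<^sub>i - a\<^sub>i\<close> exactly for \<open>\<lambda> = \<pi>\<^sub>p\<^sup>p (p - 1) (b\<^sub>i - a\<^sub>i)\<^sup>-\<^sup>p\<close>.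

  Lower bound: products of smooth almost-extremal functions of one variable, stretched in the
  unbounded directions, almost attain the norm, and their translates along an unbounded direction
  have disjoint supports. The span of \<open>m\<close> translates is an \<open>m\<close>-dimensional copy of \<open>\<ell>\<^sub>p\<close> in \<open>L\<^sup>p\<close> that is
  the range of a projection of norm \<open>1\<close>, so the identity of this span factors through \<open>I\<close>. For the entropy
  numbers it suffices that any fixed function in \<open>L\<^sup>p\<close> has arbitrarily small norm on the support of a
  late translate.
\<close>

subsection \<open>The space \<open>L\<^sup>p\<close>\<close>

text \<open>Because the gradient is measured in the \<open>l^p\<close> norm, the \<open>p\<close>-th
  power of the Sobolev norm is a plain sum over the coordinate directions. This decouples the
  problem into one-dimensional ones; their sharp constants add up to \<open>\<Lambda>\<close>, the
  unbounded directions contributing 0. Three obstacles shape the proof. The norm of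
  \<open>W0_space\<close> is taken at a gradient picked by choice, so weak gradients must be unique
  almost everywhere before anything can be computed. The one-dimensional extremal function reaches
  the end points of its interval and need not be smooth, whereas test functions have compact support
  and partial derivatives of all orders, so it can only be approached. Finally, an axiomatic
  s-number is bounded from below only through identities of Banach spaces: the span of the bumps has
  to be a complete space over the same type of classes, with operators into \<open>W0_space\<close>
  and out of \<open>Lp_space\<close> whose composition with \<open>I\<close> is literally
  \<open>idop\<close>. The operator out of \<open>Lp_space\<close> is built from one norming
  functional per bump; disjoint supports keep its norm at 1.\<close>

lemma powr_add_split:
  fixes x y t p :: real
  assumes p: "1 < p" and t: "0 < t" "t < 1"
  shows "\<bar>x + y\<bar> powr p \<le> t powr (1 - p) * \<bar>x\<bar> powr p + (1 - t) powr (1 - p) * \<bar>y\<bar> powr p"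
proof -
  have ge1: "1 \<le> u powr (1 - p)" if "0 < u" "u < 1" for u :: real
    using that p powr_mono'[of "1 - p" 0 u] by simp
  show ?thesis
  proof (cases "x = 0 \<or> y = 0")
    case True
    have "1 * \<bar>x\<bar> powr p \<le> t powr (1 - p) * \<bar>x\<bar> powr p"
      by (intro mult_right_mono ge1 t) auto
    moreover have "1 * \<bar>y\<bar> powr p \<le> (1 - t) powr (1 - p) * \<bar>y\<bar> powr p"
      using t by (intro mult_right_mono ge1) auto
    ultimately show ?thesis using True by auto
  next
    case False
    have sc: "u * (\<bar>z\<bar> / u) powr p = u powr (1 - p) * \<bar>z\<bar> powr p" if "0 < u" for u z :: real
      using that by (simp add: powr_divide powr_diff field_simps)
    have "\<bar>x + y\<bar> powr p \<le> (\<bar>x\<bar> + \<bar>y\<bar>) powr p"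
      using p by (intro powr_mono2) auto
    also have "\<dots> = ((1 - t) * (\<bar>y\<bar> / (1 - t)) + t * (\<bar>x\<bar> / t)) powr p"
      using t by (simp add: add.commute)
    also have "\<dots> \<le> (1 - t) * (\<bar>y\<bar> / (1 - t)) powr p + t * (\<bar>x\<bar> / t) powr p"
      using convex_onD[OF powr_convex, of p t "\<bar>y\<bar> / (1 - t)" "\<bar>x\<bar> / t"] p t False by simp
    also have "\<dots> = (1 - t) powr (1 - p) * \<bar>y\<bar> powr p + t powr (1 - p) * \<bar>x\<bar> powr p"
      using t by (simp add: sc)
    finally show ?thesis by simp
  qed
qed

text \<open>For \<open>A = \<alpha>^p\<close> and \<open>B = \<beta>^p\<close> the minimum over
  \<open>t\<close> of the right-hand side is \<open>(\<alpha> + \<beta>)^p\<close>, so the family of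
  bounds amounts to Minkowski's inequality. Each single bound is linear in \<open>A\<close> and
  \<open>B\<close> and therefore survives integration and summation over the partial derivatives;
  the triangle inequality of the Sobolev norm follows without a separate argument for finite
  sums.\<close>

lemma powr_inverse_le_add:
  fixes A B C p :: real
  assumes p: "1 < p" and nn: "0 \<le> A" "0 \<le> B" "0 \<le> C"
    and le: "\<And>t. 0 < t \<Longrightarrow> t < 1 \<Longrightarrow> C \<le> t powr (1 - p) * A + (1 - t) powr (1 - p) * B"
  shows "C powr (1 / p) \<le> A powr (1 / p) + B powr (1 / p)"
proof -
  \<comment> \<open>When \<open>A\<close> or \<open>B\<close> vanishes, the minimiser sits at an
    excluded end point of \<open>(0, 1)\<close>; there the bound is used in the limit.\<close>
  have lim: "C' \<le> B'" if le': "\<And>t. 0 < t \<Longrightarrow> t < 1 \<Longrightarrow> C' \<le> (1 - t) powr (1 - p) * B'"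
    for B' C' :: real
  proof (rule tendsto_le[of "at_right 0"])
    show "((\<lambda>t::real. (1 - t) powr (1 - p) * B') \<longlongrightarrow> B') (at_right 0)"
      by (rule tendsto_eq_intros refl | simp)+
    show "((\<lambda>t::real. C') \<longlongrightarrow> C') (at_right 0)" by simp
    show "\<forall>\<^sub>F t in at_right (0::real). C' \<le> (1 - t) powr (1 - p) * B'"
      using eventually_at_right_less[of "0::real"] eventually_at_right_field[of _ "0::real"]
      by (metis (mono_tags, lifting) le' eventually_at_right_field zero_less_one)
  qed simp
  consider "A = 0" | "B = 0" | "A > 0" "B > 0" using nn by fastforce
  then show ?thesis
  proof cases
    case 1
    have "C \<le> B" by (rule lim) (use le 1 in force)
    with 1 nn p show ?thesis by (simp add: powr_mono2)
  next
    case 2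
    have "C \<le> A"
    proof (rule lim)
      fix t :: real assume "0 < t" "t < 1"
      with le[of "1 - t"] 2 show "C \<le> (1 - t) powr (1 - p) * A" by simp
    qed
    with 2 nn p show ?thesis by (simp add: powr_mono2)
  next
    case 3
    define \<alpha> \<beta> where "\<alpha> = A powr (1 / p)" and "\<beta> = B powr (1 / p)"
    have pos: "0 < \<alpha>" "0 < \<beta>" using 3 by (auto simp: \<alpha>_def \<beta>_def)
    have AB: "A = \<alpha> powr p" "B = \<beta> powr p" using 3 p by (auto simp: \<alpha>_def \<beta>_def powr_powr)
    \<comment> \<open>The minimiser of the right-hand side.\<close>
    define t where "t = \<alpha> / (\<alpha> + \<beta>)"
    have t: "0 < t" "t < 1" "1 - t = \<beta> / (\<alpha> + \<beta>)" using pos by (auto simp: t_def field_simps)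
    have sc: "(z / (\<alpha> + \<beta>)) powr (1 - p) * z powr p = z * (\<alpha> + \<beta>) powr (p - 1)"
      if "0 < z" for z
    proof -
      have "(z / (\<alpha> + \<beta>)) powr (1 - p) * z powr p = (z powr (1 - p) * z powr p) * (1 / (\<alpha> + \<beta>) powr (1 - p))"
        using that pos by (simp add: powr_divide)
      also have "z powr (1 - p) * z powr p = z" using that by (simp flip: powr_add)
      also have "1 / (\<alpha> + \<beta>) powr (1 - p) = (\<alpha> + \<beta>) powr (p - 1)"
        by (simp flip: powr_minus_divide)
      finally show ?thesis .
    qed
    have "C \<le> t powr (1 - p) * A + (1 - t) powr (1 - p) * B" using le t by blast
    also have "\<dots> = (\<alpha> + \<beta>) * (\<alpha> + \<beta>) powr (p - 1)"
      unfolding t(3) unfolding t_def AB using sc pos by (simp add: algebra_simps)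
    also have "\<dots> = (\<alpha> + \<beta>) powr p" using pos by (simp add: powr_diff)
    finally have "C powr (1 / p) \<le> ((\<alpha> + \<beta>) powr p) powr (1 / p)"
      using nn p by (intro powr_mono2) auto
    also have "\<dots> = \<alpha> + \<beta>" using pos p by (simp add: powr_powr)
    finally show ?thesis by (simp add: \<alpha>_def \<beta>_def)
  qed
qed

lemma powr_add_bound:
  fixes x y p :: real
  assumes "1 < p"
  shows "\<bar>x + y\<bar> powr p \<le> 2 powr (p - 1) * \<bar>x\<bar> powr p + 2 powr (p - 1) * \<bar>y\<bar> powr p"
  using powr_add_split[OF assms, of "1/2" x y] by (simp add: powr_divide powr_diff field_simps)

lemma integrable_powr_add:
  fixes f g :: "'a \<Rightarrow> real"
  assumes p: "1 < p" and [measurable]: "f \<in> borel_measurable M" "g \<in> borel_measurable M"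
    and int: "integrable M (\<lambda>x. \<bar>f x\<bar> powr p)" "integrable M (\<lambda>x. \<bar>g x\<bar> powr p)"
  shows "integrable M (\<lambda>x. \<bar>f x + g x\<bar> powr p)"
proof (rule Bochner_Integration.integrable_bound)
  show "integrable M (\<lambda>x. 2 powr (p - 1) * \<bar>f x\<bar> powr p + 2 powr (p - 1) * \<bar>g x\<bar> powr p)"
    using int by simp
  show "AE x in M. norm (\<bar>f x + g x\<bar> powr p)
      \<le> norm (2 powr (p - 1) * \<bar>f x\<bar> powr p + 2 powr (p - 1) * \<bar>g x\<bar> powr p)"
    using powr_add_bound[OF p] by (auto simp: abs_of_nonneg)
qed measurable

lemma Holder_inequality:
  fixes f g :: "'a \<Rightarrow> real"
  assumes pq: "1 < p" "1 < q" "1 / p + 1 / q = 1"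
    and [measurable]: "f \<in> borel_measurable M" "g \<in> borel_measurable M"
    and int: "integrable M (\<lambda>x. \<bar>f x\<bar> powr p)" "integrable M (\<lambda>x. \<bar>g x\<bar> powr q)"
  shows Holder_integrable: "integrable M (\<lambda>x. f x * g x)"
    and Holder_bound: "\<bar>\<integral>x. f x * g x \<partial>M\<bar>
      \<le> (\<integral>x. \<bar>f x\<bar> powr p \<partial>M) powr (1 / p) * (\<integral>x. \<bar>g x\<bar> powr q \<partial>M) powr (1 / q)"
proof -
  show I: "integrable M (\<lambda>x. f x * g x)"
  proof (rule Bochner_Integration.integrable_bound)
    show "integrable M (\<lambda>x. \<bar>f x\<bar> powr p / p + \<bar>g x\<bar> powr q / q)" using int by simp
    show "AE x in M. norm (f x * g x) \<le> norm (\<bar>f x\<bar> powr p / p + \<bar>g x\<bar> powr q / q)"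
      using Youngs_inequality[OF pq] pq by (auto simp: abs_mult intro!: AE_I2)
  qed measurable
  define A where "A = (\<integral>x. \<bar>f x\<bar> powr p \<partial>M)"
  define B where "B = (\<integral>x. \<bar>g x\<bar> powr q \<partial>M)"
  have nn: "A \<ge> 0" "B \<ge> 0" by (auto simp: A_def B_def)
  consider "A = 0" | "B = 0" | "A > 0" "B > 0" using nn by fastforce
  then have "\<bar>\<integral>x. f x * g x \<partial>M\<bar> \<le> A powr (1 / p) * B powr (1 / q)"
  proof cases
    case 1
    then have "AE x in M. \<bar>f x\<bar> powr p = 0"
      unfolding A_def using integral_nonneg_eq_0_iff_AE[OF int(1)] by simp
    then have "(\<integral>x. f x * g x \<partial>M) = 0"
      by (intro integral_eq_zero_AE) auto
    then show ?thesis by simp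
  next
    case 2
    then have "AE x in M. \<bar>g x\<bar> powr q = 0"
      unfolding B_def using integral_nonneg_eq_0_iff_AE[OF int(2)] by simp
    then have "(\<integral>x. f x * g x \<partial>M) = 0"
      by (intro integral_eq_zero_AE) auto
    then show ?thesis by simp
  next
    case 3
    define \<alpha> \<beta> where "\<alpha> = A powr (1 / p)" and "\<beta> = B powr (1 / q)"
    have pos: "0 < \<alpha>" "0 < \<beta>" using 3 by (auto simp: \<alpha>_def \<beta>_def)
    have AB: "A = \<alpha> powr p" "B = \<beta> powr q" using 3 pq by (auto simp: \<alpha>_def \<beta>_def powr_powr)
    \<comment> \<open>Young's inequality for the two functions divided by their norms.\<close>
    have pt: "\<bar>f x * g x\<bar> \<le> \<alpha> * \<beta> * (\<bar>f x\<bar> powr p / (A * p) + \<bar>g x\<bar> powr q / (B * q))" for x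
    proof -
      have "(\<bar>f x\<bar> / \<alpha>) * (\<bar>g x\<bar> / \<beta>) \<le> (\<bar>f x\<bar> / \<alpha>) powr p / p + (\<bar>g x\<bar> / \<beta>) powr q / q"
        using pos by (intro Youngs_inequality[OF pq]) auto
      also have "\<dots> = \<bar>f x\<bar> powr p / (A * p) + \<bar>g x\<bar> powr q / (B * q)"
        using pos by (simp add: AB powr_divide)
      finally show ?thesis using pos by (simp add: field_simps abs_mult)
    qed
    have "\<bar>\<integral>x. f x * g x \<partial>M\<bar> \<le> (\<integral>x. \<bar>f x * g x\<bar> \<partial>M)" by simp
    also have "\<dots> \<le> (\<integral>x. \<alpha> * \<beta> * (\<bar>f x\<bar> powr p / (A * p) + \<bar>g x\<bar> powr q / (B * q)) \<partial>M)"
      using I int pt by (intro integral_mono) auto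
    also have "\<dots> = \<alpha> * \<beta> * (A / (A * p) + B / (B * q))"
      using int by (simp add: A_def B_def)
    also have "\<dots> = \<alpha> * \<beta> * (1 / p + 1 / q)" using 3 by simp
    also have "\<dots> = \<alpha> * \<beta>" using pq by simp
    finally show ?thesis by (simp add: \<alpha>_def \<beta>_def)
  qed
  then show "\<bar>\<integral>x. f x * g x \<partial>M\<bar>
      \<le> (\<integral>x. \<bar>f x\<bar> powr p \<partial>M) powr (1 / p) * (\<integral>x. \<bar>g x\<bar> powr q \<partial>M) powr (1 / q)"
    by (simp add: A_def B_def)
qed

text \<open>The Riesz-Fischer theorem, with weights in place of Minkowski's inequality for infinite
  sums: along a fast subsequence even the increments multiplied by \<open>2^k\<close> have summable
  integrals of their \<open>p\<close>-th powers, so at almost every point the increments decay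
  geometrically.\<close>

lemma Lp_complete:
  fixes f :: "nat \<Rightarrow> 'a \<Rightarrow> real"
  assumes p: "1 < p" and [measurable]: "\<And>j. f j \<in> borel_measurable M"
    and int: "\<And>j. integrable M (\<lambda>x. \<bar>f j x\<bar> powr p)"
    and cauchy: "\<And>e. 0 < e \<Longrightarrow> \<exists>N. \<forall>j\<ge>N. \<forall>k\<ge>N. (\<integral>x. \<bar>f j x - f k x\<bar> powr p \<partial>M) < e"
  obtains g where "g \<in> borel_measurable M" "integrable M (\<lambda>x. \<bar>g x\<bar> powr p)"
    "(\<lambda>j. \<integral>x. \<bar>f j x - g x\<bar> powr p \<partial>M) \<longlonglongrightarrow> 0"
proof -
  \<comment> \<open>Each step of the weight costs a factor \<open>2 powr p\<close>; the rate
    \<open>1 / c\<close> repays it with a further \<open>1 / 2\<close>, which leaves a geometric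
    series.\<close>
  define c where "c = 2 * (2::real) powr p"
  have c: "0 < c" by (simp add: c_def)
  have intd: "integrable M (\<lambda>x. \<bar>f j x - f k x\<bar> powr p)" for j k
    using integrable_powr_add[OF p, of "f j" M "\<lambda>x. - f k x"] int by simp
  have "\<exists>N. \<forall>k. \<forall>i\<ge>N k. \<forall>j\<ge>N k. (\<integral>x. \<bar>f i x - f j x\<bar> powr p \<partial>M) < (1 / c) ^ k"
    using cauchy c by (intro choice) auto
  then obtain N where N: "\<And>k i j. N k \<le> i \<Longrightarrow> N k \<le> j \<Longrightarrow>
      (\<integral>x. \<bar>f i x - f j x\<bar> powr p \<partial>M) < (1 / c) ^ k" by blast
  \<comment> \<open>Adding up all earlier thresholds makes the subsequence monotone, and the summand
    \<open>k\<close> makes it tend to infinity.\<close>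
  define r where "r k = (\<Sum>i\<le>k. N i) + k" for k
  have rN: "N k \<le> r k" for k
    unfolding r_def using member_le_sum[of k "{..k}" N] by simp
  have rS: "r k \<le> r (Suc k)" for k by (simp add: r_def)
  have rk: "k \<le> r k" for k by (simp add: r_def)
  define d where "d k x = f (r (Suc k)) x - f (r k) x" for k x
  have [measurable]: "d k \<in> borel_measurable M" for k unfolding d_def by measurable
  have dint: "integrable M (\<lambda>x. \<bar>d k x\<bar> powr p)" for k unfolding d_def by (rule intd)
  have dle: "(\<integral>x. \<bar>d k x\<bar> powr p \<partial>M) \<le> (1 / c) ^ k" for k
    unfolding d_def using N[of k "r (Suc k)" "r k"] rN[of k] rS[of k] by linarith
  have "(\<integral>\<^sup>+x. (\<Sum>k. ennreal ((2 powr p) ^ k * \<bar>d k x\<bar> powr p)) \<partial>M)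
      = (\<Sum>k. \<integral>\<^sup>+x. ennreal ((2 powr p) ^ k * \<bar>d k x\<bar> powr p) \<partial>M)"
    by (rule nn_integral_suminf) measurable
  also have "\<dots> \<le> (\<Sum>k. ennreal ((1 / 2) ^ k))"
  proof (intro suminf_le)
    fix k
    have "(\<integral>\<^sup>+x. ennreal ((2 powr p) ^ k * \<bar>d k x\<bar> powr p) \<partial>M)
        = ennreal (\<integral>x. (2 powr p) ^ k * \<bar>d k x\<bar> powr p \<partial>M)"
      using dint by (intro nn_integral_eq_integral) auto
    also have "\<dots> = ennreal ((2 powr p) ^ k * (\<integral>x. \<bar>d k x\<bar> powr p \<partial>M))" by simp
    also have "\<dots> \<le> ennreal ((2 powr p) ^ k * (1 / c) ^ k)"
      using dle by (intro ennreal_leI mult_left_mono) auto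
    also have "(2 powr p) ^ k * (1 / c) ^ k = (1 / 2) ^ k"
      by (simp add: c_def flip: power_mult_distrib)
    finally show "(\<integral>\<^sup>+x. ennreal ((2 powr p) ^ k * \<bar>d k x\<bar> powr p) \<partial>M) \<le> ennreal ((1 / 2) ^ k)" .
  qed auto
  also have "\<dots> = ennreal (\<Sum>k. (1 / 2) ^ k)"
    by (intro suminf_ennreal_eq) (auto intro!: summable_sums summable_geometric)
  also have "\<dots> < \<infinity>" by simp
  finally have "AE x in M. (\<Sum>k. ennreal ((2 powr p) ^ k * \<bar>d k x\<bar> powr p)) \<noteq> \<infinity>"
    by (intro nn_integral_PInf_AE) auto
  then have conv: "AE x in M. convergent (\<lambda>k. f (r k) x)"
  proof eventually_elim
    case (elim x)
    define B where "B = enn2real (\<Sum>k. ennreal ((2 powr p) ^ k * \<bar>d k x\<bar> powr p))"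
    have B: "(2 powr p) ^ k * \<bar>d k x\<bar> powr p \<le> B" for k
    proof -
      have "ennreal ((2 powr p) ^ k * \<bar>d k x\<bar> powr p) = (\<Sum>k\<in>{k}. ennreal ((2 powr p) ^ k * \<bar>d k x\<bar> powr p))"
        by simp
      also have "\<dots> \<le> (\<Sum>k. ennreal ((2 powr p) ^ k * \<bar>d k x\<bar> powr p))"
        by (rule sum_le_suminf) auto
      also have "\<dots> = ennreal B" using elim by (simp add: B_def less_top)
      finally show ?thesis
        by (subst (asm) ennreal_le_iff) (auto simp: B_def)
    qed
    have dB: "norm (d k x) \<le> B powr (1 / p) * (1 / 2) ^ k" for k
    proof -
      have "(2 ^ k * \<bar>d k x\<bar>) powr p \<le> B"
        using B[of k] by (simp add: powr_mult powr_powr flip: powr_realpow) (simp add: mult.commute powr_realpow)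
      then have "((2 ^ k * \<bar>d k x\<bar>) powr p) powr (1 / p) \<le> B powr (1 / p)"
        using p by (intro powr_mono2) auto
      then show ?thesis using p by (simp add: powr_powr field_simps)
    qed
    have "summable (\<lambda>k. B powr (1 / p) * (1 / 2) ^ k)"
      by (intro summable_mult summable_geometric) simp
    then have "summable (\<lambda>k. d k x)"
      by (rule summable_comparison_test'[where N = 0]) (rule dB)
    then have "convergent (\<lambda>n. \<Sum>k<n. d k x)" by (simp only: summable_iff_convergent)
    also have "(\<lambda>n. \<Sum>k<n. d k x) = (\<lambda>n. f (r n) x - f (r 0) x)"
      unfolding d_def by (rule ext, rule sum_lessThan_telescope)
    finally have "convergent (\<lambda>n. f (r n) x - f (r 0) x)" .
    from convergent_add[OF this convergent_const[of "f (r 0) x"]] show ?case by simp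
  qed
  define g where "g x = lim (\<lambda>k. f (r k) x)" for x
  have gm [measurable]: "g \<in> borel_measurable M" unfolding g_def by measurable
  have lim: "AE x in M. (\<lambda>k. f (r k) x) \<longlonglongrightarrow> g x"
    using conv by eventually_elim (simp add: g_def convergent_LIMSEQ_iff)
  \<comment> \<open>Fatou's lemma carries the Cauchy estimate to the limit in the second
    index.\<close>
  have fatou: "(\<integral>\<^sup>+x. ennreal (\<bar>f j x - g x\<bar> powr p) \<partial>M) \<le> ennreal e"
    if M: "\<forall>j\<ge>N0. \<forall>k\<ge>N0. (\<integral>x. \<bar>f j x - f k x\<bar> powr p \<partial>M) < e" and j: "N0 \<le> j" for N0 j e
  proof -
    have "(\<integral>\<^sup>+x. ennreal (\<bar>f j x - g x\<bar> powr p) \<partial>M)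
        = (\<integral>\<^sup>+x. liminf (\<lambda>k. ennreal (\<bar>f j x - f (r k) x\<bar> powr p)) \<partial>M)"
    proof (intro nn_integral_cong_AE, use lim in eventually_elim)
      case (elim x)
      have "(\<lambda>k. ennreal (\<bar>f j x - f (r k) x\<bar> powr p)) \<longlonglongrightarrow> ennreal (\<bar>f j x - g x\<bar> powr p)"
        using p by (intro tendsto_ennrealI tendsto_powr' tendsto_rabs tendsto_diff tendsto_const elim) auto
      then show ?case using lim_imp_Liminf[OF sequentially_bot] by metis
    qed
    also have "\<dots> \<le> liminf (\<lambda>k. \<integral>\<^sup>+x. ennreal (\<bar>f j x - f (r k) x\<bar> powr p) \<partial>M)"
      by (rule nn_integral_liminf) measurable
    also have "\<dots> \<le> liminf (\<lambda>k. ennreal e)"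
    proof (rule Liminf_mono, rule eventually_sequentiallyI[of N0])
      fix k assume "N0 \<le> k"
      then have k: "N0 \<le> r k" using rk[of k] by simp
      have "(\<integral>\<^sup>+x. ennreal (\<bar>f j x - f (r k) x\<bar> powr p) \<partial>M) = ennreal (\<integral>x. \<bar>f j x - f (r k) x\<bar> powr p \<partial>M)"
        using intd by (intro nn_integral_eq_integral) auto
      also have "\<dots> \<le> ennreal e" using M j k by (intro ennreal_leI) (meson less_imp_le)
      finally show "(\<integral>\<^sup>+x. ennreal (\<bar>f j x - f (r k) x\<bar> powr p) \<partial>M) \<le> ennreal e" .
    qed
    also have "\<dots> = ennreal e" by (simp add: Liminf_const)
    finally show ?thesis .
  qed
  have fgint: "\<exists>N0. \<forall>j\<ge>N0. integrable M (\<lambda>x. \<bar>f j x - g x\<bar> powr p) \<and>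
      (\<integral>x. \<bar>f j x - g x\<bar> powr p \<partial>M) \<le> e" if e: "0 < e" for e
  proof -
    obtain N0 where N0: "\<forall>j\<ge>N0. \<forall>k\<ge>N0. (\<integral>x. \<bar>f j x - f k x\<bar> powr p \<partial>M) < e"
      using cauchy[OF e] by blast
    have "integrable M (\<lambda>x. \<bar>f j x - g x\<bar> powr p) \<and> (\<integral>x. \<bar>f j x - g x\<bar> powr p \<partial>M) \<le> e"
      if "N0 \<le> j" for j
    proof
      have le: "(\<integral>\<^sup>+x. ennreal (\<bar>f j x - g x\<bar> powr p) \<partial>M) \<le> ennreal e"
        by (rule fatou[OF N0 that])
      show I: "integrable M (\<lambda>x. \<bar>f j x - g x\<bar> powr p)"
        by (rule integrableI_nonneg) (use le in \<open>auto simp: less_top intro: le_less_trans\<close>)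
      have "(\<integral>\<^sup>+x. ennreal (\<bar>f j x - g x\<bar> powr p) \<partial>M) = ennreal (\<integral>x. \<bar>f j x - g x\<bar> powr p \<partial>M)"
        using I by (intro nn_integral_eq_integral) auto
      with le e show "(\<integral>x. \<bar>f j x - g x\<bar> powr p \<partial>M) \<le> e" by simp
    qed
    then show ?thesis by blast
  qed
  obtain j where j: "integrable M (\<lambda>x. \<bar>f j x - g x\<bar> powr p)" using fgint[of 1] by auto
  have "integrable M (\<lambda>x. \<bar>f j x + - (f j x - g x)\<bar> powr p)"
    by (rule integrable_powr_add[OF p]) (use j int in \<open>auto simp: abs_minus_commute\<close>)
  then have gi: "integrable M (\<lambda>x. \<bar>g x\<bar> powr p)" by simp
  have "(\<lambda>j. \<integral>x. \<bar>f j x - g x\<bar> powr p \<partial>M) \<longlonglongrightarrow> 0"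
  proof (rule LIMSEQ_I)
    fix e :: real assume e: "0 < e"
    obtain N0 where "\<forall>j\<ge>N0. (\<integral>x. \<bar>f j x - g x\<bar> powr p \<partial>M) \<le> e / 2" using fgint[of "e/2"] e by auto
    then have "\<forall>j\<ge>N0. norm ((\<integral>x. \<bar>f j x - g x\<bar> powr p \<partial>M) - 0) < e"
      using e by (auto simp: abs_of_nonneg)
    then show "\<exists>no. \<forall>n\<ge>no. norm ((\<integral>x. \<bar>f n x - g x\<bar> powr p \<partial>M) - 0) < e" by blast
  qed
  with gm gi show thesis by (rule that)
qed

subsection \<open>Banach spaces of classes of functions\<close>

abbreviation eq_on_AE :: "(real^'n::finite) set \<Rightarrow> (real^'n \<Rightarrow> real) \<Rightarrow> (real^'n \<Rightarrow> real) \<Rightarrow> bool" where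
  "eq_on_AE D f g \<equiv> AE x in lebesgue. x \<in> D \<longrightarrow> f x = g x"

lemma cls_eq_iff: "cls D f = cls D g \<longleftrightarrow> eq_on_AE D f g"
proof
  assume "cls D f = cls D g"
  then have "f \<in> cls D g" by (auto simp: cls_def)
  then show "eq_on_AE D f g" by (simp add: cls_def)
next
  assume fg: "eq_on_AE D f g"
  have "eq_on_AE D h f \<longleftrightarrow> eq_on_AE D h g" for h
  proof
    show "eq_on_AE D h g" if "eq_on_AE D h f"
      using that fg by eventually_elim auto
    show "eq_on_AE D h f" if "eq_on_AE D h g"
      using that fg by eventually_elim auto
  qed
  then show "cls D f = cls D g" by (auto simp: cls_def)
qed

lemma rep_cls: "eq_on_AE D (rep (cls D f)) f"
proof -
  have "f \<in> cls D f" by (simp add: cls_def)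
  then have "rep (cls D f) \<in> cls D f" unfolding rep_def by (auto simp: some_in_eq)
  then show ?thesis by (simp add: cls_def)
qed

text \<open>\<open>Lp_space\<close>, \<open>W0_space\<close> and the finite-dimensional span of
  bumps share their operations on classes; only the set of admissible functions and the norm of a
  representative change.\<close>

definition fspace :: "(real^'n::finite) set \<Rightarrow> (real^'n \<Rightarrow> real) set \<Rightarrow> ((real^'n \<Rightarrow> real) \<Rightarrow> real)
    \<Rightarrow> (real^'n \<Rightarrow> real) set nspace" where
  "fspace D V N = \<lparr> vcarrier = {cls D f | f. f \<in> V},
     vzero = cls D (\<lambda>_. 0),
     vadd = (\<lambda>C1 C2. cls D (\<lambda>x. rep C1 x + rep C2 x)),
     vscale = (\<lambda>c C. cls D (\<lambda>x. c * rep C x)),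
     vnorm = (\<lambda>C. N (rep C)) \<rparr>"

lemma fspace_simps [simp]:
  "vcarrier (fspace D V N) = cls D ` V"
  "vzero (fspace D V N) = cls D (\<lambda>_. 0)"
  "vnorm (fspace D V N) C = N (rep C)"
  by (auto simp: fspace_def)

lemma fspace_add [simp]: "vadd (fspace D V N) (cls D f) (cls D g) = cls D (\<lambda>x. f x + g x)"
  unfolding fspace_def using rep_cls[of D f] rep_cls[of D g] by (auto simp: cls_eq_iff)

lemma fspace_scale [simp]: "vscale (fspace D V N) c (cls D f) = cls D (\<lambda>x. c * f x)"
  unfolding fspace_def using rep_cls[of D f] by (auto simp: cls_eq_iff)

lemma fspace_sub [simp]: "vsub (fspace D V N) (cls D f) (cls D g) = cls D (\<lambda>x. f x - g x)"
  by (simp add: vsub_def)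

text \<open>The Banach space axioms on the level of functions instead of classes.
  \<open>AE_mem\<close> and \<open>AE_norm\<close> are the price for this: \<open>rep\<close> picks
  an unknown member of a class, determined only up to a null set.\<close>

locale function_space =
  fixes D :: "(real^'n::finite) set" and V :: "(real^'n \<Rightarrow> real) set" and N :: "(real^'n \<Rightarrow> real) \<Rightarrow> real"
  assumes zero_mem: "(\<lambda>_. 0) \<in> V"
    and add_mem: "\<And>f g. f \<in> V \<Longrightarrow> g \<in> V \<Longrightarrow> (\<lambda>x. f x + g x) \<in> V"
    and scale_mem: "\<And>f c. f \<in> V \<Longrightarrow> (\<lambda>x. c * f x) \<in> V"
    and AE_mem: "\<And>f g. f \<in> V \<Longrightarrow> eq_on_AE D f g \<Longrightarrow> g \<in> V"
    and AE_norm: "\<And>f g. f \<in> V \<Longrightarrow> eq_on_AE D f g \<Longrightarrow> N g = N f"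
    and norm_nonneg: "\<And>f. f \<in> V \<Longrightarrow> 0 \<le> N f"
    and norm_zero_iff: "\<And>f. f \<in> V \<Longrightarrow> N f = 0 \<longleftrightarrow> eq_on_AE D f (\<lambda>_. 0)"
    and norm_scale: "\<And>f c. f \<in> V \<Longrightarrow> N (\<lambda>x. c * f x) = \<bar>c\<bar> * N f"
    and norm_triangle: "\<And>f g. f \<in> V \<Longrightarrow> g \<in> V \<Longrightarrow> N (\<lambda>x. f x + g x) \<le> N f + N g"
    and norm_complete: "\<And>f :: nat \<Rightarrow> _. (\<And>j. f j \<in> V) \<Longrightarrow>
      (\<And>e. 0 < e \<Longrightarrow> \<exists>M. \<forall>j\<ge>M. \<forall>k\<ge>M. N (\<lambda>x. f j x - f k x) < e) \<Longrightarrow>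
      \<exists>g\<in>V. (\<lambda>j. N (\<lambda>x. f j x - g x)) \<longlonglongrightarrow> 0"
begin

lemma rep_mem: "f \<in> V \<Longrightarrow> rep (cls D f) \<in> V"
  using AE_mem[of f "rep (cls D f)"] rep_cls[of D f] by (simp add: eq_commute)

lemma norm_rep [simp]: "f \<in> V \<Longrightarrow> N (rep (cls D f)) = N f"
  using AE_norm[of f "rep (cls D f)"] rep_cls[of D f] by (simp add: eq_commute)

lemma diff_mem: "f \<in> V \<Longrightarrow> g \<in> V \<Longrightarrow> (\<lambda>x. f x - g x) \<in> V"
  using add_mem[of f "\<lambda>x. (-1) * g x"] scale_mem[of g "-1"] by simp

lemma banach_fspace: "banach (fspace D V N)"
proof -
  have "\<exists>x\<in>vcarrier (fspace D V N). (\<lambda>j. vnorm (fspace D V N) (vsub (fspace D V N) (F j) x)) \<longlonglongrightarrow> 0"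
    if F: "\<And>j. F j \<in> vcarrier (fspace D V N)"
      and C: "\<forall>e>0. \<exists>M. \<forall>j\<ge>M. \<forall>k\<ge>M. vnorm (fspace D V N) (vsub (fspace D V N) (F j) (F k)) < e"
    for F :: "nat \<Rightarrow> _"
  proof -
    have "\<exists>f. \<forall>j. F j = cls D (f j) \<and> f j \<in> V" using F by (intro choice) auto
    then obtain f where f: "\<And>j. F j = cls D (f j)" "\<And>j. f j \<in> V" by blast
    have "\<exists>g\<in>V. (\<lambda>j. N (\<lambda>x. f j x - g x)) \<longlonglongrightarrow> 0"
      by (rule norm_complete) (use C f diff_mem in auto)
    then obtain g where "g \<in> V" "(\<lambda>j. N (\<lambda>x. f j x - g x)) \<longlonglongrightarrow> 0" by blast
    then show ?thesis using f diff_mem by (intro bexI[of _ "cls D g"]) auto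
  qed
  then show ?thesis
    unfolding banach_def
    by (auto simp: zero_mem add_mem scale_mem norm_nonneg norm_scale norm_triangle norm_zero_iff
        cls_eq_iff algebra_simps intro!: imageI zero_mem add_mem scale_mem)
qed

end

section \<open>Operator norms as suprema over the unit ball\<close>

lemma opnorm_le:
  assumes C: "0 \<le> C" and T: "\<And>x. x \<in> vcarrier X \<Longrightarrow> vnorm Y (T x) \<le> C * vnorm X x"
    and z: "z \<in> vcarrier X" "vnorm X z \<le> 1"
  shows "opnorm X Y T \<le> C"
  unfolding opnorm_def
proof (rule cSup_least)
  show "{vnorm Y (T x) | x. x \<in> vcarrier X \<and> vnorm X x \<le> 1} \<noteq> {}" using z by blast
next
  fix r assume "r \<in> {vnorm Y (T x) | x. x \<in> vcarrier X \<and> vnorm X x \<le> 1}"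
  then obtain x where x: "r = vnorm Y (T x)" "x \<in> vcarrier X" "vnorm X x \<le> 1" by blast
  have "r \<le> C * vnorm X x" using T x by simp
  also have "\<dots> \<le> C * 1" using C x by (intro mult_left_mono) auto
  finally show "r \<le> C" by simp
qed

lemma le_opnorm:
  assumes T: "\<And>x. x \<in> vcarrier X \<Longrightarrow> vnorm Y (T x) \<le> C * vnorm X x"
    and nn: "\<And>x. x \<in> vcarrier X \<Longrightarrow> 0 \<le> vnorm X x"
    and x: "x \<in> vcarrier X" "vnorm X x \<le> 1"
  shows "vnorm Y (T x) \<le> opnorm X Y T"
  unfolding opnorm_def
proof (rule cSup_upper)
  show "vnorm Y (T x) \<in> {vnorm Y (T x) | x. x \<in> vcarrier X \<and> vnorm X x \<le> 1}" using x by blast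
  have "vnorm Y (T y) \<le> \<bar>C\<bar>" if "y \<in> vcarrier X" "vnorm X y \<le> 1" for y
  proof -
    have "vnorm Y (T y) \<le> C * vnorm X y" using T that by blast
    also have "\<dots> \<le> \<bar>C\<bar> * 1" using that nn by (intro mult_mono) auto
    finally show ?thesis by simp
  qed
  then show "bdd_above {vnorm Y (T x) | x. x \<in> vcarrier X \<and> vnorm X x \<le> 1}"
    by (auto simp: bdd_above_def)
qed

subsection \<open>Smooth functions and integration by parts\<close>

text \<open>The derivative is an existential witness rather than \<open>deriv\<close>, so closure
  under sums, products and affine substitutions is an induction in which the derivative is written
  down explicitly.\<close>

primrec times_differentiable :: "nat \<Rightarrow> (real \<Rightarrow> real) \<Rightarrow> bool" where
  "times_differentiable 0 f = True"
| "times_differentiable (Suc k) f =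
    (\<exists>f'. (\<forall>x. (f has_real_derivative f' x) (at x)) \<and> times_differentiable k f')"

definition smooth_real :: "(real \<Rightarrow> real) \<Rightarrow> bool" where
  "smooth_real f \<longleftrightarrow> (\<forall>k. times_differentiable k f)"

lemma times_differentiable_Suc: "times_differentiable (Suc k) f \<Longrightarrow> times_differentiable k f"
  by (induction k arbitrary: f) auto

text \<open>Read from right to left, a primitive of a smooth function is smooth. In this form it
  yields the one-dimensional test functions, which are constructed from their derivatives.\<close>

lemma smooth_real_iff:
  assumes "\<And>x. (f has_real_derivative f' x) (at x)"
  shows "smooth_real f \<longleftrightarrow> smooth_real f'"
proof
  assume f: "smooth_real f"
  show "smooth_real f'"
    unfolding smooth_real_def
  proof
    fix k
    have "times_differentiable (Suc k) f" using f by (simp only: smooth_real_def)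
    then obtain g where "\<forall>x. (f has_real_derivative g x) (at x)" "times_differentiable k g" by auto
    moreover from this assms have "g = f'" by (auto intro!: ext DERIV_unique)
    ultimately show "times_differentiable k f'" by simp
  qed
next
  assume f': "smooth_real f'"
  show "smooth_real f"
    unfolding smooth_real_def
  proof
    fix k
    have "times_differentiable (Suc k) f" using f' assms by (auto simp: smooth_real_def)
    then show "times_differentiable k f" by (rule times_differentiable_Suc)
  qed
qed

lemma smooth_real_deriv:
  assumes "smooth_real f"
  shows "(f has_real_derivative deriv f x) (at x)" and "smooth_real (deriv f)"
proof -
  have "times_differentiable (Suc 0) f" using assms by (simp only: smooth_real_def)
  then show d: "(f has_real_derivative deriv f x) (at x)" for x
    using DERIV_deriv_iff_real_differentiable real_differentiable_def by fastforce
  show "smooth_real (deriv f)" using smooth_real_iff[of f "deriv f"] d assms by blast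
qed

lemma smooth_real_continuous: "smooth_real f \<Longrightarrow> continuous_on A f"
  by (intro continuous_at_imp_continuous_on ballI DERIV_isCont[OF smooth_real_deriv(1)])

lemma smooth_real_const: "smooth_real (\<lambda>_. c)"
proof -
  have z: "times_differentiable k (\<lambda>_. 0)" for k
    by (induction k) (auto intro!: exI[of _ "\<lambda>_. 0"])
  then have "smooth_real (\<lambda>_. 0)" by (simp add: smooth_real_def)
  then show ?thesis using smooth_real_iff[of "\<lambda>_. c" "\<lambda>_. 0"] by simp
qed

lemma times_differentiable_add:
  "times_differentiable k f \<Longrightarrow> times_differentiable k g \<Longrightarrow> times_differentiable k (\<lambda>x. f x + g x)"
proof (induction k arbitrary: f g)
  case (Suc k)
  then obtain f' g' where "\<forall>x. (f has_real_derivative f' x) (at x)" "times_differentiable k f'"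
    "\<forall>x. (g has_real_derivative g' x) (at x)" "times_differentiable k g'" by auto
  with Suc.IH show ?case
    by (auto intro!: exI[of _ "\<lambda>x. f' x + g' x"] derivative_eq_intros)
qed simp

lemma times_differentiable_mult:
  "times_differentiable k f \<Longrightarrow> times_differentiable k g \<Longrightarrow> times_differentiable k (\<lambda>x. f x * g x)"
proof (induction k arbitrary: f g)
  case (Suc k)
  then obtain f' g' where d: "\<forall>x. (f has_real_derivative f' x) (at x)" "times_differentiable k f'"
    "\<forall>x. (g has_real_derivative g' x) (at x)" "times_differentiable k g'" by auto
  have "times_differentiable k (\<lambda>x. f' x * g x + f x * g' x)"
    using Suc d times_differentiable_Suc by (intro times_differentiable_add Suc.IH) blast+
  moreover have "\<forall>x. ((\<lambda>x. f x * g x) has_real_derivative f' x * g x + f x * g' x) (at x)"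
    using d by (auto intro!: derivative_eq_intros)
  ultimately show ?case by auto
qed simp

lemma smooth_real_add: "smooth_real f \<Longrightarrow> smooth_real g \<Longrightarrow> smooth_real (\<lambda>x. f x + g x)"
  by (simp add: smooth_real_def times_differentiable_add)

lemma smooth_real_mult: "smooth_real f \<Longrightarrow> smooth_real g \<Longrightarrow> smooth_real (\<lambda>x. f x * g x)"
  by (simp add: smooth_real_def times_differentiable_mult)

lemma smooth_real_affine:
  assumes "smooth_real f"
  shows "smooth_real (\<lambda>x. f (c * x + b))"
proof -
  have scale: "times_differentiable k f \<Longrightarrow> times_differentiable k (\<lambda>x. a * f x)" for k f and a :: real
  proof (induction k arbitrary: f)
    case (Suc k)
    then obtain f' where "\<forall>x. (f has_real_derivative f' x) (at x)" "times_differentiable k f'" by auto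
    with Suc.IH show ?case by (auto intro!: exI[of _ "\<lambda>x. a * f' x"] derivative_eq_intros)
  qed simp
  have "times_differentiable k f \<Longrightarrow> times_differentiable k (\<lambda>x. f (c * x + b))" for k
  proof (induction k arbitrary: f)
    case (Suc k)
    then obtain f' where d: "\<forall>x. (f has_real_derivative f' x) (at x)" "times_differentiable k f'" by auto
    have "((\<lambda>x. f (c * x + b)) has_real_derivative c * f' (c * x + b)) (at x)" for x
    proof -
      have "((\<lambda>x. c * x + b) has_real_derivative c) (at x)" by (auto intro!: derivative_eq_intros)
      from DERIV_chain2[OF d(1)[rule_format] this] show ?thesis by (simp add: mult.commute)
    qed
    with scale Suc.IH d show ?case by (auto intro!: exI[of _ "\<lambda>x. c * f' (c * x + b)"])
  qed simp
  with assms show ?thesis by (simp add: smooth_real_def)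
qed

lemma smooth_real_polynomial:
  "real_polynomial_function P \<Longrightarrow> smooth_real P" for P :: "real \<Rightarrow> real"
proof (induction rule: real_polynomial_function.induct)
  case (linear f)
  have eq: "(\<lambda>x. x * f 1) = f"
  proof
    fix x
    show "x * f 1 = f x" using linear_scale[OF bounded_linear.linear[OF linear], of x 1] by simp
  qed
  have "((\<lambda>x. x * c) has_real_derivative c) (at x)" for x c :: real
    by (auto intro!: derivative_eq_intros)
  from smooth_real_iff[OF this] have "smooth_real (\<lambda>x. x * f 1)" using smooth_real_const by blast
  then show ?case unfolding eq .
qed (auto intro: smooth_real_const smooth_real_add smooth_real_mult)

section \<open>The flat function \<open>exp (- 1 / x)\<close>\<close>

definition flat_exp :: "real \<Rightarrow> real" where
  "flat_exp x = (if 0 < x then exp (- (1 / x)) else 0)"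

lemma flat_exp_bounds: "0 \<le> flat_exp x" "flat_exp x \<le> 1"
  by (auto simp: flat_exp_def)

lemma poly_div_exp_tendsto_0: "((\<lambda>y. poly P y * exp (- y)) \<longlongrightarrow> 0) at_top" for P :: "real poly"
proof -
  have "((\<lambda>y. y ^ k * poly P y * exp (- y)) \<longlongrightarrow> 0) at_top" for k
  proof (induction P arbitrary: k)
    case (pCons a P)
    have "((\<lambda>y. a * (y ^ k / exp y) + y ^ Suc k * poly P y * exp (- y)) \<longlongrightarrow> a * 0 + 0) at_top"
      by (intro tendsto_add tendsto_mult tendsto_const tendsto_power_div_exp_0 pCons.IH)
    then show ?case by (simp add: field_simps exp_minus)
  qed simp
  from this[of 0] show ?thesis by simp
qed

text \<open>The functions \<open>P (1 / x) * exp (- 1 / x)\<close> with a polynomial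
  \<open>P\<close>, extended by 0, are closed under differentiation: the derivative belongs to the
  polynomial \<open>X^2 * (P - P')\<close>. One induction on the order then covers all
  \<open>P\<close> at once.\<close>

lemma smooth_flat_exp: "smooth_real flat_exp"
proof -
  define F where "F P x = (if 0 < x then poly P (1 / x) * exp (- (1 / x)) else 0)" for P :: "real poly" and x :: real
  have D: "(F P has_real_derivative F ([:0, 0, 1:] * (P - pderiv P)) x) (at x)" for P x
  proof -
    consider "x < 0" | "x > 0" | "x = 0" by linarith
    then show ?thesis
    proof cases
      case 1
      then have "((\<lambda>_. 0) has_real_derivative F ([:0, 0, 1:] * (P - pderiv P)) x) (at x)"
        by (simp add: F_def)
      then show ?thesis
        by (rule has_field_derivative_transform_within_open[of _ _ _ "{..<0}"]) (use 1 in \<open>auto simp: F_def\<close>)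
    next
      case 2
      have "((\<lambda>x. poly P (1 / x) * exp (- (1 / x))) has_real_derivative
          F ([:0, 0, 1:] * (P - pderiv P)) x) (at x)"
        using 2 by (auto intro!: derivative_eq_intros DERIV_chain2[OF poly_DERIV] simp: F_def field_simps power2_eq_square)
      then show ?thesis
        by (rule has_field_derivative_transform_within_open[of _ _ _ "{0<..}"]) (use 2 in \<open>auto simp: F_def\<close>)
    next
      case 3
      have "((\<lambda>h. F P h / h) \<longlongrightarrow> 0) (at 0)"
      proof (rule filterlim_split_at_real)
        show "((\<lambda>h. F P h / h) \<longlongrightarrow> 0) (at_left 0)"
          by (rule tendsto_eventually) (auto simp: F_def eventually_at_filter)
        \<comment> \<open>Division by \<open>h\<close> multiplies the polynomial in
          \<open>1 / h\<close> by its variable, whence \<open>pCons 0 P\<close>.\<close>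
        have "((\<lambda>h. poly (pCons 0 P) (inverse h) * exp (- inverse h)) \<longlongrightarrow> 0) (at_right 0)"
          by (rule filterlim_compose[OF poly_div_exp_tendsto_0 filterlim_inverse_at_top_right])
        then show "((\<lambda>h. F P h / h) \<longlongrightarrow> 0) (at_right 0)"
          by (rule Lim_transform_eventually)
             (auto simp: eventually_at_filter F_def field_simps inverse_eq_divide)
      qed
      then show ?thesis using 3 by (simp add: has_field_derivative_iff F_def)
    qed
  qed
  have "times_differentiable k (F P)" for k P
    by (induction k arbitrary: P) (auto intro: D)
  then have "smooth_real (F 1)" by (simp add: smooth_real_def)
  moreover have "F 1 = flat_exp" by (auto simp: F_def flat_exp_def)
  ultimately show ?thesis by simp
qed

section \<open>Partial derivatives of smooth and compactly supported functions\<close>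

lemma smooth_partial:
  assumes "smooth f"
  shows "((\<lambda>t. iterpd is f (x + t *\<^sub>R axis i 1)) has_real_derivative pd i (iterpd is f) x) (at 0)"
  using assms unfolding smooth_def pd_def by (simp add: DERIV_deriv_iff_real_differentiable)

lemma smooth_partial1:
  assumes "smooth f"
  shows "((\<lambda>t. f (x + t *\<^sub>R axis i 1)) has_real_derivative pd i f x) (at 0)"
  using smooth_partial[OF assms, of "[]"] by simp

lemma smooth_iterpd_continuous: "smooth f \<Longrightarrow> continuous_on UNIV (iterpd is f)"
  unfolding smooth_def by blast

lemma smooth_continuous: "smooth f \<Longrightarrow> continuous_on UNIV f"
  using smooth_iterpd_continuous[of f "[]"] by simp

lemma smooth_pd_continuous: "smooth f \<Longrightarrow> continuous_on UNIV (pd i f)"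
  using smooth_iterpd_continuous[of f "[i]"] by simp

lemma pd_eqI: "((\<lambda>t. f (x + t *\<^sub>R axis i 1)) has_real_derivative d) (at 0) \<Longrightarrow> pd i f x = d"
  unfolding pd_def by (rule DERIV_imp_deriv)

lemma smooth_combine:
  assumes f: "smooth f" and g: "smooth g"
  shows "smooth (\<lambda>x. a * f x + b * g x)"
proof -
  have D: "((\<lambda>t. a * iterpd is f (x + t *\<^sub>R axis i 1) + b * iterpd is g (x + t *\<^sub>R axis i 1))
      has_real_derivative a * pd i (iterpd is f) x + b * pd i (iterpd is g) x) (at 0)" for "is" x i
    by (intro DERIV_add DERIV_cmult smooth_partial f g)
  have eq: "iterpd is (\<lambda>x. a * f x + b * g x) = (\<lambda>x. a * iterpd is f x + b * iterpd is g x)" for "is"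
    by (induction "is") (auto intro!: ext pd_eqI D)
  show ?thesis
    unfolding smooth_def eq
  proof (intro allI conjI)
    fix "is" i x
    show "continuous_on UNIV (\<lambda>x. a * iterpd is f x + b * iterpd is g x)"
      using f g by (auto simp: smooth_def intro!: continuous_intros)
    show "(\<lambda>t. a * iterpd is f (x + t *\<^sub>R axis i 1) + b * iterpd is g (x + t *\<^sub>R axis i 1)) differentiable at 0"
      using D real_differentiable_def by blast
  qed
qed

lemma pd_combine:
  assumes "smooth f" "smooth g"
  shows "pd i (\<lambda>x. a * f x + b * g x) x = a * pd i f x + b * pd i g x"
  by (intro pd_eqI DERIV_add DERIV_cmult smooth_partial1 assms)

lemma Ccinf_combine:
  assumes f: "Ccinf D f" and g: "Ccinf D g"
  shows "Ccinf D (\<lambda>x. a * f x + b * g x)"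
proof -
  have "closure {x. a * f x + b * g x \<noteq> 0} \<subseteq> closure ({x. f x \<noteq> 0} \<union> {x. g x \<noteq> 0})"
    by (intro closure_mono) auto
  then have sub: "closure {x. a * f x + b * g x \<noteq> 0} \<subseteq> closure {x. f x \<noteq> 0} \<union> closure {x. g x \<noteq> 0}"
    by simp
  moreover have "compact (closure {x. f x \<noteq> 0} \<union> closure {x. g x \<noteq> 0})"
    using f g by (simp add: Ccinf_def compact_Un)
  ultimately have "compact (closure {x. a * f x + b * g x \<noteq> 0})"
    by (meson bounded_subset closed_closure compact_eq_bounded_closed)
  with sub f g show ?thesis unfolding Ccinf_def by (auto intro: smooth_combine)
qed

lemma Ccinf_zero: "Ccinf D (\<lambda>_. 0)"
proof -
  have "iterpd is (\<lambda>_. 0) = (\<lambda>_. 0)" for "is" :: "'a list"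
    by (induction "is") (auto intro!: ext pd_eqI)
  then show ?thesis by (simp add: Ccinf_def smooth_def)
qed

text \<open>The complement of the closed set is open, so a short segment through \<open>x\<close>
  avoids \<open>K\<close> and the function is constantly 0 along it.\<close>

lemma pd_eq_0:
  assumes "\<And>x. x \<notin> K \<Longrightarrow> f x = 0" "closed K" "x \<notin> K"
  shows "pd i f x = 0"
proof (rule pd_eqI)
  show "((\<lambda>t. f (x + t *\<^sub>R axis i 1)) has_real_derivative 0) (at 0)"
  proof (rule has_field_derivative_transform_within_open[of "\<lambda>_. 0"])
    show "open ((\<lambda>t::real. x + t *\<^sub>R axis i 1) -` (- K))"
      by (intro open_vimage continuous_intros) (use assms in auto)
  qed (use assms in auto)
qed

lemma Ccinf_support:
  assumes "Ccinf D f"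
  obtains K where "compact K" "K \<subseteq> D" "\<And>x. x \<notin> K \<Longrightarrow> f x = 0" "\<And>x i. x \<notin> K \<Longrightarrow> pd i f x = 0"
proof
  let ?K = "closure {x. f x \<noteq> 0}"
  show "compact ?K" "?K \<subseteq> D" using assms by (auto simp: Ccinf_def)
  show z: "f x = 0" if "x \<notin> ?K" for x using that closure_subset[of "{x. f x \<noteq> 0}"] by auto
  show "pd i f x = 0" if "x \<notin> ?K" for x i
    by (rule pd_eq_0[OF z]) (use that in auto)
qed

lemma Ccinf_smooth: "Ccinf D f \<Longrightarrow> smooth f"
  by (simp add: Ccinf_def)

section \<open>Integrals of partial derivatives over the whole space\<close>

lemma lborel_integral_shift:
  fixes F :: "'a::euclidean_space \<Rightarrow> real"
  assumes [measurable]: "F \<in> borel_measurable borel"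
  shows "(\<integral>x. F (x + c) \<partial>lborel) = (\<integral>x. F x \<partial>lborel)"
proof -
  have "(\<integral>x. F x \<partial>lborel) = (\<integral>x. F x \<partial>distr lborel borel ((+) c))"
    by (simp add: lborel_distr_plus)
  also have "\<dots> = (\<integral>x. F (c + x) \<partial>lborel)" by (subst integral_distr) auto
  finally show ?thesis by (simp add: add.commute)
qed

lemma integrable_bounded_support:
  fixes F :: "'a::euclidean_space \<Rightarrow> real"
  assumes [measurable]: "F \<in> borel_measurable borel"
    and bd: "\<And>x. \<bar>F x\<bar> \<le> C" and supp: "\<And>x. x \<notin> cball 0 R \<Longrightarrow> F x = 0"
  shows "integrable lborel F"
proof (rule Bochner_Integration.integrable_bound)
  show "integrable lborel (\<lambda>x::'a. C * indicat_real (cball 0 R) x)"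
    using emeasure_lborel_cball_finite[of "0::'a" R] by (auto simp: less_top)
  show "AE x in lborel. norm (F x) \<le> norm (C * indicat_real (cball 0 R) x)"
    using bd supp by (auto intro!: AE_I2 simp: indicator_def) (meson abs_ge_self order_trans)
qed simp

text \<open>Translation invariance replaces Fubini and the fundamental theorem of calculus: every
  difference quotient has integral 0, the mean value theorem bounds it by \<open>C\<close>, and
  dominated convergence passes to the derivative. Of \<open>F'\<close> only a pointwise bound is
  asked, and its measurability comes from the limit, which suits derivatives that contain
  \<open>sgn\<close>.\<close>

lemma integral_partial_derivative:
  fixes F F' :: "real^'n::finite \<Rightarrow> real"
  assumes D: "\<And>x. ((\<lambda>t. F (x + t *\<^sub>R axis i 1)) has_real_derivative F' x) (at 0)"
    and cont: "continuous_on UNIV F"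
    and supp: "\<And>x. x \<notin> cball 0 R \<Longrightarrow> F x = 0"
    and bd: "\<And>x. \<bar>F' x\<bar> \<le> C"
  shows "integrable lborel F'" and "(\<integral>x. F' x \<partial>lborel) = 0"
proof -
  define e where "e = (axis i 1 :: real^'n)"
  have ne: "norm e = 1" by (simp add: e_def)
  have [measurable]: "F \<in> borel_measurable borel" by (rule borel_measurable_continuous_onI[OF cont])
  define q where "q k x = (F (x + (1 / real (Suc k)) *\<^sub>R e) - F x) * real (Suc k)" for k x
  have [measurable]: "q k \<in> borel_measurable borel" for k unfolding q_def by measurable
  have lim: "(\<lambda>k. q k x) \<longlonglongrightarrow> F' x" for x
  proof -
    have "((\<lambda>h. (F (x + h *\<^sub>R e) - F x) / h) \<longlongrightarrow> F' x) (at 0)"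
      using D[of x] by (simp add: has_field_derivative_iff e_def)
    moreover have "filterlim (\<lambda>k. 1 / real (Suc k)) (at 0) sequentially"
      using LIMSEQ_inverse_real_of_nat by (auto simp: filterlim_at inverse_eq_divide)
    ultimately have "(\<lambda>k. (F (x + (1 / real (Suc k)) *\<^sub>R e) - F x) / (1 / real (Suc k))) \<longlonglongrightarrow> F' x"
      by (rule filterlim_compose)
    then show ?thesis by (simp add: q_def del: of_nat_Suc)
  qed
  have [measurable]: "F' \<in> borel_measurable borel"
    by (rule borel_measurable_LIMSEQ_real[OF lim]) simp
  \<comment> \<open>The hypothesis speaks of the parameter 0 only; applied at shifted points it
    gives the derivative along the whole line.\<close>
  have D': "((\<lambda>t. F (x + t *\<^sub>R e)) has_real_derivative F' (x + s *\<^sub>R e)) (at s)" for x s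
    using D[of "x + s *\<^sub>R e"] DERIV_shift[of "\<lambda>t. F (x + t *\<^sub>R e)" "F' (x + s *\<^sub>R e)" 0 s]
    by (simp add: e_def algebra_simps scaleR_add_left)
  have qb: "\<bar>q k x\<bar> \<le> C" for k x
  proof -
    have "\<exists>z>0. z < 1 / real (Suc k) \<and> F (x + (1 / real (Suc k)) *\<^sub>R e) - F (x + 0 *\<^sub>R e)
        = (1 / real (Suc k) - 0) * F' (x + z *\<^sub>R e)"
      by (rule MVT2[where f = "\<lambda>t. F (x + t *\<^sub>R e)"]) (use D' in auto)
    then obtain z where "F (x + (1 / real (Suc k)) *\<^sub>R e) - F x = (1 / real (Suc k)) * F' (x + z *\<^sub>R e)"
      by auto
    then have "q k x = F' (x + z *\<^sub>R e)" by (simp add: q_def del: of_nat_Suc)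
    then show ?thesis using bd by simp
  qed
  \<comment> \<open>Steps have length at most 1, so all quotients live in the ball of radius
    \<open>R + 1\<close>, which makes the dominating function integrable.\<close>
  have qs: "q k x = 0" if "x \<notin> cball 0 (R + 1)" for k x
  proof -
    have "norm x \<le> norm (x + (1 / real (Suc k)) *\<^sub>R e) + norm ((1 / real (Suc k)) *\<^sub>R e)"
      by (metis add_diff_cancel norm_triangle_ineq4)
    also have "norm ((1 / real (Suc k)) *\<^sub>R e) \<le> 1" by (simp add: ne del: of_nat_Suc)
    finally have "x + (1 / real (Suc k)) *\<^sub>R e \<notin> cball 0 R" "x \<notin> cball 0 R" using that by auto
    then show ?thesis using supp by (simp add: q_def)
  qed
  have F's: "F' x = 0" if "x \<notin> cball 0 (R + 1)" for x
    using LIMSEQ_unique[OF lim[of x]] qs[OF that] by simp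
  show "integrable lborel F'"
    by (rule integrable_bounded_support[OF _ bd F's]) simp_all
  have Fi: "integrable lborel F"
  proof -
    have "bounded (F ` cball 0 R)"
      by (intro compact_imp_bounded compact_continuous_image) (auto intro: continuous_on_subset[OF cont])
    then obtain B where B: "\<forall>x\<in>cball 0 R. \<bar>F x\<bar> \<le> B" by (auto simp: bounded_iff)
    have "\<bar>F x\<bar> \<le> max B 0" for x using B supp[of x] by (cases "x \<in> cball 0 R") (fastforce simp: le_max_iff_disj)+
    then show ?thesis by (rule integrable_bounded_support[OF _ _ supp, rotated]) simp_all
  qed
  have "(\<integral>x. q k x \<partial>lborel) = 0" for k
  proof -
    have Fs: "integrable lborel (\<lambda>x. F (x + (1 / real (Suc k)) *\<^sub>R e))"
    proof -
      have "integrable (distr lborel borel ((+) ((1 / real (Suc k)) *\<^sub>R e))) F"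
        using Fi by (simp only: lborel_distr_plus)
      then show ?thesis by (subst (asm) integrable_distr_eq) (auto simp: add.commute)
    qed
    have "(\<integral>x. q k x \<partial>lborel)
        = ((\<integral>x. F (x + (1 / real (Suc k)) *\<^sub>R e) \<partial>lborel) - (\<integral>x. F x \<partial>lborel)) * real (Suc k)"
      unfolding q_def using Fi Fs by simp
    also have "\<dots> = 0" by (subst lborel_integral_shift) auto
    finally show ?thesis .
  qed
  moreover have "(\<lambda>k. \<integral>x. q k x \<partial>lborel) \<longlonglongrightarrow> (\<integral>x. F' x \<partial>lborel)"
  proof (rule integral_dominated_convergence)
    show "integrable lborel (\<lambda>x::real^'n. C * indicat_real (cball 0 (R + 1)) x)"
      using emeasure_lborel_cball_finite[of "0::real^'n" "R + 1"] by (auto simp: less_top)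
    show "AE x in lborel. norm (q k x) \<le> C * indicat_real (cball 0 (R + 1)) x" for k
      using qb[of k] qs[of _ k] by (auto intro!: AE_I2 simp: indicator_def)
  qed (use lim in auto)
  ultimately show "(\<integral>x. F' x \<partial>lborel) = 0" by (simp add: LIMSEQ_const_iff)
qed

text \<open>Here \<open>d i k\<close> stands for the \<open>k\<close>-th derivative of the
  \<open>i\<close>-th factor. A mixed partial derivative of a product of one-variable functions
  depends only on how often each direction occurs, hence \<open>count_list\<close>; all iterated
  derivatives that \<open>smooth\<close> asks for thus have one closed form.\<close>

lemma iterpd_prod:
  fixes d :: "'n::finite \<Rightarrow> nat \<Rightarrow> real \<Rightarrow> real"
  assumes D: "\<And>i k y. (d i k has_real_derivative d i (Suc k) y) (at y)"
  shows "iterpd is (\<lambda>x. \<Prod>i\<in>UNIV. d i 0 (x $ i)) = (\<lambda>x. \<Prod>i\<in>UNIV. d i (count_list is i) (x $ i))"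
    and "smooth (\<lambda>x. \<Prod>i\<in>UNIV. d i 0 (x $ i))"
proof -
  have P: "((\<lambda>t. \<Prod>i\<in>UNIV. d i (c i) ((x + t *\<^sub>R axis j 1) $ i)) has_real_derivative
      (\<Prod>i\<in>UNIV. d i ((c(j := Suc (c j))) i) (x $ i))) (at 0)" for c j and x :: "real^'n"
  proof -
    have split: "(\<Prod>i\<in>UNIV. h i) = h j * (\<Prod>i\<in>UNIV - {j}. h i)" for h :: "'n \<Rightarrow> real"
      by (simp add: prod.remove)
    have "((\<lambda>t. d j (c j) (x $ j + t)) has_real_derivative d j (Suc (c j)) (x $ j)) (at 0)"
      using D[of j "c j" "x $ j"] DERIV_shift[of "d j (c j)" "d j (Suc (c j)) (x $ j)" 0 "x $ j"]
      by (simp add: add.commute)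
    from DERIV_cmult_right[OF this, of "\<Prod>i\<in>UNIV - {j}. d i (c i) (x $ i)"]
    moreover have "(\<Prod>i\<in>UNIV - {j}. d i (c i) ((x + t *\<^sub>R axis j 1) $ i)) = (\<Prod>i\<in>UNIV - {j}. d i (c i) (x $ i))" for t
      by (intro prod.cong) (auto simp: axis_def)
    moreover have "(\<Prod>i\<in>UNIV - {j}. d i ((c(j := Suc (c j))) i) (x $ i)) = (\<Prod>i\<in>UNIV - {j}. d i (c i) (x $ i))"
      by (intro prod.cong) auto
    ultimately show ?thesis by (simp only: split) (simp add: axis_def)
  qed
  show eq: "iterpd is (\<lambda>x. \<Prod>i\<in>UNIV. d i 0 (x $ i)) = (\<lambda>x. \<Prod>i\<in>UNIV. d i (count_list is i) (x $ i))" for "is"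
  proof (induction "is")
    case (Cons j js)
    have c: "((count_list js)(j := Suc (count_list js j))) = count_list (j # js)" by auto
    have "pd j (\<lambda>x. \<Prod>i\<in>UNIV. d i (count_list js i) (x $ i)) x
        = (\<Prod>i\<in>UNIV. d i (count_list (j # js) i) (x $ i))" for x
      using pd_eqI[OF P[where c = "count_list js" and x = x and j = j]] unfolding c .
    then show ?case by (simp only: iterpd.simps Cons)
  qed simp
  have cd: "continuous_on UNIV (d i k)" for i k
    using D by (meson DERIV_continuous continuous_at_imp_continuous_on)
  show "smooth (\<lambda>x. \<Prod>i\<in>UNIV. d i 0 (x $ i))"
    unfolding smooth_def eq
  proof (intro allI conjI)
    fix "is" i and x :: "real^'n"
    show "continuous_on UNIV (\<lambda>x. \<Prod>i\<in>UNIV. d i (count_list is i) (x $ i))"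
      by (intro continuous_on_prod continuous_on_compose2[OF cd] continuous_intros) auto
    show "(\<lambda>t. \<Prod>j\<in>UNIV. d j (count_list is j) ((x + t *\<^sub>R axis i 1) $ j)) differentiable at 0"
      using P real_differentiable_def by blast
  qed
qed

lemma smooth_prod:
  fixes g :: "'n::finite \<Rightarrow> real \<Rightarrow> real"
  assumes g: "\<And>i. smooth_real (g i)"
  shows "smooth (\<lambda>x. \<Prod>i\<in>UNIV. g i (x $ i))"
    and "pd j (\<lambda>x. \<Prod>i\<in>UNIV. g i (x $ i)) = (\<lambda>x. \<Prod>i\<in>UNIV. (if i = j then deriv (g i) else g i) (x $ i))"
proof -
  have s: "smooth_real ((deriv ^^ k) (g i))" for k i
    by (induction k) (auto intro: g smooth_real_deriv)
  have d: "((deriv ^^ k) (g i) has_real_derivative (deriv ^^ Suc k) (g i) y) (at y)" for k i y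
    using smooth_real_deriv(1)[OF s] by simp
  show "smooth (\<lambda>x. \<Prod>i\<in>UNIV. g i (x $ i))"
    using iterpd_prod(2)[of "\<lambda>i k. (deriv ^^ k) (g i)", OF d] by simp
  show "pd j (\<lambda>x. \<Prod>i\<in>UNIV. g i (x $ i)) = (\<lambda>x. \<Prod>i\<in>UNIV. (if i = j then deriv (g i) else g i) (x $ i))"
  proof -
    have "pd j (\<lambda>x. \<Prod>i\<in>UNIV. g i (x $ i)) = (\<lambda>x. \<Prod>i\<in>UNIV. (deriv ^^ count_list [j] i) (g i) (x $ i))"
      using iterpd_prod(1)[of "\<lambda>i k. (deriv ^^ k) (g i)" "[j]", OF d]
      by (simp only: iterpd.simps funpow_0)
    also have "\<dots> = (\<lambda>x. \<Prod>i\<in>UNIV. (if i = j then deriv (g i) else g i) (x $ i))"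
      by (intro ext prod.cong) auto
    finally show ?thesis .
  qed
qed

subsection \<open>\<open>L\<^sup>p\<close> on an open set\<close>

lemma integrable_compact_support:
  fixes F :: "'a::euclidean_space \<Rightarrow> real"
  assumes cont: "continuous_on UNIV F" and K: "compact K" and supp: "\<And>x. x \<notin> K \<Longrightarrow> F x = 0"
  shows "integrable lborel F"
proof -
  have "bounded (F ` K)"
    by (intro compact_imp_bounded compact_continuous_image continuous_on_subset[OF cont] K) auto
  then obtain B where B: "\<forall>x\<in>K. \<bar>F x\<bar> \<le> B" by (auto simp: bounded_iff)
  obtain R where R: "\<forall>x\<in>K. norm x \<le> R" using compact_imp_bounded[OF K] by (auto simp: bounded_iff)
  show ?thesis
  proof (rule integrable_bounded_support)
    show "F \<in> borel_measurable borel" by (rule borel_measurable_continuous_onI[OF cont])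
    show "\<bar>F x\<bar> \<le> max B 0" for x using B supp[of x] by (cases "x \<in> K") (auto simp: le_max_iff_disj)
    show "F x = 0" if "x \<notin> cball 0 R" for x using R that supp[of x] by auto
  qed
qed

text \<open>A Dynkin argument: the Borel sets over which \<open>h\<close> integrates to 0 are closed
  under countable disjoint unions and, because the total integral vanishes, under complements, while
  the boxes form a generator stable under intersection. The sets where \<open>h\<close> is positive
  or negative are then among them.\<close>

lemma AE_zero_if_box_integrals_zero:
  fixes h :: "'a::euclidean_space \<Rightarrow> real"
  assumes h: "integrable lborel h" and total: "(\<integral>x. h x \<partial>lborel) = 0"
    and box: "\<And>a b. (LINT x:box a b|lborel. h x) = 0"
  shows "AE x in lborel. h x = 0"
proof -
  have [measurable]: "h \<in> borel_measurable borel" using h by auto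
  have si: "set_integrable lborel A h" if "A \<in> sets borel" for A
    unfolding set_integrable_def using h that by (intro integrable_mult_indicator) auto
  have zero: "(LINT x:A|lborel. h x) = 0" if "A \<in> sets borel" for A
  proof -
    have st: "Int_stable (range (\<lambda>(a, b). box a b :: 'a set))"
      by (auto simp: Int_stable_def box_Int_box image_iff)
    have "range (\<lambda>(a, b). box a b :: 'a set) \<subseteq> Pow UNIV" by simp
    moreover have "A \<in> sigma_sets UNIV (range (\<lambda>(a, b). box a b :: 'a set))"
      using that by (simp add: borel_eq_box)
    ultimately show ?thesis
    proof (induction rule: sigma_sets_induct_disjoint[OF st, consumes 2, case_names basic empty compl union])
      case (basic A)
      then show ?case using box by auto
    next
      case (compl A)
      then have A: "A \<in> sets borel" by (simp add: borel_eq_box)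
      have "(LINT x:UNIV - A|lborel. h x) = (\<integral>x. h x - indicator A x *\<^sub>R h x \<partial>lborel)"
        unfolding set_lebesgue_integral_def by (intro Bochner_Integration.integral_cong) (auto simp: indicator_def)
      also have "\<dots> = 0"
        using h total compl(2) si[OF A]
        by (subst Bochner_Integration.integral_diff) (auto simp: set_integrable_def set_lebesgue_integral_def)
      finally show ?case .
    next
      case (union A)
      then have A: "A i \<in> sets borel" for i by (auto simp: borel_eq_box)
      have "(LINT x:(\<Union>i. A i)|lborel. h x) = (\<Sum>i. LINT x:A i|lborel. h x)"
        by (intro lebesgue_integral_countable_add si)
           (use union(1) A in \<open>auto simp: disjoint_family_on_def\<close>)
      then show ?case using union by simp
    qed (simp add: set_lebesgue_integral_def)
  qed
  \<comment> \<open>The factor \<open>c\<close> is used with the values 1 and -1, to treat both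
    signs of \<open>h\<close>.\<close>
  have "AE x in lborel. indicator {x. 0 < c * h x} x *\<^sub>R (c * h x) = 0" for c
  proof -
    have m: "{x. 0 < c * h x} \<in> sets borel" by measurable
    have "integrable lborel (\<lambda>x. indicator {x. 0 < c * h x} x *\<^sub>R (c * h x))"
      using si[OF m] by (simp add: set_integrable_def mult.left_commute[of _ c])
    moreover have "(\<integral>x. indicator {x. 0 < c * h x} x *\<^sub>R (c * h x) \<partial>lborel) = 0"
      using zero[OF m] by (simp add: set_lebesgue_integral_def mult.left_commute[of _ c])
    moreover have "AE x in lborel. 0 \<le> indicator {x. 0 < c * h x} x *\<^sub>R (c * h x)"
      by (auto simp: indicator_def)
    ultimately show ?thesis using integral_nonneg_eq_0_iff_AE by blast
  qed
  from this[of 1] this[of "-1"] show ?thesis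
    by eventually_elim (auto simp: indicator_def split: if_splits)
qed

section \<open>\<open>L^p\<close> and Sobolev norms on an open domain\<close>

locale Lp_domain =
  fixes D :: "(real^'n::finite) set" and p :: real
  assumes open_D: "open D" and p_gt_1: "1 < p"
begin

abbreviation "M \<equiv> lebesgue_on D"

lemma D_sets: "D \<in> sets lebesgue"
  using open_D by (metis borel_open sets_completionI_sets sets_lborel)

lemma AE_M: "(AE x in M. P x) \<longleftrightarrow> (AE x in lebesgue. x \<in> D \<longrightarrow> P x)"
  using D_sets by (simp add: AE_restrict_space_iff)

lemma Lint_M: "Lint D f = (\<integral>x. f x \<partial>M)"
  unfolding Lint_def set_lebesgue_integral_def using D_sets by (simp add: integral_restrict_space)

lemma memLp_M: "memLp D p f \<longleftrightarrow> f \<in> borel_measurable M \<and> integrable M (\<lambda>x. \<bar>f x\<bar> powr p)"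
  unfolding memLp_def set_borel_measurable_def set_integrable_def
  using D_sets by (simp add: borel_measurable_restrict_space_iff integrable_restrict_space)

lemma AE_measurable_M:
  fixes f g :: "real^'n \<Rightarrow> real"
  assumes "f \<in> borel_measurable M" "AE x in M. f x = g x"
  shows "g \<in> borel_measurable M"
proof -
  have D: "D \<inter> space lebesgue \<in> sets lebesgue" using D_sets by simp
  have "(\<lambda>x. indicator D x *\<^sub>R f x) \<in> borel_measurable lebesgue"
    using assms(1) borel_measurable_restrict_space_iff[OF D] by blast
  moreover have "AE x in lebesgue. indicator D x *\<^sub>R f x = indicator D x *\<^sub>R g x"
    using assms(2) unfolding AE_M by eventually_elim (auto simp: indicator_def)
  ultimately have "(\<lambda>x. indicator D x *\<^sub>R g x) \<in> borel_measurable lebesgue"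
    by (rule borel_measurable_AE)
  then show ?thesis using borel_measurable_restrict_space_iff[OF D] by blast
qed

lemma AE_memLp:
  assumes f: "memLp D p f" and fg: "AE x in M. f x = g x"
  shows "memLp D p g"
proof -
  have g: "g \<in> borel_measurable M" using AE_measurable_M f fg memLp_M by blast
  moreover have "integrable M (\<lambda>x. \<bar>g x\<bar> powr p)"
  proof (rule integrable_cong_AE_imp)
    show "integrable M (\<lambda>x. \<bar>f x\<bar> powr p)" using f memLp_M by blast
    show "(\<lambda>x. \<bar>g x\<bar> powr p) \<in> borel_measurable M" using g by measurable
    show "AE x in M. \<bar>f x\<bar> powr p = \<bar>g x\<bar> powr p" using fg by eventually_elim auto
  qed
  ultimately show ?thesis by (simp add: memLp_M)
qed

lemma memLp_zero: "memLp D p (\<lambda>_. 0)"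
  by (simp add: memLp_M)

lemma memLp_add: "memLp D p f \<Longrightarrow> memLp D p g \<Longrightarrow> memLp D p (\<lambda>x. f x + g x)"
  unfolding memLp_M using integrable_powr_add[OF p_gt_1] by auto

lemma memLp_scale: "memLp D p f \<Longrightarrow> memLp D p (\<lambda>x. c * f x)"
  unfolding memLp_M by (auto simp: abs_mult powr_mult)

lemma memLp_diff: "memLp D p f \<Longrightarrow> memLp D p g \<Longrightarrow> memLp D p (\<lambda>x. f x - g x)"
  using memLp_add[of f "\<lambda>x. -1 * g x"] memLp_scale[of g "-1"] by simp

lemma powr_norm:
  assumes "0 \<le> A"
  shows "(A powr (1 / p)) powr p = A" and "(A powr p) powr (1 / p) = A"
  using assms p_gt_1 by (simp_all add: powr_powr)

lemma energy_nonneg: "0 \<le> Lint D (\<lambda>x. \<bar>u x\<bar> powr p) + (\<Sum>i\<in>UNIV. Lint D (\<lambda>x. \<bar>G i x\<bar> powr p))"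
  unfolding Lint_M by (intro add_nonneg_nonneg sum_nonneg) auto

lemma W1p_norm_nonneg: "0 \<le> W1p_norm D p u G"
  by (simp add: W1p_norm_def)

lemma W1p_norm_powr:
  "W1p_norm D p u G powr p = Lint D (\<lambda>x. \<bar>u x\<bar> powr p) + (\<Sum>i\<in>UNIV. Lint D (\<lambda>x. \<bar>G i x\<bar> powr p))"
  unfolding W1p_norm_def by (rule powr_norm(1)[OF energy_nonneg])

lemma Lpnorm_powr: "Lpnorm D p f powr p = Lint D (\<lambda>x. \<bar>f x\<bar> powr p)"
  unfolding Lpnorm_def by (rule powr_norm(1)) (simp add: Lint_M)

lemma Lpnorm_nonneg: "0 \<le> Lpnorm D p f"
  by (simp add: Lpnorm_def)

text \<open>The \<open>L^p\<close> norm is the Sobolev norm with zero gradient, so scaling, the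
  triangle inequality and invariance under null sets are proved once for both.\<close>

lemma Lpnorm_W1p: "Lpnorm D p f = W1p_norm D p f (\<lambda>_ _. 0)"
  by (simp add: Lpnorm_def W1p_norm_def Lint_M)

lemma W1p_norm_scale: "W1p_norm D p (\<lambda>x. c * u x) (\<lambda>i x. c * G i x) = \<bar>c\<bar> * W1p_norm D p u G"
proof -
  have "Lint D (\<lambda>x. \<bar>c * u x\<bar> powr p) + (\<Sum>i\<in>UNIV. Lint D (\<lambda>x. \<bar>c * G i x\<bar> powr p))
     = \<bar>c\<bar> powr p * (Lint D (\<lambda>x. \<bar>u x\<bar> powr p) + (\<Sum>i\<in>UNIV. Lint D (\<lambda>x. \<bar>G i x\<bar> powr p)))"
    by (simp add: Lint_M abs_mult powr_mult distrib_left sum_distrib_left)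
  then show ?thesis
    using energy_nonneg[of u G] by (simp add: W1p_norm_def powr_mult powr_norm)
qed

text \<open>For fixed \<open>t\<close> the splitting inequality is integrated for the function and
  for each partial derivative. The same \<open>t\<close> serves for all of them, so the sums are
  collected first and \<open>t\<close> is optimised afterwards.\<close>

lemma W1p_norm_triangle:
  assumes u: "memLp D p u" "memLp D p v" and G: "\<And>i. memLp D p (G i)" "\<And>i. memLp D p (H i)"
  shows "W1p_norm D p (\<lambda>x. u x + v x) (\<lambda>i x. G i x + H i x) \<le> W1p_norm D p u G + W1p_norm D p v H"
  unfolding W1p_norm_def
proof (rule powr_inverse_le_add[OF p_gt_1 energy_nonneg energy_nonneg energy_nonneg])
  fix t :: real assume t: "0 < t" "t < 1"
  have le: "Lint D (\<lambda>x. \<bar>f x + g x\<bar> powr p)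
      \<le> t powr (1 - p) * Lint D (\<lambda>x. \<bar>f x\<bar> powr p) + (1 - t) powr (1 - p) * Lint D (\<lambda>x. \<bar>g x\<bar> powr p)"
    if f: "memLp D p f" and g: "memLp D p g" for f g
  proof -
    have int: "integrable M (\<lambda>x. \<bar>f x\<bar> powr p)" "integrable M (\<lambda>x. \<bar>g x\<bar> powr p)"
      "integrable M (\<lambda>x. \<bar>f x + g x\<bar> powr p)"
      using f g memLp_add[OF f g] by (auto simp: memLp_M)
    have "(\<integral>x. \<bar>f x + g x\<bar> powr p \<partial>M)
        \<le> (\<integral>x. t powr (1 - p) * \<bar>f x\<bar> powr p + (1 - t) powr (1 - p) * \<bar>g x\<bar> powr p \<partial>M)"
      using int powr_add_split[OF p_gt_1 t] by (intro integral_mono) auto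
    also have "\<dots> = t powr (1 - p) * (\<integral>x. \<bar>f x\<bar> powr p \<partial>M) + (1 - t) powr (1 - p) * (\<integral>x. \<bar>g x\<bar> powr p \<partial>M)"
      using int by simp
    finally show ?thesis by (simp add: Lint_M)
  qed
  have "Lint D (\<lambda>x. \<bar>u x + v x\<bar> powr p) + (\<Sum>i\<in>UNIV. Lint D (\<lambda>x. \<bar>G i x + H i x\<bar> powr p))
     \<le> (t powr (1 - p) * Lint D (\<lambda>x. \<bar>u x\<bar> powr p) + (1 - t) powr (1 - p) * Lint D (\<lambda>x. \<bar>v x\<bar> powr p))
      + (\<Sum>i\<in>UNIV. t powr (1 - p) * Lint D (\<lambda>x. \<bar>G i x\<bar> powr p) + (1 - t) powr (1 - p) * Lint D (\<lambda>x. \<bar>H i x\<bar> powr p))"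
    by (intro add_mono sum_mono le u G)
  also have "\<dots> = t powr (1 - p) * (Lint D (\<lambda>x. \<bar>u x\<bar> powr p) + (\<Sum>i\<in>UNIV. Lint D (\<lambda>x. \<bar>G i x\<bar> powr p))) +
     (1 - t) powr (1 - p) * (Lint D (\<lambda>x. \<bar>v x\<bar> powr p) + (\<Sum>i\<in>UNIV. Lint D (\<lambda>x. \<bar>H i x\<bar> powr p)))"
    by (simp add: sum.distrib sum_distrib_left distrib_left)
  finally show "Lint D (\<lambda>x. \<bar>u x + v x\<bar> powr p) + (\<Sum>i\<in>UNIV. Lint D (\<lambda>x. \<bar>G i x + H i x\<bar> powr p))
     \<le> t powr (1 - p) * (Lint D (\<lambda>x. \<bar>u x\<bar> powr p) + (\<Sum>i\<in>UNIV. Lint D (\<lambda>x. \<bar>G i x\<bar> powr p))) +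
     (1 - t) powr (1 - p) * (Lint D (\<lambda>x. \<bar>v x\<bar> powr p) + (\<Sum>i\<in>UNIV. Lint D (\<lambda>x. \<bar>H i x\<bar> powr p)))" .
qed

lemma Lpnorm_triangle:
  assumes "memLp D p f" "memLp D p g"
  shows "Lpnorm D p (\<lambda>x. f x + g x) \<le> Lpnorm D p f + Lpnorm D p g"
  using W1p_norm_triangle[OF assms, of "\<lambda>_ _. 0" "\<lambda>_ _. 0"] by (simp add: Lpnorm_W1p memLp_zero)

lemma W1p_norm_AE:
  assumes "AE x in M. u x = v x" "\<And>i. AE x in M. G i x = H i x"
    "memLp D p u" "\<And>i. memLp D p (G i)"
  shows "W1p_norm D p u G = W1p_norm D p v H"
proof -
  have eq: "Lint D (\<lambda>x. \<bar>f x\<bar> powr p) = Lint D (\<lambda>x. \<bar>g x\<bar> powr p)"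
    if fg: "AE x in M. f x = g x" and f: "memLp D p f" for f g
    unfolding Lint_M
  proof (rule integral_cong_AE)
    have [measurable]: "f \<in> borel_measurable M" "g \<in> borel_measurable M"
      using f AE_memLp[OF f fg] by (auto simp: memLp_M)
    show "(\<lambda>x. \<bar>f x\<bar> powr p) \<in> borel_measurable M" "(\<lambda>x. \<bar>g x\<bar> powr p) \<in> borel_measurable M" by measurable
    show "AE x in M. \<bar>f x\<bar> powr p = \<bar>g x\<bar> powr p" using fg by eventually_elim auto
  qed
  have "(\<Sum>i\<in>UNIV. Lint D (\<lambda>x. \<bar>G i x\<bar> powr p)) = (\<Sum>i\<in>UNIV. Lint D (\<lambda>x. \<bar>H i x\<bar> powr p))"
    by (intro sum.cong refl eq assms)
  moreover have "Lint D (\<lambda>x. \<bar>u x\<bar> powr p) = Lint D (\<lambda>x. \<bar>v x\<bar> powr p)"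
    by (intro eq assms)
  ultimately show ?thesis unfolding W1p_norm_def by (simp only:)
qed

lemma Lpnorm_le_W1p: "Lpnorm D p u \<le> W1p_norm D p u G"
  unfolding Lpnorm_def W1p_norm_def
  by (rule powr_mono2) (use p_gt_1 in \<open>auto simp: Lint_M intro!: sum_nonneg\<close>)

lemma Lpnorm_partial_le_W1p: "Lpnorm D p (G i) \<le> W1p_norm D p u G"
  unfolding Lpnorm_def W1p_norm_def
proof (rule powr_mono2)
  have "Lint D (\<lambda>x. \<bar>G i x\<bar> powr p) \<le> (\<Sum>i\<in>UNIV. Lint D (\<lambda>x. \<bar>G i x\<bar> powr p))"
    by (rule member_le_sum) (auto simp: Lint_M)
  moreover have "0 \<le> Lint D (\<lambda>x. \<bar>u x\<bar> powr p)" by (simp add: Lint_M)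
  ultimately show "Lint D (\<lambda>x. \<bar>G i x\<bar> powr p)
      \<le> Lint D (\<lambda>x. \<bar>u x\<bar> powr p) + (\<Sum>i\<in>UNIV. Lint D (\<lambda>x. \<bar>G i x\<bar> powr p))" by simp
qed (use p_gt_1 in \<open>auto simp: Lint_M\<close>)

lemma Lpnorm_zero_iff:
  assumes "memLp D p f"
  shows "Lpnorm D p f = 0 \<longleftrightarrow> (AE x in M. f x = 0)"
proof -
  have "Lpnorm D p f = 0 \<longleftrightarrow> (\<integral>x. \<bar>f x\<bar> powr p \<partial>M) = 0"
    by (simp add: Lpnorm_def Lint_M)
  also have "\<dots> \<longleftrightarrow> (AE x in M. \<bar>f x\<bar> powr p = 0)"
    using assms by (intro integral_nonneg_eq_0_iff_AE) (auto simp: memLp_M)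
  finally show ?thesis by simp
qed

lemma Lpnorm_complete:
  assumes f: "\<And>j :: nat. memLp D p (f j)"
    and C: "\<And>e. 0 < e \<Longrightarrow> \<exists>N. \<forall>j\<ge>N. \<forall>k\<ge>N. Lpnorm D p (\<lambda>x. f j x - f k x) < e"
  obtains g where "memLp D p g" "(\<lambda>j. Lpnorm D p (\<lambda>x. f j x - g x)) \<longlonglongrightarrow> 0"
proof (rule Lp_complete[OF p_gt_1, of f M])
  show "f j \<in> borel_measurable M" "integrable M (\<lambda>x. \<bar>f j x\<bar> powr p)" for j
    using f by (auto simp: memLp_M)
  fix e :: real assume e: "0 < e"
  then obtain N where N: "\<forall>j\<ge>N. \<forall>k\<ge>N. Lpnorm D p (\<lambda>x. f j x - f k x) < e powr (1 / p)"
    using C[of "e powr (1 / p)"] by auto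
  have "(\<integral>x. \<bar>f j x - f k x\<bar> powr p \<partial>M) < e" if "N \<le> j" "N \<le> k" for j k
  proof -
    have "Lpnorm D p (\<lambda>x. f j x - f k x) powr p < (e powr (1 / p)) powr p"
      using N that p_gt_1 by (intro powr_less_mono2) (auto simp: Lpnorm_nonneg)
    then show ?thesis using e by (simp add: Lpnorm_powr powr_norm Lint_M)
  qed
  then show "\<exists>N. \<forall>j\<ge>N. \<forall>k\<ge>N. (\<integral>x. \<bar>f j x - f k x\<bar> powr p \<partial>M) < e" by blast
next
  fix g assume g: "g \<in> borel_measurable M" "integrable M (\<lambda>x. \<bar>g x\<bar> powr p)"
    "(\<lambda>j. \<integral>x. \<bar>f j x - g x\<bar> powr p \<partial>M) \<longlonglongrightarrow> 0"
  have "(\<lambda>j. (\<integral>x. \<bar>f j x - g x\<bar> powr p \<partial>M) powr (1 / p)) \<longlonglongrightarrow> 0 powr (1 / p)"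
    using p_gt_1 by (intro tendsto_powr'[OF g(3) tendsto_const]) auto
  then have "(\<lambda>j. Lpnorm D p (\<lambda>x. f j x - g x)) \<longlonglongrightarrow> 0" by (simp add: Lpnorm_def Lint_M)
  with g show thesis by (intro that[of g]) (auto simp: memLp_M)
qed

lemma Lp_space_eq: "Lp_space D p = fspace D {f. memLp D p f} (Lpnorm D p)"
  unfolding Lp_space_def fspace_def by auto

lemma Lp_function_space: "function_space D {f. memLp D p f} (Lpnorm D p)"
proof
  show "g \<in> {f. memLp D p f}" if "f \<in> {f. memLp D p f}" "eq_on_AE D f g" for f g
    using that AE_memLp by (auto simp: AE_M)
  show "Lpnorm D p g = Lpnorm D p f" if "f \<in> {f. memLp D p f}" "eq_on_AE D f g" for f g
    using W1p_norm_AE[of f g "\<lambda>_ _. 0" "\<lambda>_ _. 0"] that by (simp add: Lpnorm_W1p AE_M memLp_zero)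
  show "Lpnorm D p f = 0 \<longleftrightarrow> eq_on_AE D f (\<lambda>_. 0)" if "f \<in> {f. memLp D p f}" for f
    using Lpnorm_zero_iff[of f] that by (simp add: AE_M)
  show "Lpnorm D p (\<lambda>x. c * f x) = \<bar>c\<bar> * Lpnorm D p f" for f c
    using W1p_norm_scale[of c f "\<lambda>_ _. 0"] by (simp add: Lpnorm_W1p)
  show "\<exists>g\<in>{f. memLp D p f}. (\<lambda>j. Lpnorm D p (\<lambda>x. f j x - g x)) \<longlonglongrightarrow> 0"
    if V: "\<And>j. f j \<in> {f. memLp D p f}"
      and C: "\<And>e. 0 < e \<Longrightarrow> \<exists>N. \<forall>j\<ge>N. \<forall>k\<ge>N. Lpnorm D p (\<lambda>x. f j x - f k x) < e" for f :: "nat \<Rightarrow> _"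
  proof -
    have f: "memLp D p (f j)" for j using V[of j] by simp
    obtain g where "memLp D p g" "(\<lambda>j. Lpnorm D p (\<lambda>x. f j x - g x)) \<longlonglongrightarrow> 0"
      using Lpnorm_complete[OF f C] by blast
    then show ?thesis by blast
  qed
qed (auto intro: memLp_zero memLp_add memLp_scale Lpnorm_triangle simp: Lpnorm_nonneg)

lemma banach_Lp: "banach (Lp_space D p)"
  unfolding Lp_space_eq by (rule function_space.banach_fspace[OF Lp_function_space])

section \<open>Test functions and their pairing with \<open>L^p\<close>\<close>

lemma integrable_M_lborel:
  fixes F :: "real^'n \<Rightarrow> real"
  assumes "integrable lborel F"
  shows "integrable M F"
proof -
  have "integrable lebesgue F" using assms by (subst integrable_completion) auto
  then show ?thesis using D_sets
    by (subst integrable_restrict_space) (auto intro!: integrable_mult_indicator simp del: real_scaleR_def)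
qed

lemma integral_M_lborel:
  fixes F :: "real^'n \<Rightarrow> real"
  assumes F: "F \<in> borel_measurable borel" and supp: "\<And>x. x \<notin> D \<Longrightarrow> F x = 0"
  shows "(\<integral>x. F x \<partial>M) = (\<integral>x. F x \<partial>lborel)"
proof -
  have "(\<integral>x. F x \<partial>M) = (\<integral>x. indicator D x *\<^sub>R F x \<partial>lebesgue)"
    using D_sets by (simp add: integral_restrict_space)
  also have "\<dots> = (\<integral>x. F x \<partial>lebesgue)"
    using supp by (intro Bochner_Integration.integral_cong) (auto simp: indicator_def)
  also have "\<dots> = (\<integral>x. F x \<partial>lborel)" using F by (simp add: integral_completion)
  finally show ?thesis .
qed

lemma borel_measurable_M:
  assumes "F \<in> borel_measurable borel"
  shows "F \<in> borel_measurable M"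
proof -
  have "F \<in> borel_measurable lebesgue" using assms by (simp add: measurable_completion)
  then show ?thesis by (simp add: measurable_restrict_space1)
qed

lemma compact_support_Lq:
  fixes F :: "real^'n \<Rightarrow> real"
  assumes cont: "continuous_on UNIV F" and K: "compact K" and supp: "\<And>x. x \<notin> K \<Longrightarrow> F x = 0" and q: "0 < q"
  shows "F \<in> borel_measurable M" and "integrable M (\<lambda>x. \<bar>F x\<bar> powr q)"
proof -
  show "F \<in> borel_measurable M"
    by (intro borel_measurable_M borel_measurable_continuous_onI cont)
  have "continuous_on UNIV (\<lambda>x. \<bar>F x\<bar> powr q)"
    using q by (intro continuous_on_powr' continuous_on_rabs cont continuous_on_const) auto
  then show "integrable M (\<lambda>x. \<bar>F x\<bar> powr q)"
    by (intro integrable_M_lborel integrable_compact_support[OF _ K]) (auto simp: supp)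
qed

definition q where "q = p / (p - 1)"

lemma q_conj: "1 < q" "1 / p + 1 / q = 1"
  using p_gt_1 by (auto simp: q_def field_simps)

text \<open>Hoelder's inequality makes integration against a fixed continuous function of compact
  support continuous in \<open>L^p\<close>; this is what lets weak derivatives pass to
  limits.\<close>

lemma test_integrable:
  assumes g: "memLp D p g" and F: "continuous_on UNIV F" "compact K" "\<And>x. x \<notin> K \<Longrightarrow> F x = 0"
  shows "integrable M (\<lambda>x. g x * F x)"
    and "\<bar>Lint D (\<lambda>x. g x * F x)\<bar> \<le> Lpnorm D p g * (\<integral>x. \<bar>F x\<bar> powr q \<partial>M) powr (1 / q)"
proof -
  have q0: "0 < q" using q_conj by simp
  note H = Holder_inequality[OF p_gt_1 q_conj, of g M F]
  have "g \<in> borel_measurable M" "integrable M (\<lambda>x. \<bar>g x\<bar> powr p)" using g by (auto simp: memLp_M)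
  note H = H[OF this(1) compact_support_Lq(1)[OF F q0] this(2) compact_support_Lq(2)[OF F q0]]
  show "integrable M (\<lambda>x. g x * F x)" by (rule H)
  show "\<bar>Lint D (\<lambda>x. g x * F x)\<bar> \<le> Lpnorm D p g * (\<integral>x. \<bar>F x\<bar> powr q \<partial>M) powr (1 / q)"
    using H(2) by (simp add: Lint_M Lpnorm_def)
qed

lemma Ccinf_test_integrable:
  assumes g: "memLp D p g" and \<phi>: "Ccinf D \<phi>"
  shows "integrable M (\<lambda>x. g x * \<phi> x)" "integrable M (\<lambda>x. g x * pd i \<phi> x)"
proof -
  obtain K where K: "compact K" "\<And>x. x \<notin> K \<Longrightarrow> \<phi> x = 0" "\<And>x i. x \<notin> K \<Longrightarrow> pd i \<phi> x = 0"
    using Ccinf_support[OF \<phi>] by metis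
  show "integrable M (\<lambda>x. g x * \<phi> x)"
    by (rule test_integrable(1)[OF g smooth_continuous[OF Ccinf_smooth[OF \<phi>]] K(1)]) (rule K(2))
  show "integrable M (\<lambda>x. g x * pd i \<phi> x)"
    by (rule test_integrable(1)[OF g smooth_pd_continuous[OF Ccinf_smooth[OF \<phi>]] K(1)]) (rule K(3))
qed

lemma Ccinf_memLp:
  assumes \<phi>: "Ccinf D \<phi>"
  shows "memLp D p \<phi>" "memLp D p (pd i \<phi>)"
proof -
  obtain K where K: "compact K" "\<And>x. x \<notin> K \<Longrightarrow> \<phi> x = 0" "\<And>x i. x \<notin> K \<Longrightarrow> pd i \<phi> x = 0"
    using Ccinf_support[OF \<phi>] by metis
  have p0: "0 < p" using p_gt_1 by simp
  show "memLp D p \<phi>"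
    unfolding memLp_M using compact_support_Lq[OF smooth_continuous[OF Ccinf_smooth[OF \<phi>]] K(1) K(2) p0] by blast
  show "memLp D p (pd i \<phi>)"
    unfolding memLp_M using compact_support_Lq[OF smooth_pd_continuous[OF Ccinf_smooth[OF \<phi>]] K(1) K(3) p0] by blast
qed

end

subsection \<open>Uniqueness of weak gradients\<close>

lemma Ccinf_prod:
  fixes g :: "'n::finite \<Rightarrow> real \<Rightarrow> real"
  assumes g: "\<And>i. smooth_real (g i)"
    and supp: "\<And>i y. y \<notin> {l i..u i} \<Longrightarrow> g i y = 0"
    and sub: "\<And>x. (\<And>i. l i \<le> x $ i \<and> x $ i \<le> u i) \<Longrightarrow> x \<in> D"
  shows "Ccinf D (\<lambda>x. \<Prod>i\<in>UNIV. g i (x $ i))"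
proof -
  let ?C = "cbox (\<chi> i. l i) (\<chi> i. u i) :: (real^'n) set"
  have "{x :: real^'n. (\<Prod>i\<in>UNIV. g i (x $ i)) \<noteq> 0} \<subseteq> ?C"
    using supp by (fastforce simp: mem_box_cart)
  then have cl: "closure {x :: real^'n. (\<Prod>i\<in>UNIV. g i (x $ i)) \<noteq> 0} \<subseteq> ?C"
    by (intro closure_minimal) auto
  moreover have "compact (closure {x :: real^'n. (\<Prod>i\<in>UNIV. g i (x $ i)) \<noteq> 0})"
    using cl by (meson bounded_cbox bounded_subset closed_closure compact_eq_bounded_closed)
  moreover have "?C \<subseteq> D" using sub by (auto simp: mem_box_cart)
  ultimately show ?thesis unfolding Ccinf_def using smooth_prod(1)[of g, OF g] by blast
qed

text \<open>Smooth approximations of the indicator of \<open>(a, b)\<close> from below: for positive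
  \<open>n\<close> they vanish within \<open>1 / n\<close> of the end points, they are bounded by 1,
  and they tend to 1 at every inner point.\<close>

definition plateau :: "nat \<Rightarrow> real \<Rightarrow> real \<Rightarrow> real \<Rightarrow> real" where
  "plateau n a b y = flat_exp (real n * (y - a) - 1) * flat_exp (real n * (b - y) - 1)"

lemma smooth_plateau: "smooth_real (plateau n a b)"
proof -
  have "smooth_real (\<lambda>y. flat_exp (real n * y + (- real n * a - 1)) * flat_exp (- real n * y + (real n * b - 1)))"
    by (intro smooth_real_mult smooth_real_affine smooth_flat_exp)
  moreover have "(\<lambda>y. flat_exp (real n * y + (- real n * a - 1)) * flat_exp (- real n * y + (real n * b - 1))) = plateau n a b"
    by (auto simp: plateau_def algebra_simps)
  ultimately show ?thesis by simp
qed

lemma plateau_bounds: "0 \<le> plateau n a b y" "plateau n a b y \<le> 1"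
  unfolding plateau_def by (simp_all add: flat_exp_bounds mult_le_one)

lemma plateau_support:
  assumes "0 < n" "y \<notin> {a + 1 / real n..b - 1 / real n}"
  shows "plateau n a b y = 0"
proof -
  have "real n * (y - a) - 1 \<le> 0 \<or> real n * (b - y) - 1 \<le> 0"
    using assms by (auto simp: field_simps)
  then show ?thesis by (auto simp: plateau_def flat_exp_def)
qed

lemma plateau_outside: "y \<notin> {a<..<b} \<Longrightarrow> plateau n a b y = 0"
proof -
  assume "y \<notin> {a<..<b}"
  then have "real n * (y - a) \<le> 0 \<or> real n * (b - y) \<le> 0"
    by (auto simp: mult_nonneg_nonpos)
  then show ?thesis by (auto simp: plateau_def flat_exp_def)
qed

lemma plateau_tendsto:
  assumes "y \<in> {a<..<b}"
  shows "(\<lambda>n. plateau n a b y) \<longlonglongrightarrow> 1"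
proof -
  have "(flat_exp \<longlongrightarrow> 1) at_top"
  proof (rule Lim_transform_eventually)
    have "((\<lambda>x::real. exp (- inverse x)) \<longlongrightarrow> exp (- 0)) at_top"
      by (intro tendsto_exp tendsto_minus tendsto_inverse_0_at_top filterlim_ident)
    then show "((\<lambda>x::real. exp (- inverse x)) \<longlongrightarrow> 1) at_top" by simp
    show "\<forall>\<^sub>F x in at_top. exp (- inverse x) = flat_exp x"
      using eventually_gt_at_top[of 0] by eventually_elim (simp add: flat_exp_def inverse_eq_divide)
  qed
  moreover have "filterlim (\<lambda>n. real n * c - 1) at_top sequentially" if "0 < c" for c
  proof -
    have "filterlim (\<lambda>n. - 1 + c * real n) at_top sequentially"
      using that by (intro filterlim_tendsto_add_at_top[OF tendsto_const]
          filterlim_tendsto_pos_mult_at_top[OF tendsto_const] filterlim_real_sequentially)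
    then show ?thesis by (simp add: algebra_simps)
  qed
  ultimately have "(\<lambda>n. flat_exp (real n * c - 1)) \<longlonglongrightarrow> 1" if "0 < c" for c
    using that filterlim_compose by blast
  from tendsto_mult[OF this[of "y - a"] this[of "b - y"]] assms show ?thesis
    by (simp add: plateau_def)
qed

context Lp_domain
begin

text \<open>On the box \<open>\<bar>g\<bar>\<close> is at most 1 or at most its own
  \<open>p\<close>-th power. The resulting majorant is integrable and serves as the dominating
  function below.\<close>

lemma box_integrable:
  assumes g: "memLp D p g"
  shows "integrable M (\<lambda>x. \<bar>g x\<bar> powr p + indicator (box a b) x)"
    and "\<bar>g x * indicator (box a b) x\<bar> \<le> \<bar>g x\<bar> powr p + indicator (box a b) x"
    and "integrable M (\<lambda>x. g x * indicator (box a b) x)"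
proof -
  have "integrable lborel (indicator (box a b) :: real^'n \<Rightarrow> real)"
    by (simp add: integrable_indicator_iff emeasure_lborel_box_eq)
  then have I: "integrable M (indicator (box a b) :: real^'n \<Rightarrow> real)" by (rule integrable_M_lborel)
  show 1: "integrable M (\<lambda>x. \<bar>g x\<bar> powr p + indicator (box a b) x)"
    using I g by (auto simp: memLp_M)
  show 2: "\<bar>g x * indicator (box a b) x\<bar> \<le> \<bar>g x\<bar> powr p + indicator (box a b) x" for x
  proof (cases "\<bar>g x\<bar> \<le> 1")
    case True
    then show ?thesis by (auto simp: indicator_def intro: add_increasing)
  next
    case False
    then have "\<bar>g x\<bar> powr 1 \<le> \<bar>g x\<bar> powr p" using p_gt_1 by (intro powr_mono) auto
    with False show ?thesis by (auto simp: indicator_def)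
  qed
  have [measurable]: "g \<in> borel_measurable M" "(indicator (box a b) :: real^'n \<Rightarrow> real) \<in> borel_measurable M"
    using g I by (auto simp: memLp_M)
  show "integrable M (\<lambda>x. g x * indicator (box a b) x)"
  proof (rule Bochner_Integration.integrable_bound[OF 1])
    show "AE x in M. norm (g x * indicator (box a b) x) \<le> norm (\<bar>g x\<bar> powr p + indicator (box a b) x)"
      using 2 by (auto intro!: AE_I2)
  qed measurable
qed

text \<open>Products of plateaus have compact support in the box and tend to its indicator, so the
  hypothesis on test functions passes to the box by dominated convergence.\<close>

lemma box_integral_zero:
  assumes g: "memLp D p g" and test: "\<And>\<phi>. Ccinf D \<phi> \<Longrightarrow> Lint D (\<lambda>x. g x * \<phi> x) = 0"
    and sub: "box a b \<subseteq> D"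
  shows "(\<integral>x. g x * indicator (box a b) x \<partial>M) = 0"
proof -
  define \<phi> where "\<phi> n x = (\<Prod>i\<in>UNIV. plateau (Suc n) (a $ i) (b $ i) (x $ i))" for n and x :: "real^'n"
  have \<phi>: "Ccinf D (\<phi> n)" for n
    unfolding \<phi>_def
  proof (rule Ccinf_prod[OF smooth_plateau plateau_support])
    fix x :: "real^'n"
    assume le: "\<And>i. a $ i + 1 / real (Suc n) \<le> x $ i \<and> x $ i \<le> b $ i - 1 / real (Suc n)"
    have "0 < 1 / real (Suc n)" by simp
    then have "a $ i < x $ i \<and> x $ i < b $ i" for i using le[of i] by linarith
    then show "x \<in> D" using sub by (auto simp: mem_box_cart)
  qed simp
  have \<phi>b: "0 \<le> \<phi> n x" "\<phi> n x \<le> 1" for n x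
    unfolding \<phi>_def by (auto intro!: prod_nonneg prod_le_1 plateau_bounds)
  have \<phi>0: "\<phi> n x = 0" if "x \<notin> box a b" for n x
    using that plateau_outside unfolding \<phi>_def mem_box_cart by fastforce
  have lim: "(\<lambda>n. \<phi> n x) \<longlonglongrightarrow> indicator (box a b) x" for x
  proof (cases "x \<in> box a b")
    case True
    have "(\<lambda>n. \<phi> n x) \<longlonglongrightarrow> (\<Prod>i\<in>(UNIV::'n set). 1)"
      unfolding \<phi>_def
      by (intro tendsto_prod LIMSEQ_Suc plateau_tendsto) (use True in \<open>auto simp: mem_box_cart\<close>)
    with True show ?thesis by simp
  qed (simp add: \<phi>0)
  have gm [measurable]: "g \<in> borel_measurable M" using g by (simp add: memLp_M)
  have [measurable]: "\<phi> n \<in> borel_measurable M" for n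
    using Ccinf_memLp(1)[OF \<phi>] by (simp add: memLp_M)
  have "(\<lambda>n. \<integral>x. g x * \<phi> n x \<partial>M) \<longlonglongrightarrow> (\<integral>x. g x * indicator (box a b) x \<partial>M)"
  proof (rule integral_dominated_convergence[OF _ _ box_integrable(1)[OF g]])
    show "(\<lambda>x. g x * indicator (box a b) x) \<in> borel_measurable M"
      using box_integrable(3)[OF g] by auto
    show "AE x in M. (\<lambda>n. g x * \<phi> n x) \<longlonglongrightarrow> g x * indicator (box a b) x"
      by (intro AE_I2 tendsto_mult tendsto_const lim)
    show "AE x in M. norm (g x * \<phi> n x) \<le> \<bar>g x\<bar> powr p + indicator (box a b) x" for n
    proof (rule AE_I2)
      fix x
      have "norm (g x * \<phi> n x) \<le> \<bar>g x * indicator (box a b) x\<bar>"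
        using \<phi>b[of n x] \<phi>0[of x n] by (auto simp: abs_mult indicator_def intro: mult_left_le)
      also have "\<dots> \<le> \<bar>g x\<bar> powr p + indicator (box a b) x" by (rule box_integrable(2)[OF g])
      finally show "norm (g x * \<phi> n x) \<le> \<bar>g x\<bar> powr p + indicator (box a b) x" .
    qed
  qed measurable
  moreover have "(\<integral>x. g x * \<phi> n x \<partial>M) = 0" for n using test[OF \<phi>[of n]] by (simp add: Lint_M)
  ultimately show ?thesis by (simp add: LIMSEQ_const_iff)
qed

text \<open>The fundamental lemma of the calculus of variations. Integrals over boxes inside
  \<open>D\<close> vanish, hence \<open>g\<close> vanishes almost everywhere on each such box, and
  countably many of them exhaust \<open>D\<close>.\<close>

lemma AE_zero_if_test_integrals_zero:
  assumes g: "memLp D p g" and test: "\<And>\<phi>. Ccinf D \<phi> \<Longrightarrow> Lint D (\<lambda>x. g x * \<phi> x) = 0"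
  shows "AE x in M. g x = 0"
proof -
  have box: "AE x in lebesgue. x \<in> box a b \<longrightarrow> g x = 0" if sub: "box a b \<subseteq> D" for a b
  proof -
    let ?g = "\<lambda>x. indicator (box a b) x * g x"
    have DD: "D \<inter> space lebesgue \<in> sets lebesgue" using D_sets by simp
    have eqD: "indicator D x *\<^sub>R (g x * indicator (box c d \<inter> box a b) x) = indicator (box c d) x * ?g x"
      for c d x using sub by (auto simp: indicator_def)
    have eqD': "indicator D x *\<^sub>R (g x * indicator (box a b) x) = ?g x"
      for x using sub by (auto simp: indicator_def)
    have "integrable lebesgue (\<lambda>x. indicator D x *\<^sub>R (g x * indicator (box a b) x))"
      using box_integrable(3)[OF g, of a b] by (simp only: integrable_restrict_space[OF DD])
    then have gi: "integrable lebesgue ?g" unfolding eqD' .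
    then have "?g \<in> borel_measurable (completion lborel)" by auto
    \<comment> \<open>The argument with a generator works on Borel sets, so the Lebesgue measurable
      function is exchanged for a Borel one.\<close>
    from completion_ex_borel_measurable_real[OF this]
    obtain h where h[measurable]: "h \<in> borel_measurable lborel" and gh: "AE x in lborel. ?g x = h x" by blast
    have gh': "AE x in lebesgue. ?g x = h x" using gh by (rule AE_completion)
    have hm: "h \<in> borel_measurable lebesgue" using h by (rule measurable_completion)
    have hl: "integrable lebesgue h"
      using integrable_cong_AE_imp[OF gi hm] gh' by (simp add: eq_commute)
    then have hi: "integrable lborel h" by (subst (asm) integrable_completion) auto
    have "AE x in lborel. h x = 0"
    proof (rule AE_zero_if_box_integrals_zero[OF hi])
      have "(\<integral>x. h x \<partial>lborel) = (\<integral>x. h x \<partial>lebesgue)" by (rule integral_completion[symmetric]) simp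
      also have "\<dots> = (\<integral>x. ?g x \<partial>lebesgue)"
        using gh' gi hm by (intro integral_cong_AE) (auto simp: eq_commute)
      also have "\<dots> = (\<integral>x. g x * indicator (box a b) x \<partial>M)"
        unfolding integral_restrict_space[OF DD] eqD' ..
      also have "\<dots> = 0" by (rule box_integral_zero[OF g test sub])
      finally show "(\<integral>x. h x \<partial>lborel) = 0" .
      fix c d :: "real^'n"
      have [measurable]: "box c d \<in> sets lebesgue" by simp
      have "(LINT x:box c d|lborel. h x) = (\<integral>x. indicator (box c d) x * h x \<partial>lebesgue)"
        unfolding set_lebesgue_integral_def by (subst integral_completion) auto
      also have "\<dots> = (\<integral>x. indicator (box c d) x * ?g x \<partial>lebesgue)"
      proof (rule integral_cong_AE)
        show "AE x in lebesgue. indicator (box c d) x * h x = indicator (box c d) x * ?g x"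
          using gh' by eventually_elim auto
        show "(\<lambda>x. indicator (box c d) x * h x) \<in> borel_measurable lebesgue"
          using hm by measurable
        show "(\<lambda>x. indicator (box c d) x * ?g x) \<in> borel_measurable lebesgue"
          using borel_measurable_integrable[OF gi] by measurable
      qed
      also have "\<dots> = (\<integral>x. g x * indicator (box c d \<inter> box a b) x \<partial>M)"
        unfolding integral_restrict_space[OF DD] eqD ..
      \<comment> \<open>Two boxes meet in a box, which lies in \<open>D\<close> together with
        \<open>box a b\<close>.\<close>
      also have "\<dots> = 0"
        unfolding box_Int_box by (rule box_integral_zero[OF g test]) (use sub in \<open>auto simp flip: box_Int_box\<close>)
      finally show "(LINT x:box c d|lborel. h x) = 0" .
    qed
    then have "AE x in lebesgue. h x = 0" by (rule AE_completion)
    with gh' show ?thesis by eventually_elim (auto simp: indicator_def)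
  qed
  obtain \<D> where \<D>: "countable \<D>" "\<Union>\<D> = D" "\<And>X. X \<in> \<D> \<Longrightarrow> \<exists>a b. X = box a b"
    using open_countable_Union_open_box[OF open_D] by metis
  have "AE x in lebesgue. \<forall>X\<in>\<D>. x \<in> X \<longrightarrow> g x = 0"
    unfolding AE_ball_countable[OF \<D>(1)]
  proof
    fix X assume X: "X \<in> \<D>"
    then obtain a b where "X = box a b" using \<D>(3) by blast
    then show "AE x in lebesgue. x \<in> X \<longrightarrow> g x = 0" using box X \<D>(2) by blast
  qed
  then have "AE x in lebesgue. x \<in> \<Union>\<D> \<longrightarrow> g x = 0" by (rule eventually_mono) blast
  then show ?thesis unfolding AE_M \<D>(2) .
qed

end

subsection \<open>The space \<open>W\<^sub>0\<close>\<close>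

context Lp_domain
begin

lemma memLp_integral_cong:
  assumes u: "memLp D p u" and uv: "AE x in M. u x = v x" and F: "continuous_on UNIV F"
  shows "Lint D (\<lambda>x. u x * F x) = Lint D (\<lambda>x. v x * F x)"
  unfolding Lint_M
proof (rule integral_cong_AE)
  have [measurable]: "u \<in> borel_measurable M" "v \<in> borel_measurable M" "F \<in> borel_measurable M"
    using u AE_memLp[OF u uv] borel_measurable_M[OF borel_measurable_continuous_onI[OF F]] by (auto simp: memLp_M)
  show "(\<lambda>x. u x * F x) \<in> borel_measurable M" "(\<lambda>x. v x * F x) \<in> borel_measurable M" by measurable
  show "AE x in M. u x * F x = v x * F x" using uv by eventually_elim simp
qed

lemma has_weak_grad_AE:
  assumes G: "has_weak_grad D p u G" and uv: "AE x in M. u x = v x"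
  shows "has_weak_grad D p v G"
proof -
  have u: "memLp D p u" using G by (simp add: has_weak_grad_def)
  have "weak_partial D v i (G i)" for i
    unfolding weak_partial_def
  proof (intro allI impI)
    fix \<phi> assume \<phi>: "Ccinf D \<phi>"
    have "Lint D (\<lambda>x. v x * pd i \<phi> x) = Lint D (\<lambda>x. u x * pd i \<phi> x)"
      by (rule memLp_integral_cong[OF u uv smooth_pd_continuous[OF Ccinf_smooth[OF \<phi>]], symmetric])
    then show "Lint D (\<lambda>x. v x * pd i \<phi> x) = - Lint D (\<lambda>x. G i x * \<phi> x)"
      using G \<phi> by (simp add: has_weak_grad_def weak_partial_def)
  qed
  then show ?thesis using G AE_memLp[OF u uv] by (simp add: has_weak_grad_def)
qed

lemma has_weak_grad_memLp:
  assumes "has_weak_grad D p u G"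
  shows "memLp D p u" "memLp D p (G i)"
  using assms by (auto simp: has_weak_grad_def)

lemma has_weak_grad_partial:
  "has_weak_grad D p u G \<Longrightarrow> Ccinf D \<phi> \<Longrightarrow> Lint D (\<lambda>x. u x * pd i \<phi> x) = - Lint D (\<lambda>x. G i x * \<phi> x)"
  by (simp add: has_weak_grad_def weak_partial_def)

lemma Lint_combine:
  assumes "integrable M f" "integrable M g"
  shows "Lint D (\<lambda>x. a * f x + b * g x) = a * Lint D f + b * Lint D g"
  using assms by (simp add: Lint_M)

lemma memLp_combine: "memLp D p f \<Longrightarrow> memLp D p g \<Longrightarrow> memLp D p (\<lambda>x. a * f x + b * g x)"
  by (intro memLp_add memLp_scale)

lemma has_weak_grad_combine:
  assumes G: "has_weak_grad D p u G" and H: "has_weak_grad D p v H"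
  shows "has_weak_grad D p (\<lambda>x. a * u x + b * v x) (\<lambda>i x. a * G i x + b * H i x)"
  unfolding has_weak_grad_def weak_partial_def
proof (intro conjI allI impI)
  note m = has_weak_grad_memLp[OF G] has_weak_grad_memLp[OF H]
  show "memLp D p (\<lambda>x. a * u x + b * v x)" "memLp D p (\<lambda>x. a * G i x + b * H i x)" for i
    by (intro memLp_combine m)+
  fix i \<phi> assume \<phi>: "Ccinf D \<phi>"
  note I = m[THEN Ccinf_test_integrable(1), OF \<phi>] m[THEN Ccinf_test_integrable(2), OF \<phi>]
  have "Lint D (\<lambda>x. (a * u x + b * v x) * pd i \<phi> x)
      = Lint D (\<lambda>x. a * (u x * pd i \<phi> x) + b * (v x * pd i \<phi> x))"
    by (simp add: algebra_simps)
  also have "\<dots> = a * Lint D (\<lambda>x. u x * pd i \<phi> x) + b * Lint D (\<lambda>x. v x * pd i \<phi> x)"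
    by (intro Lint_combine I)
  also have "\<dots> = - (a * Lint D (\<lambda>x. G i x * \<phi> x) + b * Lint D (\<lambda>x. H i x * \<phi> x))"
    using has_weak_grad_partial[OF G \<phi>] has_weak_grad_partial[OF H \<phi>] by simp
  also have "a * Lint D (\<lambda>x. G i x * \<phi> x) + b * Lint D (\<lambda>x. H i x * \<phi> x)
      = Lint D (\<lambda>x. a * (G i x * \<phi> x) + b * (H i x * \<phi> x))"
    by (intro Lint_combine[symmetric] I)
  also have "\<dots> = Lint D (\<lambda>x. (a * G i x + b * H i x) * \<phi> x)"
    by (simp add: algebra_simps)
  finally show "Lint D (\<lambda>x. (a * u x + b * v x) * pd i \<phi> x) = - Lint D (\<lambda>x. (a * G i x + b * H i x) * \<phi> x)" .
qed

text \<open>Gives the norm of \<open>W0_space\<close> a meaning, since that norm is evaluated at a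
  gradient picked by \<open>SOME\<close>.\<close>

lemma has_weak_grad_unique:
  assumes G: "has_weak_grad D p u G" and H: "has_weak_grad D p u H"
  shows "AE x in M. G i x = H i x"
proof -
  have m: "memLp D p (\<lambda>x. G i x - H i x)"
    by (intro memLp_diff has_weak_grad_memLp[OF G] has_weak_grad_memLp[OF H])
  have "AE x in M. G i x - H i x = 0"
  proof (rule AE_zero_if_test_integrals_zero[OF m])
    fix \<phi> assume \<phi>: "Ccinf D \<phi>"
    have "Lint D (\<lambda>x. (G i x - H i x) * \<phi> x) = Lint D (\<lambda>x. 1 * (G i x * \<phi> x) + (-1) * (H i x * \<phi> x))"
      by (simp add: algebra_simps)
    also have "\<dots> = 1 * Lint D (\<lambda>x. G i x * \<phi> x) + (-1) * Lint D (\<lambda>x. H i x * \<phi> x)"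
      by (intro Lint_combine Ccinf_test_integrable \<phi> has_weak_grad_memLp[OF G] has_weak_grad_memLp[OF H])
    also have "\<dots> = 0" using has_weak_grad_partial[OF G \<phi>, of i] has_weak_grad_partial[OF H \<phi>, of i] by simp
    finally show "Lint D (\<lambda>x. (G i x - H i x) * \<phi> x) = 0" .
  qed
  then show ?thesis by eventually_elim simp
qed

text \<open>The product of two test functions has compact support, so the integral of its partial
  derivative vanishes; the product rule turns this into the defining identity of a weak
  derivative.\<close>

lemma has_weak_grad_Ccinf:
  assumes \<phi>: "Ccinf D \<phi>"
  shows "has_weak_grad D p \<phi> (\<lambda>i. pd i \<phi>)"
  unfolding has_weak_grad_def weak_partial_def
proof (intro conjI allI impI)
  show "memLp D p \<phi>" "memLp D p (pd i \<phi>)" for i by (rule Ccinf_memLp[OF \<phi>])+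
  fix i \<psi> assume \<psi>: "Ccinf D \<psi>"
  obtain K where K: "compact K" "K \<subseteq> D" "\<And>x. x \<notin> K \<Longrightarrow> \<phi> x = 0" "\<And>x i. x \<notin> K \<Longrightarrow> pd i \<phi> x = 0"
    using Ccinf_support[OF \<phi>] by metis
  obtain R where R: "\<forall>x\<in>K. norm x \<le> R" using compact_imp_bounded[OF K(1)] by (auto simp: bounded_iff)
  define F' where "F' x = pd i \<phi> x * \<psi> x + pd i \<psi> x * \<phi> x" for x
  have c: "continuous_on UNIV \<phi>" "continuous_on UNIV \<psi>" "continuous_on UNIV (pd i \<phi>)" "continuous_on UNIV (pd i \<psi>)"
    using smooth_continuous smooth_pd_continuous Ccinf_smooth \<phi> \<psi> by blast+
  have cF: "continuous_on UNIV F'" unfolding F'_def by (intro continuous_intros c)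
  have F'0: "F' x = 0" if "x \<notin> K" for x using K that by (simp add: F'_def)
  have "bounded (F' ` K)"
    by (intro compact_imp_bounded compact_continuous_image continuous_on_subset[OF cF] K) auto
  then obtain B where B: "\<forall>x\<in>K. \<bar>F' x\<bar> \<le> B" by (auto simp: bounded_iff)
  have "(\<integral>x. F' x \<partial>lborel) = 0"
  proof (rule integral_partial_derivative(2)[where F = "\<lambda>x. \<phi> x * \<psi> x" and i = i])
    show "((\<lambda>t. \<phi> (x + t *\<^sub>R axis i 1) * \<psi> (x + t *\<^sub>R axis i 1)) has_real_derivative F' x) (at 0)" for x
      using DERIV_mult[OF smooth_partial1[OF Ccinf_smooth[OF \<phi>]] smooth_partial1[OF Ccinf_smooth[OF \<psi>]], of x i x i]
      by (simp add: F'_def)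
    show "continuous_on UNIV (\<lambda>x. \<phi> x * \<psi> x)" by (intro continuous_intros c)
    show "\<phi> x * \<psi> x = 0" if "x \<notin> cball 0 R" for x using that R K(3)[of x] by auto
    show "\<bar>F' x\<bar> \<le> max B 0" for x using B F'0[of x] by (cases "x \<in> K") (auto simp: le_max_iff_disj)
  qed
  moreover have "(\<integral>x. F' x \<partial>M) = (\<integral>x. F' x \<partial>lborel)"
    by (rule integral_M_lborel[OF borel_measurable_continuous_onI[OF cF]]) (use F'0 K in blast)
  moreover have "(\<integral>x. F' x \<partial>M) = Lint D (\<lambda>x. 1 * (pd i \<phi> x * \<psi> x) + 1 * (\<phi> x * pd i \<psi> x))"
    by (simp add: Lint_M F'_def mult.commute)
  moreover have "\<dots> = 1 * Lint D (\<lambda>x. pd i \<phi> x * \<psi> x) + 1 * Lint D (\<lambda>x. \<phi> x * pd i \<psi> x)"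
    by (intro Lint_combine Ccinf_test_integrable Ccinf_memLp \<phi> \<psi>)
  ultimately show "Lint D (\<lambda>x. \<phi> x * pd i \<psi> x) = - Lint D (\<lambda>x. pd i \<phi> x * \<psi> x)" by simp
qed

text \<open>The carrier condition of \<open>W0_space\<close> with the gradient as an explicit
  argument, so that linear combinations and limits can be written down for function and gradient
  together.\<close>

definition W0_grad :: "(real^'n \<Rightarrow> real) \<Rightarrow> ('n \<Rightarrow> real^'n \<Rightarrow> real) \<Rightarrow> bool" where
  "W0_grad u G \<longleftrightarrow> has_weak_grad D p u G \<and>
    (\<exists>\<phi>. (\<forall>j. Ccinf D (\<phi> j)) \<and>
      (\<lambda>j. W1p_norm D p (\<lambda>x. u x - \<phi> j x) (\<lambda>i x. G i x - pd i (\<phi> j) x)) \<longlonglongrightarrow> 0)"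

definition W0_norm :: "(real^'n \<Rightarrow> real) \<Rightarrow> real" where
  "W0_norm u = W1p_norm D p u (SOME G. has_weak_grad D p u G)"

lemma W0_space_eq: "W0_space D p = fspace D {u. \<exists>G. W0_grad u G} W0_norm"
  unfolding W0_space_def fspace_def W0_grad_def W0_norm_def by auto

text \<open>By uniqueness up to null sets the gradient picked by choice may be replaced by any known
  one; from here on norms are computed with explicit gradients.\<close>

lemma W0_norm_eq:
  assumes "has_weak_grad D p u G"
  shows "W0_norm u = W1p_norm D p u G"
proof -
  have H: "has_weak_grad D p u (SOME G. has_weak_grad D p u G)"
    using exI[of "has_weak_grad D p u", OF assms] by (rule someI_ex)
  show ?thesis
    unfolding W0_norm_def
    by (rule W1p_norm_AE) (use has_weak_grad_unique[OF H assms] has_weak_grad_memLp[OF H] in auto)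
qed

lemma W0_gradI:
  assumes G: "has_weak_grad D p u G"
    and app: "\<And>e. 0 < e \<Longrightarrow> \<exists>\<phi>. Ccinf D \<phi> \<and> W1p_norm D p (\<lambda>x. u x - \<phi> x) (\<lambda>i x. G i x - pd i \<phi> x) < e"
  shows "W0_grad u G"
proof -
  have "\<exists>\<phi>. \<forall>j. Ccinf D (\<phi> j) \<and>
      W1p_norm D p (\<lambda>x. u x - \<phi> j x) (\<lambda>i x. G i x - pd i (\<phi> j) x) < 1 / real (Suc j)"
    by (intro choice allI app) simp
  then obtain \<phi> where \<phi>: "\<And>j. Ccinf D (\<phi> j)"
    "\<And>j. W1p_norm D p (\<lambda>x. u x - \<phi> j x) (\<lambda>i x. G i x - pd i (\<phi> j) x) < 1 / real (Suc j)" by blast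
  have "(\<lambda>j. W1p_norm D p (\<lambda>x. u x - \<phi> j x) (\<lambda>i x. G i x - pd i (\<phi> j) x)) \<longlonglongrightarrow> 0"
  proof (rule tendsto_sandwich[of "\<lambda>_. 0"])
    show "\<forall>\<^sub>F j in sequentially. W1p_norm D p (\<lambda>x. u x - \<phi> j x) (\<lambda>i x. G i x - pd i (\<phi> j) x) \<le> 1 / real (Suc j)"
      using \<phi>(2) by (intro always_eventually allI less_imp_le)
    show "(\<lambda>j. 1 / real (Suc j)) \<longlonglongrightarrow> 0"
      using LIMSEQ_inverse_real_of_nat by (simp add: inverse_eq_divide)
  qed (auto simp: W1p_norm_nonneg)
  then show ?thesis unfolding W0_grad_def using G \<phi>(1) by blast
qed

lemma W0_gradD:
  assumes "W0_grad u G"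
  shows "has_weak_grad D p u G"
    and "0 < e \<Longrightarrow> \<exists>\<phi>. Ccinf D \<phi> \<and> W1p_norm D p (\<lambda>x. u x - \<phi> x) (\<lambda>i x. G i x - pd i \<phi> x) < e"
proof -
  show "has_weak_grad D p u G" using assms by (simp add: W0_grad_def)
  assume e: "0 < e"
  obtain \<phi> where \<phi>: "\<And>j. Ccinf D (\<phi> j)"
    and lim: "(\<lambda>j. W1p_norm D p (\<lambda>x. u x - \<phi> j x) (\<lambda>i x. G i x - pd i (\<phi> j) x)) \<longlonglongrightarrow> 0"
    using assms unfolding W0_grad_def by blast
  have "\<forall>\<^sub>F j in sequentially. W1p_norm D p (\<lambda>x. u x - \<phi> j x) (\<lambda>i x. G i x - pd i (\<phi> j) x) < e"
    using lim e by (rule order_tendstoD)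
  then show "\<exists>\<phi>. Ccinf D \<phi> \<and> W1p_norm D p (\<lambda>x. u x - \<phi> x) (\<lambda>i x. G i x - pd i \<phi> x) < e"
    using \<phi> by (auto simp: eventually_sequentially)
qed

lemma W0_grad_Ccinf: "Ccinf D \<phi> \<Longrightarrow> W0_grad \<phi> (\<lambda>i. pd i \<phi>)"
  by (rule W0_gradI[OF has_weak_grad_Ccinf]) (auto intro!: exI[of _ \<phi>] simp: W1p_norm_def Lint_M)

lemma W0_subset_Lp: "{u. \<exists>G. W0_grad u G} \<subseteq> {u. memLp D p u}"
  using has_weak_grad_memLp(1) W0_gradD(1) by blast

lemma W1p_norm_combine:
  assumes "memLp D p u" "memLp D p v" "\<And>i. memLp D p (G i)" "\<And>i. memLp D p (H i)"
  shows "W1p_norm D p (\<lambda>x. a * u x + b * v x) (\<lambda>i x. a * G i x + b * H i x)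
    \<le> \<bar>a\<bar> * W1p_norm D p u G + \<bar>b\<bar> * W1p_norm D p v H"
  using W1p_norm_triangle[of "\<lambda>x. a * u x" "\<lambda>x. b * v x" "\<lambda>i x. a * G i x" "\<lambda>i x. b * H i x"]
  by (simp add: assms memLp_scale W1p_norm_scale)

lemma W0_grad_combine:
  assumes G: "W0_grad u G" and H: "W0_grad v H"
  shows "W0_grad (\<lambda>x. a * u x + b * v x) (\<lambda>i x. a * G i x + b * H i x)"
proof (rule W0_gradI)
  show "has_weak_grad D p (\<lambda>x. a * u x + b * v x) (\<lambda>i x. a * G i x + b * H i x)"
    by (intro has_weak_grad_combine W0_gradD(1) G H)
  fix e :: real assume e: "0 < e"
  \<comment> \<open>The summand 1 keeps the denominator positive even when both coefficients
    vanish.\<close>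
  define d where "d = e / (\<bar>a\<bar> + \<bar>b\<bar> + 1)"
  have d: "0 < d" using e by (simp add: d_def)
  obtain \<phi> where \<phi>: "Ccinf D \<phi>" "W1p_norm D p (\<lambda>x. u x - \<phi> x) (\<lambda>i x. G i x - pd i \<phi> x) < d"
    using W0_gradD(2)[OF G d] by blast
  obtain \<psi> where \<psi>: "Ccinf D \<psi>" "W1p_norm D p (\<lambda>x. v x - \<psi> x) (\<lambda>i x. H i x - pd i \<psi> x) < d"
    using W0_gradD(2)[OF H d] by blast
  let ?\<omega> = "\<lambda>x. a * \<phi> x + b * \<psi> x"
  have pd\<omega>: "pd i ?\<omega> x = a * pd i \<phi> x + b * pd i \<psi> x" for i x
    by (intro pd_combine Ccinf_smooth[OF \<phi>(1)] Ccinf_smooth[OF \<psi>(1)])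
  note m = has_weak_grad_memLp[OF W0_gradD(1)[OF G]] has_weak_grad_memLp[OF W0_gradD(1)[OF H]]
  have "W1p_norm D p (\<lambda>x. (a * u x + b * v x) - ?\<omega> x) (\<lambda>i x. (a * G i x + b * H i x) - pd i ?\<omega> x)
     = W1p_norm D p (\<lambda>x. a * (u x - \<phi> x) + b * (v x - \<psi> x)) (\<lambda>i x. a * (G i x - pd i \<phi> x) + b * (H i x - pd i \<psi> x))"
    by (simp add: pd\<omega> algebra_simps)
  also have "\<dots> \<le> \<bar>a\<bar> * W1p_norm D p (\<lambda>x. u x - \<phi> x) (\<lambda>i x. G i x - pd i \<phi> x)
      + \<bar>b\<bar> * W1p_norm D p (\<lambda>x. v x - \<psi> x) (\<lambda>i x. H i x - pd i \<psi> x)"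
    by (intro W1p_norm_combine memLp_diff m Ccinf_memLp \<phi> \<psi>)
  also have "\<dots> \<le> \<bar>a\<bar> * d + \<bar>b\<bar> * d"
    using \<phi> \<psi> by (intro add_mono mult_left_mono) auto
  also have "\<dots> < (\<bar>a\<bar> + \<bar>b\<bar> + 1) * d" using d by (simp add: algebra_simps)
  also have "\<dots> = e" by (simp add: d_def add_pos_nonneg add_nonneg_pos field_simps)
  finally show "\<exists>\<omega>. Ccinf D \<omega> \<and> W1p_norm D p (\<lambda>x. (a * u x + b * v x) - \<omega> x)
      (\<lambda>i x. (a * G i x + b * H i x) - pd i \<omega> x) < e"
    using Ccinf_combine[OF \<phi>(1) \<psi>(1)] by blast
qed

lemma Lint_test_tendsto:
  assumes f: "\<And>j. memLp D p (f j)" and g: "memLp D p g"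
    and lim: "(\<lambda>j. Lpnorm D p (\<lambda>x. f j x - g x)) \<longlonglongrightarrow> 0"
    and F: "continuous_on UNIV F" "compact K" "\<And>x. x \<notin> K \<Longrightarrow> F x = 0"
  shows "(\<lambda>j. Lint D (\<lambda>x. f j x * F x)) \<longlonglongrightarrow> Lint D (\<lambda>x. g x * F x)"
proof (rule LIM_zero_cancel, rule Lim_null_comparison)
  let ?C = "(\<integral>x. \<bar>F x\<bar> powr q \<partial>M) powr (1 / q)"
  show "(\<lambda>j. Lpnorm D p (\<lambda>x. f j x - g x) * ?C) \<longlonglongrightarrow> 0"
    using tendsto_mult[OF lim tendsto_const[of ?C]] by simp
  have "\<bar>Lint D (\<lambda>x. f j x * F x) - Lint D (\<lambda>x. g x * F x)\<bar> \<le> Lpnorm D p (\<lambda>x. f j x - g x) * ?C" for j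
  proof -
    have "Lint D (\<lambda>x. f j x * F x) - Lint D (\<lambda>x. g x * F x) = Lint D (\<lambda>x. (f j x - g x) * F x)"
      using test_integrable(1)[OF f[of j] F] test_integrable(1)[OF g F] by (simp add: Lint_M left_diff_distrib)
    also have "\<bar>\<dots>\<bar> \<le> Lpnorm D p (\<lambda>x. f j x - g x) * ?C"
      by (rule test_integrable(2)[OF memLp_diff[OF f g] F])
    finally show ?thesis .
  qed
  then show "\<forall>\<^sub>F j in sequentially. norm (Lint D (\<lambda>x. f j x * F x) - Lint D (\<lambda>x. g x * F x))
      \<le> Lpnorm D p (\<lambda>x. f j x - g x) * ?C"
    by simp
qed

lemma W1p_norm_tendsto:
  assumes u: "(\<lambda>j. Lpnorm D p (u j)) \<longlonglongrightarrow> 0" and G: "\<And>i. (\<lambda>j. Lpnorm D p (G j i)) \<longlonglongrightarrow> 0"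
  shows "(\<lambda>j. W1p_norm D p (u j) (G j)) \<longlonglongrightarrow> 0"
proof -
  have P: "(\<lambda>j. Lpnorm D p (f j) powr p) \<longlonglongrightarrow> 0" if "(\<lambda>j. Lpnorm D p (f j)) \<longlonglongrightarrow> 0" for f
    using tendsto_powr'[OF that tendsto_const[of p]] p_gt_1 by (auto simp: Lpnorm_nonneg)
  have "(\<lambda>j. Lpnorm D p (u j) powr p + (\<Sum>i\<in>UNIV. Lpnorm D p (G j i) powr p)) \<longlonglongrightarrow> 0 + (\<Sum>i\<in>(UNIV::'n set). 0)"
    by (intro tendsto_add tendsto_sum P u G)
  then have "(\<lambda>j. (Lpnorm D p (u j) powr p + (\<Sum>i\<in>UNIV. Lpnorm D p (G j i) powr p)) powr (1 / p)) \<longlonglongrightarrow> 0 powr (1 / p)"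
    using p_gt_1 by (intro tendsto_powr' tendsto_const) (auto intro!: always_eventually sum_nonneg add_nonneg_nonneg)
  then show ?thesis by (simp add: W1p_norm_def Lpnorm_powr)
qed

text \<open>A Cauchy sequence for \<open>W0_norm\<close> is Cauchy in \<open>L^p\<close>, and so is
  each of its partial derivatives. The limits fit together because pairings with test functions are
  continuous, and a test function close to a late member of the sequence is close to the limit as
  well.\<close>

lemma W0_complete:
  assumes W: "\<And>j :: nat. \<exists>G. W0_grad (f j) G"
    and C: "\<And>e. 0 < e \<Longrightarrow> \<exists>N. \<forall>j\<ge>N. \<forall>k\<ge>N. W0_norm (\<lambda>x. f j x - f k x) < e"
  shows "\<exists>g. (\<exists>G. W0_grad g G) \<and> (\<lambda>j. W0_norm (\<lambda>x. f j x - g x)) \<longlonglongrightarrow> 0"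
proof -
  obtain G where G: "\<And>j. W0_grad (f j) (G j)" using W by metis
  note Gw = W0_gradD(1)[OF G]
  note m = has_weak_grad_memLp[OF Gw]
  have diff: "W0_norm (\<lambda>x. f j x - f k x) = W1p_norm D p (\<lambda>x. f j x - f k x) (\<lambda>i x. G j i x - G k i x)" for j k
    using W0_norm_eq[OF has_weak_grad_combine[OF Gw[of j] Gw[of k], of 1 "-1"]] by simp
  obtain g where g: "memLp D p g" "(\<lambda>j. Lpnorm D p (\<lambda>x. f j x - g x)) \<longlonglongrightarrow> 0"
  proof (rule Lpnorm_complete[of f])
    fix e :: real assume "0 < e"
    from C[OF this] show "\<exists>N. \<forall>j\<ge>N. \<forall>k\<ge>N. Lpnorm D p (\<lambda>x. f j x - f k x) < e"
      unfolding diff using Lpnorm_le_W1p le_less_trans by blast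
  qed (auto intro: m)
  have "\<exists>H. memLp D p H \<and> (\<lambda>j. Lpnorm D p (\<lambda>x. G j i x - H x)) \<longlonglongrightarrow> 0" for i
  proof -
    have "\<exists>N. \<forall>j\<ge>N. \<forall>k\<ge>N. Lpnorm D p (\<lambda>x. G j i x - G k i x) < e" if e: "0 < e" for e
    proof -
      obtain N where N: "\<forall>j\<ge>N. \<forall>k\<ge>N. W1p_norm D p (\<lambda>x. f j x - f k x) (\<lambda>i x. G j i x - G k i x) < e"
        using C[OF e] unfolding diff by blast
      have "Lpnorm D p (\<lambda>x. G j i x - G k i x) < e" if "N \<le> j" "N \<le> k" for j k
        using Lpnorm_partial_le_W1p[of "\<lambda>i x. G j i x - G k i x" i "\<lambda>x. f j x - f k x"] N that
        by (meson le_less_trans)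
      then show ?thesis by blast
    qed
    from Lpnorm_complete[of "\<lambda>j. G j i", OF m(2) this] show ?thesis by blast
  qed
  then obtain H where H: "\<And>i. memLp D p (H i)" "\<And>i. (\<lambda>j. Lpnorm D p (\<lambda>x. G j i x - H i x)) \<longlonglongrightarrow> 0" by metis
  have Hw: "has_weak_grad D p g H"
    unfolding has_weak_grad_def weak_partial_def
  proof (intro conjI allI impI g H)
    fix i \<phi> assume \<phi>: "Ccinf D \<phi>"
    obtain K where K: "compact K" "\<And>x. x \<notin> K \<Longrightarrow> \<phi> x = 0" "\<And>x i. x \<notin> K \<Longrightarrow> pd i \<phi> x = 0"
      using Ccinf_support[OF \<phi>] by metis
    have "(\<lambda>j. Lint D (\<lambda>x. f j x * pd i \<phi> x)) \<longlonglongrightarrow> Lint D (\<lambda>x. g x * pd i \<phi> x)"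
      by (rule Lint_test_tendsto[OF m(1) g smooth_pd_continuous[OF Ccinf_smooth[OF \<phi>]] K(1) K(3)])
    moreover have "(\<lambda>j. Lint D (\<lambda>x. G j i x * \<phi> x)) \<longlonglongrightarrow> Lint D (\<lambda>x. H i x * \<phi> x)"
      by (rule Lint_test_tendsto[OF m(2) H smooth_continuous[OF Ccinf_smooth[OF \<phi>]] K(1) K(2)])
    then have "(\<lambda>j. Lint D (\<lambda>x. f j x * pd i \<phi> x)) \<longlonglongrightarrow> - Lint D (\<lambda>x. H i x * \<phi> x)"
      unfolding has_weak_grad_partial[OF Gw \<phi>] by (rule tendsto_minus)
    ultimately show "Lint D (\<lambda>x. g x * pd i \<phi> x) = - Lint D (\<lambda>x. H i x * \<phi> x)"
      by (rule LIMSEQ_unique)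
  qed
  have lim: "(\<lambda>j. W1p_norm D p (\<lambda>x. f j x - g x) (\<lambda>i x. G j i x - H i x)) \<longlonglongrightarrow> 0"
    by (rule W1p_norm_tendsto) (rule g H)+
  have "W0_grad g H"
  proof (rule W0_gradI[OF Hw])
    fix e :: real assume e: "0 < e"
    then have "\<forall>\<^sub>F j in sequentially. W1p_norm D p (\<lambda>x. f j x - g x) (\<lambda>i x. G j i x - H i x) < e / 2"
      by (intro order_tendstoD(2)[OF lim]) simp
    then obtain j where j: "W1p_norm D p (\<lambda>x. f j x - g x) (\<lambda>i x. G j i x - H i x) < e / 2"
      by (auto simp: eventually_sequentially)
    obtain \<phi> where \<phi>: "Ccinf D \<phi>" "W1p_norm D p (\<lambda>x. f j x - \<phi> x) (\<lambda>i x. G j i x - pd i \<phi> x) < e / 2"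
      using W0_gradD(2)[OF G[of j], of "e / 2"] e by auto
    have "W1p_norm D p (\<lambda>x. g x - \<phi> x) (\<lambda>i x. H i x - pd i \<phi> x)
       = W1p_norm D p (\<lambda>x. (-1) * (f j x - g x) + 1 * (f j x - \<phi> x))
          (\<lambda>i x. (-1) * (G j i x - H i x) + 1 * (G j i x - pd i \<phi> x))" by simp
    also have "\<dots> \<le> \<bar>-1\<bar> * W1p_norm D p (\<lambda>x. f j x - g x) (\<lambda>i x. G j i x - H i x)
       + \<bar>1\<bar> * W1p_norm D p (\<lambda>x. f j x - \<phi> x) (\<lambda>i x. G j i x - pd i \<phi> x)"
      by (intro W1p_norm_combine memLp_diff m g H Ccinf_memLp \<phi>)
    also have "\<dots> < e" using j \<phi> by simp
    finally show "\<exists>\<phi>. Ccinf D \<phi> \<and> W1p_norm D p (\<lambda>x. g x - \<phi> x) (\<lambda>i x. H i x - pd i \<phi> x) < e"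
      using \<phi> by blast
  qed
  moreover have "W0_norm (\<lambda>x. f j x - g x) = W1p_norm D p (\<lambda>x. f j x - g x) (\<lambda>i x. G j i x - H i x)" for j
    using W0_norm_eq[OF has_weak_grad_combine[OF Gw[of j] Hw, of 1 "-1"]] by simp
  ultimately show ?thesis using lim by auto
qed

lemma W0_function_space: "function_space D {u. \<exists>G. W0_grad u G} W0_norm"
proof
  have "W0_grad (\<lambda>_. 0) (\<lambda>i. pd i (\<lambda>_. 0))" by (rule W0_grad_Ccinf[OF Ccinf_zero])
  then show "(\<lambda>_. 0) \<in> {u. \<exists>G. W0_grad u G}" by blast
  show "(\<lambda>x. f x + g x) \<in> {u. \<exists>G. W0_grad u G}"
    if "f \<in> {u. \<exists>G. W0_grad u G}" "g \<in> {u. \<exists>G. W0_grad u G}" for f g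
    using that W0_grad_combine[of f _ g _ 1 1] by auto
  show "(\<lambda>x. c * f x) \<in> {u. \<exists>G. W0_grad u G}" if "f \<in> {u. \<exists>G. W0_grad u G}" for f c
    using that W0_grad_combine[of f _ f _ c 0] by auto
  show "g \<in> {u. \<exists>G. W0_grad u G}" if f: "f \<in> {u. \<exists>G. W0_grad u G}" and fg: "eq_on_AE D f g" for f g
  proof -
    obtain G where G: "W0_grad f G" using f by blast
    have fgM: "AE x in M. f x = g x" using fg by (simp add: AE_M)
    have "W0_grad g G"
    proof (rule W0_gradI[OF has_weak_grad_AE[OF W0_gradD(1)[OF G] fgM]])
      fix e :: real assume "0 < e"
      from W0_gradD(2)[OF G this] obtain \<phi> where
        \<phi>: "Ccinf D \<phi>" "W1p_norm D p (\<lambda>x. f x - \<phi> x) (\<lambda>i x. G i x - pd i \<phi> x) < e" by blast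
      have "W1p_norm D p (\<lambda>x. f x - \<phi> x) (\<lambda>i x. G i x - pd i \<phi> x) = W1p_norm D p (\<lambda>x. g x - \<phi> x) (\<lambda>i x. G i x - pd i \<phi> x)"
      proof (rule W1p_norm_AE)
        show "AE x in M. f x - \<phi> x = g x - \<phi> x" using fgM by eventually_elim simp
      qed (intro AE_I2 refl memLp_diff Ccinf_memLp \<phi> has_weak_grad_memLp[OF W0_gradD(1)[OF G]])+
      with \<phi> show "\<exists>\<phi>. Ccinf D \<phi> \<and> W1p_norm D p (\<lambda>x. g x - \<phi> x) (\<lambda>i x. G i x - pd i \<phi> x) < e" by auto
    qed
    then show ?thesis by blast
  qed
  show "W0_norm g = W0_norm f" if f: "f \<in> {u. \<exists>G. W0_grad u G}" and fg: "eq_on_AE D f g" for f g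
  proof -
    obtain G where G: "has_weak_grad D p f G" using f W0_gradD(1) by blast
    have fgM: "AE x in M. f x = g x" using fg by (simp add: AE_M)
    have "W1p_norm D p f G = W1p_norm D p g G"
      by (rule W1p_norm_AE[OF fgM _ has_weak_grad_memLp[OF G]]) simp
    then show ?thesis using W0_norm_eq[OF G] W0_norm_eq[OF has_weak_grad_AE[OF G fgM]] by simp
  qed
  show "0 \<le> W0_norm f" for f by (simp add: W0_norm_def W1p_norm_nonneg)
  show "W0_norm f = 0 \<longleftrightarrow> eq_on_AE D f (\<lambda>_. 0)" if f: "f \<in> {u. \<exists>G. W0_grad u G}" for f
  proof -
    obtain G where G: "has_weak_grad D p f G" using f W0_gradD(1) by blast
    have fm: "memLp D p f" by (rule has_weak_grad_memLp[OF G])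
    have z: "has_weak_grad D p (\<lambda>_. 0) (\<lambda>_ _. 0)"
      using has_weak_grad_combine[OF G G, of 0 0] by simp
    have "W0_norm f = 0 \<Longrightarrow> AE x in M. f x = 0"
      using Lpnorm_le_W1p[of f G] Lpnorm_nonneg[of f] Lpnorm_zero_iff[OF fm] W0_norm_eq[OF G] by simp
    moreover have "W0_norm f = 0" if "AE x in M. f x = 0"
    proof -
      have "AE x in M. (\<lambda>_. 0) x = f x" using that by eventually_elim simp
      from has_weak_grad_AE[OF z this] have "W0_norm f = W1p_norm D p f (\<lambda>_ _. 0)" by (rule W0_norm_eq)
      also have "\<dots> = 0" using Lpnorm_zero_iff[OF fm] that by (simp add: Lpnorm_W1p)
      finally show ?thesis .
    qed
    ultimately show ?thesis unfolding AE_M by blast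
  qed
  show "W0_norm (\<lambda>x. c * f x) = \<bar>c\<bar> * W0_norm f" if f: "f \<in> {u. \<exists>G. W0_grad u G}" for f c
  proof -
    obtain G where G: "has_weak_grad D p f G" using f W0_gradD(1) by blast
    have "has_weak_grad D p (\<lambda>x. c * f x) (\<lambda>i x. c * G i x)"
      using has_weak_grad_combine[OF G G, of c 0] by simp
    then show ?thesis using W0_norm_eq[OF G] by (simp add: W0_norm_eq W1p_norm_scale)
  qed
  show "W0_norm (\<lambda>x. f x + g x) \<le> W0_norm f + W0_norm g"
    if f: "f \<in> {u. \<exists>G. W0_grad u G}" and g: "g \<in> {u. \<exists>G. W0_grad u G}" for f g
  proof -
    obtain G where G: "has_weak_grad D p f G" using f W0_gradD(1) by blast
    obtain H where H: "has_weak_grad D p g H" using g W0_gradD(1) by blast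
    have "has_weak_grad D p (\<lambda>x. f x + g x) (\<lambda>i x. G i x + H i x)"
      using has_weak_grad_combine[OF G H, of 1 1] by simp
    then show ?thesis
      using W1p_norm_triangle[OF has_weak_grad_memLp(1)[OF G] has_weak_grad_memLp(1)[OF H]
          has_weak_grad_memLp(2)[OF G] has_weak_grad_memLp(2)[OF H]]
      by (simp add: W0_norm_eq[OF G] W0_norm_eq[OF H] W0_norm_eq)
  qed
  show "\<exists>g\<in>{u. \<exists>G. W0_grad u G}. (\<lambda>j. W0_norm (\<lambda>x. f j x - g x)) \<longlonglongrightarrow> 0"
    if V: "\<And>j. f j \<in> {u. \<exists>G. W0_grad u G}"
      and C: "\<And>e. 0 < e \<Longrightarrow> \<exists>N. \<forall>j\<ge>N. \<forall>k\<ge>N. W0_norm (\<lambda>x. f j x - f k x) < e" for f :: "nat \<Rightarrow> _"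
  proof -
    have "\<exists>G. W0_grad (f j) G" for j using V[of j] by simp
    from W0_complete[OF this C] show ?thesis by blast
  qed
qed

lemma banach_W0: "banach (W0_space D p)"
  unfolding W0_space_eq by (rule function_space.banach_fspace[OF W0_function_space])

end

subsection \<open>A Riccati equation\<close>

text \<open>The condition \<open>1 < p\<close> removes the corner at 0, so that
  \<open>\<bar>\<phi>\<bar> powr p\<close> is differentiable at the zeros of \<open>\<phi>\<close>
  too.\<close>

lemma has_real_derivative_abs_powr:
  fixes p :: real
  assumes p: "1 < p"
  shows "((\<lambda>u. \<bar>u\<bar> powr p) has_real_derivative p * \<bar>u\<bar> powr (p - 1) * sgn u) (at u)"
proof -
  consider "0 < u" | "u < 0" | "u = 0" by linarith
  then show ?thesis
  proof cases
    case 1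
    have "((\<lambda>u. u powr p) has_real_derivative p * \<bar>u\<bar> powr (p - 1) * sgn u) (at u)"
      using 1 by (auto intro!: derivative_eq_intros)
    then show ?thesis
      by (rule has_field_derivative_transform_within_open[of _ _ _ "{0<..}"]) (use 1 in auto)
  next
    case 2
    have "((\<lambda>u. (- u) powr p) has_real_derivative p * \<bar>u\<bar> powr (p - 1) * sgn u) (at u)"
      using 2 by (auto intro!: derivative_eq_intros)
    then show ?thesis
      by (rule has_field_derivative_transform_within_open[of _ _ _ "{..<0}"]) (use 2 in auto)
  next
    case 3
    have "((\<lambda>h. \<bar>h\<bar> powr p / h) \<longlongrightarrow> 0) (at 0)"
    proof (rule Lim_null_comparison)
      show "\<forall>\<^sub>F h::real in at 0. norm (\<bar>h\<bar> powr p / h) \<le> \<bar>h\<bar> powr (p - 1)"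
        by (auto simp: eventually_at_filter powr_diff)
      have "((\<lambda>h::real. \<bar>h\<bar> powr (p - 1)) \<longlongrightarrow> \<bar>0\<bar> powr (p - 1)) (at 0)"
        using p by (intro tendsto_powr' tendsto_rabs tendsto_ident_at tendsto_const) auto
      then show "((\<lambda>h::real. \<bar>h\<bar> powr (p - 1)) \<longlongrightarrow> 0) (at 0)" by simp
    qed
    then show ?thesis using 3 p by (simp add: has_field_derivative_iff)
  qed
qed

section \<open>The generalised arctangent and tangent\<close>

locale exponent =
  fixes p :: real
  assumes p_gt_1: "1 < p"
begin

definition r where "r = p / (p - 1)"

lemma r_props: "1 < r" "1 / p + 1 / r = 1" "(p - 1) * r = p" "(r - 1) * (p - 1) = 1" "(r - 1) * p = r"
  using p_gt_1 by (auto simp: r_def field_simps)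

text \<open>For \<open>p = 2\<close> this is \<open>1 / (1 + y^2)\<close>: then \<open>H\<close> is
  the arctangent, \<open>L\<close> is half of pi and the inverse \<open>T\<close> is the tangent. In
  general \<open>T\<close> solves \<open>T' = (p - 1) * (1 + \<bar>T\<bar> powr r)\<close>, which is
  the Riccati equation up to sign and scaling.\<close>

definition H_deriv :: "real \<Rightarrow> real" where
  "H_deriv y = 1 / ((p - 1) * (1 + \<bar>y\<bar> powr r))"

lemma H_deriv_pos: "0 < H_deriv y"
  using p_gt_1 by (simp add: H_deriv_def add_pos_nonneg)

lemma isCont_H_deriv: "isCont H_deriv y"
proof -
  have "(1 + \<bar>y\<bar> powr r) \<noteq> 0" by (metis add_nonneg_eq_0_iff powr_ge_zero zero_le_one zero_neq_one)
  then show ?thesis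
    unfolding H_deriv_def using p_gt_1
    by (intro continuous_intros DERIV_isCont[OF has_real_derivative_abs_powr[OF r_props(1)]]) auto
qed

lemma ex_H: "\<exists>H. H 0 = 0 \<and> (\<forall>y. (H has_real_derivative H_deriv y) (at y))"
proof -
  obtain F where F: "\<And>y. (F has_vector_derivative H_deriv y) (at y)"
    using einterval_antiderivative[of "-\<infinity>" "\<infinity>" H_deriv] isCont_H_deriv by auto
  have "((\<lambda>y. F y - F 0) has_real_derivative H_deriv y) (at y)" for y
    using F[of y] by (auto simp: has_real_derivative_iff_has_vector_derivative intro!: derivative_eq_intros)
  then show ?thesis by (intro exI[of _ "\<lambda>y. F y - F 0"]) auto
qed

definition H where "H = (SOME H. H 0 = 0 \<and> (\<forall>y. (H has_real_derivative H_deriv y) (at y)))"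

lemma H_0: "H 0 = 0" and DERIV_H: "(H has_real_derivative H_deriv y) (at y)"
proof -
  have "H 0 = 0 \<and> (\<forall>y. (H has_real_derivative H_deriv y) (at y))"
    unfolding H_def by (rule someI_ex[OF ex_H])
  then show "H 0 = 0" "(H has_real_derivative H_deriv y) (at y)" by auto
qed

lemma isCont_H: "isCont H y"
  by (rule DERIV_isCont[OF DERIV_H])

lemma H_strict_mono: "x < y \<Longrightarrow> H x < H y"
  using DERIV_pos_imp_increasing[of x y H] DERIV_H H_deriv_pos by blast

lemma H_minus: "H (- y) = - H y"
proof -
  have "((\<lambda>y. H (- y) + H y) has_real_derivative 0) (at y)" for y
  proof -
    have "((\<lambda>y. H (- y)) has_real_derivative H_deriv (- y) * (- 1)) (at y)"
      by (rule DERIV_chain2[OF DERIV_H]) (auto intro!: derivative_eq_intros)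
    from DERIV_add[OF this DERIV_H[of y]] show ?thesis by (simp add: H_deriv_def)
  qed
  from DERIV_isconst_all[of "\<lambda>y. H (- y) + H y" y 0] this show ?thesis by (simp add: H_0)
qed

text \<open>For positive \<open>y\<close> the derivative is at most
  \<open>(r - 1) * y powr (- r)\<close>, which has the bounded primitive
  \<open>- y powr (- (r - 1))\<close> on \<open>[1, \<infinity>)\<close>. Hence \<open>K\<close>,
  the difference of the two primitives, is nonincreasing there, and it dominates
  \<open>H\<close>.\<close>

lemma H_bounded: "\<exists>B. \<forall>y. H y \<le> B"
proof -
  define K where "K y = H y + y powr (- (r - 1))" for y
  have Kd: "(K has_real_derivative H_deriv y - (r - 1) * y powr (- r)) (at y)" if "0 < y" for y
    unfolding K_def using that by (auto intro!: derivative_eq_intros DERIV_H simp: algebra_simps)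
  have le: "H_deriv y \<le> (r - 1) * y powr (- r)" if "0 < y" for y
  proof -
    have "H_deriv y = (r - 1) * (1 / (1 + y powr r))"
    proof -
      have "r - 1 = 1 / (p - 1)" using p_gt_1 r_props(4) by (simp add: eq_divide_eq)
      then show ?thesis using that by (simp add: H_deriv_def)
    qed
    also have "\<dots> \<le> (r - 1) * (1 / y powr r)"
      using that r_props(1) by (intro mult_left_mono divide_left_mono) (auto intro!: mult_pos_pos add_pos_pos)
    finally show ?thesis by (simp add: powr_minus_divide)
  qed
  have "H y \<le> K 1" if "1 \<le> y" for y
  proof -
    have "K y \<le> K 1"
    proof (rule DERIV_nonpos_imp_nonincreasing[OF that])
      fix x :: real assume "1 \<le> x"
      then show "\<exists>d. (K has_real_derivative d) (at x) \<and> d \<le> 0"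
        using Kd[of x] le[of x] by (intro exI[of _ "H_deriv x - (r - 1) * x powr (- r)"]) simp
    qed
    moreover have "H y \<le> K y" by (simp add: K_def)
    ultimately show ?thesis by simp
  qed
  moreover have "H y \<le> H 1" if "y < 1" for y using H_strict_mono[OF that] by simp
  ultimately have "H y \<le> max (K 1) (H 1)" for y
    using linorder_not_le[of 1 y] max.coboundedI1 max.coboundedI2 by blast
  then show ?thesis by blast
qed

definition L where "L = (SUP y. H y)"

lemma H_less_L: "H y < L"
proof -
  have "H y < H (y + 1)" by (rule H_strict_mono) simp
  also have "\<dots> \<le> L" unfolding L_def using H_bounded by (intro cSUP_upper) (auto simp: bdd_above_def)
  finally show ?thesis .
qed

lemma H_tendsto_L: "(H \<longlongrightarrow> L) at_top"
proof (rule increasing_tendsto)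
  show "\<forall>\<^sub>F y in at_top. H y \<le> L" using H_less_L by (simp add: less_imp_le)
  fix x assume "x < L"
  then obtain y where y: "x < H y"
    unfolding L_def using H_bounded by (subst (asm) less_cSUP_iff) (auto simp: bdd_above_def)
  have "x < H z" if "y \<le> z" for z
    using y that H_strict_mono[of y z] by (cases "y = z") auto
  then show "\<forall>\<^sub>F y in at_top. x < H y" by (auto simp: eventually_at_top_linorder)
qed

lemma L_pos: "0 < L" using H_less_L[of 0] by (simp add: H_0)

text \<open>The substitution \<open>y = ((1 - s\<^sup>p) / s\<^sup>p) powr (1 / r)\<close> carries the integrand of \<^const>\<open>pi_p\<close> to \<^const>\<open>H_deriv\<close>.\<close>
lemma L_eq: "pi_p p = 2 * L"
proof -
  define Y where "Y s = ((1 - s powr p) / s powr p) powr (1 / r)" for s :: real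
  have sp: "0 < s powr p" "s powr p < 1" if "0 < s" "s < 1" for s :: real
    using that p_gt_1 powr_less_mono2[of p s 1] by auto
  \<comment> \<open>\<open>Y\<close> falls from infinity to 0 on \<open>(0, 1)\<close>, which
    explains the minus sign. With \<open>z = Y s powr r\<close> the relation
    \<open>1 + z = 1 / s powr p\<close> makes \<open>H_deriv (Y s)\<close> explicit.\<close>
  have D: "((\<lambda>s. - H (Y s)) has_real_derivative (1 - s powr p) powr (- 1 / p)) (at s)"
    if s: "0 < s" "s < 1" for s
  proof -
    define z where "z = (1 - s powr p) / s powr p"
    have z: "0 < z" "1 + z = 1 / s powr p" using sp[OF s] by (auto simp: z_def field_simps)
    have zd: "((\<lambda>s. (1 - s powr p) / s powr p) has_real_derivative - p * s powr (- p - 1)) (at s)"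
    proof -
      have "((\<lambda>s. s powr (- p) - 1) has_real_derivative - p * s powr (- p - 1)) (at s)"
        using s by (auto intro!: derivative_eq_intros)
      then show ?thesis
        by (rule has_field_derivative_transform_within_open[of _ _ _ "{0<..}"])
           (use s in \<open>auto simp: powr_minus_divide diff_divide_distrib\<close>)
    qed
    have Yd: "(Y has_real_derivative 1 / r * z powr (1 / r - 1) * (- p * s powr (- p - 1))) (at s)"
      unfolding Y_def z_def
      by (rule DERIV_chain2[where f = "\<lambda>z. z powr (1 / r)", OF has_real_derivative_powr zd])
         (use z in \<open>simp add: z_def\<close>)
    have Yr: "\<bar>Y s\<bar> powr r = z" using z r_props(1) by (simp add: Y_def powr_powr flip: z_def)
    have "H_deriv (Y s) = s powr p / (p - 1)" using z by (simp add: H_deriv_def Yr)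
    moreover have "((\<lambda>s. - H (Y s)) has_real_derivative
        - (H_deriv (Y s) * (1 / r * z powr (1 / r - 1) * (- p * s powr (- p - 1))))) (at s)"
      by (intro DERIV_minus DERIV_chain2[OF DERIV_H Yd])
    moreover have "- (s powr p / (p - 1) * (1 / r * z powr (1 / r - 1) * (- p * s powr (- p - 1))))
        = (1 - s powr p) powr (- 1 / p)"
    proof -
      have r1: "1 / r - 1 = - 1 / p" using r_props(2) by simp
      have "z powr (- 1 / p) = (1 - s powr p) powr (- 1 / p) * s"
        using sp[OF s] s p_gt_1 by (simp add: z_def powr_divide powr_powr powr_minus_divide)
      moreover have "s powr p * s powr (- p - 1) = 1 / s" using s by (simp add: powr_minus_divide flip: powr_add)
      moreover have "p / ((p - 1) * r) = 1" using r_props(3) p_gt_1 by simp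
      moreover have "- (s powr p / (p - 1) * (1 / r * z powr (- 1 / p) * (- p * s powr (- p - 1))))
         = p / ((p - 1) * r) * (s powr p * s powr (- p - 1)) * z powr (- 1 / p)" by (simp add: field_simps)
      ultimately show ?thesis using s by (simp add: r1)
    qed
    ultimately show ?thesis by simp
  qed
  have Y_inf: "filterlim Y at_top (at_right 0)"
  proof -
    have "filterlim (\<lambda>s::real. s powr p) (at_right 0) (at_right 0)"
      unfolding filterlim_at
    proof
      show "((\<lambda>s::real. s powr p) \<longlongrightarrow> 0) (at_right 0)"
        using tendsto_powr'[OF tendsto_ident_at tendsto_const[of p], of 0 "{0<..}"] p_gt_1
        by (auto simp: eventually_at_filter)
      show "\<forall>\<^sub>F s::real in at_right 0. s powr p \<in> {0<..} \<and> s powr p \<noteq> 0"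
        by (auto simp: eventually_at_filter)
    qed
    then have "filterlim (\<lambda>s::real. - 1 + inverse (s powr p)) at_top (at_right 0)"
      by (intro filterlim_tendsto_add_at_top[OF tendsto_const] filterlim_compose[OF filterlim_inverse_at_top_right])
    then have 1: "filterlim (\<lambda>s::real. (1 - s powr p) / s powr p) at_top (at_right 0)"
      by (rule filterlim_mono_eventually[OF _ order_refl order_refl])
         (auto simp: eventually_at_filter field_simps inverse_eq_divide)
    have "filterlim (\<lambda>z::real. z powr (1 / r)) at_top at_top"
    proof (rule filterlim_at_top[THEN iffD2, rule_format])
      fix Z :: real
      show "\<forall>\<^sub>F z in at_top. Z \<le> z powr (1 / r)"
        using eventually_ge_at_top[of "(max Z 1) powr r"]
      proof eventually_elim
        case (elim z)
        have "Z \<le> max Z 1" by simp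
        also have "\<dots> = (max Z 1 powr r) powr (1 / r)" using r_props(1) by (simp add: powr_powr)
        also have "\<dots> \<le> z powr (1 / r)" using elim r_props(1) by (intro powr_mono2) auto
        finally show ?case .
      qed
    qed
    from filterlim_compose[OF this 1] show ?thesis by (simp add: Y_def[abs_def])
  qed
  have A: "((\<lambda>s. - H (Y s)) \<longlongrightarrow> - L) (at_right 0)"
    by (intro tendsto_minus filterlim_compose[OF H_tendsto_L Y_inf])
  have B: "((\<lambda>s. - H (Y s)) \<longlongrightarrow> - H 0) (at_left 1)"
  proof (intro tendsto_minus isCont_tendsto_compose[OF isCont_H])
    have "((\<lambda>s. (1 - s powr p) / s powr p) \<longlongrightarrow> (1 - 1 powr p) / 1 powr p) (at_left (1::real))"
      by (intro tendsto_intros) auto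
    then have "((\<lambda>s. ((1 - s powr p) / s powr p) powr (1 / r)) \<longlongrightarrow> ((1 - 1 powr p) / 1 powr p) powr (1 / r)) (at_left (1::real))"
      using r_props(1) p_gt_1
      by (intro tendsto_powr' tendsto_const)
         (auto simp: eventually_at_left_field intro!: exI[of _ 0] divide_nonneg_nonneg powr_le1)
    then show "(Y \<longlongrightarrow> 0) (at_left 1)" using r_props(1) by (simp add: Y_def[abs_def])
  qed
  have "(LBINT s=ereal 0..ereal 1. (1 - s powr p) powr (- 1 / p)) = - H 0 - - L"
  proof (rule interval_integral_FTC_nonneg(2))
    fix s :: real assume s: "ereal 0 < ereal s" "ereal s < ereal 1"
    show "((\<lambda>s. - H (Y s)) has_real_derivative (1 - s powr p) powr (- 1 / p)) (at s)" using D s by simp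
    show "isCont (\<lambda>s. (1 - s powr p) powr (- 1 / p)) s"
      using s sp[of s] by (intro continuous_intros) auto
  next
    show "(((\<lambda>s. - H (Y s)) \<circ> real_of_ereal) \<longlongrightarrow> - L) (at_right (ereal 0))"
      using A by (simp add: ereal_tendsto_simps)
    show "(((\<lambda>s. - H (Y s)) \<circ> real_of_ereal) \<longlongrightarrow> - H 0) (at_left (ereal 1))"
      using B by (simp add: ereal_tendsto_simps)
  qed auto
  then have "(LINT s:{0<..<1}|lborel. (1 - s powr p) powr (- 1 / p)) = L"
    by (simp add: interval_lebesgue_integral_def H_0 einterval_eq_Icc zero_ereal_def one_ereal_def)
  then show ?thesis by (simp add: pi_p_def)
qed

text \<open>A total inverse: outside \<open>(- L, L)\<close>, the range of \<open>H\<close>, its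
  values carry no information, so derivatives and limits are considered on this interval
  only.\<close>

definition T where "T = inv H"

lemma T_H: "T (H y) = y"
proof -
  have "inj H"
    by (rule injI) (metis H_strict_mono less_irrefl linorder_neqE_linordered_idom)
  then show ?thesis by (simp add: T_def)
qed

lemma H_T: 
  assumes "- L < x" "x < L"
  shows "H (T x) = x"
proof -
  have ex: "\<exists>y. z < H y" if "z < L" for z
    using that unfolding L_def using H_bounded by (subst (asm) less_cSUP_iff) (auto simp: bdd_above_def)
  obtain y1 where y1: "x < H y1" using ex assms by blast
  \<comment> \<open>Oddness of \<open>H\<close> reduces the lower bound to an upper one.\<close>
  obtain y2 where y2: "- x < H y2" using ex[of "- x"] assms by auto
  have "H (- y2) < H y1" using y1 y2 by (simp add: H_minus)
  then have "- y2 \<le> y1" using H_strict_mono[of y1 "- y2"] by force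
  then have "\<exists>y. - y2 \<le> y \<and> y \<le> y1 \<and> H y = x"
    using y1 y2 isCont_H by (intro IVT) (auto simp: H_minus)
  then show ?thesis using T_H by auto
qed

lemma DERIV_T:
  assumes x: "- L < x" "x < L"
  shows "(T has_real_derivative (p - 1) * (1 + \<bar>T x\<bar> powr r)) (at x)"
proof -
  have "isCont T (H (T x))"
    by (rule isCont_inverse_function[of 1]) (auto intro: T_H isCont_H)
  then have "isCont T x" using H_T[OF x] by simp
  then have "(T has_real_derivative inverse (H_deriv (T x))) (at x)"
    using x H_T H_deriv_pos[of "T x"] by (intro DERIV_inverse_function[OF DERIV_H]) auto
  then show ?thesis by (simp add: H_deriv_def)
qed

lemma T_mono: "- L < x \<Longrightarrow> x \<le> y \<Longrightarrow> y < L \<Longrightarrow> T x \<le> T y"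
  using H_strict_mono[of "T y" "T x"] H_T[of x] H_T[of y] by (cases "T y < T x") auto

text \<open>The affine map of slope \<open>\<kappa>\<close> takes \<open>(\<alpha>, \<beta>)\<close>
  onto \<open>(- L, L)\<close>. The outer factor is forced: as \<open>(p - 1) * r = p\<close>, it is
  \<open>\<kappa> powr (p - 1)\<close> for which the chain rule and the \<open>r\<close>-th power of
  \<open>w\<close> both produce \<open>\<kappa> powr p\<close>. The constant term
  \<open>\<kappa> powr p * (p - 1)\<close> is the sharp constant of the interval.\<close>

lemma DERIV_Riccati:
  assumes "\<alpha> < \<beta>" "\<alpha> < y" "y < \<beta>"
  defines "\<kappa> \<equiv> pi_p p / (\<beta> - \<alpha>)" and "w \<equiv> (\<lambda>y. - ((pi_p p / (\<beta> - \<alpha>)) powr (p - 1) * T (pi_p p / (\<beta> - \<alpha>) * (y - (\<alpha> + \<beta>) / 2))))"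
  shows "(w has_real_derivative - (\<kappa> powr p * (p - 1)) - (p - 1) * \<bar>w y\<bar> powr r) (at y)"
proof -
  have k: "0 < \<kappa>" using L_pos assms by (simp add: \<kappa>_def L_eq)
  define z where "z = \<kappa> * (y - (\<alpha> + \<beta>) / 2)"
  have "- L < z" "z < L"
    using assms(1-3) L_pos by (auto simp: z_def \<kappa>_def L_eq field_simps)
  note T' = DERIV_T[OF this]
  have "((\<lambda>y. \<kappa> * (y - (\<alpha> + \<beta>) / 2)) has_real_derivative \<kappa>) (at y)"
    by (auto intro!: derivative_eq_intros)
  from DERIV_minus[OF DERIV_cmult[OF DERIV_chain2[OF T'[unfolded z_def] this], of "\<kappa> powr (p - 1)"]]
  have w: "(w has_real_derivative - (\<kappa> powr (p - 1) * ((p - 1) * (1 + \<bar>T z\<bar> powr r) * \<kappa>))) (at y)"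
    by (simp add: w_def z_def \<kappa>_def)
  have a: "\<kappa> powr (p - 1) * ((p - 1) * (1 + \<bar>T z\<bar> powr r) * \<kappa>) = \<kappa> powr p * ((p - 1) * (1 + \<bar>T z\<bar> powr r))"
    using k by (simp add: powr_diff)
  have b: "\<bar>w y\<bar> powr r = \<kappa> powr p * \<bar>T z\<bar> powr r"
    using k r_props(3) by (simp add: w_def z_def \<kappa>_def abs_mult powr_mult powr_powr flip: \<kappa>_def)
  have "- (\<kappa> powr p * ((p - 1) * (1 + \<bar>T z\<bar> powr r))) = - (\<kappa> powr p * (p - 1)) - (p - 1) * \<bar>w y\<bar> powr r"
    unfolding b by (simp add: algebra_simps)
  with w show ?thesis unfolding a by simp
qed

end

subsection \<open>The Friedrichs inequality and the extremal function\<close>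

sublocale Lp_domain \<subseteq> ex: exponent p
  by unfold_locales (rule p_gt_1)

context Lp_domain
begin

text \<open>The weight \<open>w\<close> blows up where \<open>x $ i\<close> approaches
  \<open>\<alpha>\<close> or \<open>\<beta>\<close>, but \<open>\<phi>\<close> vanishes outside a
  compact subset of \<open>D\<close>; so \<open>F\<close> is 0 near the boundary and no boundary
  terms appear. The shape of \<open>D\<close> enters only through the coordinate \<open>i\<close>,
  which allows one inequality per bounded direction.\<close>

lemma Friedrichs_Ccinf:
  assumes \<phi>: "Ccinf D \<phi>" and ab: "\<alpha> < \<beta>" and DI: "\<And>x. x \<in> D \<Longrightarrow> \<alpha> < x $ i \<and> x $ i < \<beta>"
  shows "pi_p p powr p * (p - 1) * (\<beta> - \<alpha>) powr (- p) * Lint D (\<lambda>x. \<bar>\<phi> x\<bar> powr p)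
    \<le> Lint D (\<lambda>x. \<bar>pd i \<phi> x\<bar> powr p)"
proof -
  define \<kappa> where "\<kappa> = pi_p p / (\<beta> - \<alpha>)"
  define w where "w y = - (\<kappa> powr (p - 1) * ex.T (\<kappa> * (y - (\<alpha> + \<beta>) / 2)))" for y
  define \<mu> where "\<mu> = \<kappa> powr p * (p - 1)"
  define w' where "w' y = - \<mu> - (p - 1) * \<bar>w y\<bar> powr ex.r" for y
  have wd: "(w has_real_derivative w' y) (at y)" if "\<alpha> < y" "y < \<beta>" for y
    using ex.DERIV_Riccati[OF ab that] unfolding w'_def \<mu>_def w_def[abs_def] \<kappa>_def .
  obtain K where K: "compact K" "K \<subseteq> D" "\<And>x. x \<notin> K \<Longrightarrow> \<phi> x = 0" "\<And>x i. x \<notin> K \<Longrightarrow> pd i \<phi> x = 0"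
    using Ccinf_support[OF \<phi>] by metis
  obtain R where R: "\<forall>x\<in>K. norm x \<le> R" using compact_imp_bounded[OF K(1)] by (auto simp: bounded_iff)
  have sm: "smooth \<phi>" by (rule Ccinf_smooth[OF \<phi>])
  note c\<phi> = smooth_continuous[OF sm] and cpd = smooth_pd_continuous[OF sm, of i]
  define F where "F x = \<bar>\<phi> x\<bar> powr p * w (x $ i)" for x
  define F' where "F' x = p * \<bar>\<phi> x\<bar> powr (p - 1) * sgn (\<phi> x) * pd i \<phi> x * w (x $ i) + \<bar>\<phi> x\<bar> powr p * w' (x $ i)" for x
  have F0: "F x = 0" "F' x = 0" if "x \<notin> K" for x using K(3)[OF that] by (simp_all add: F_def F'_def)
  have opK: "open (- K)" using K(1) by (simp add: compact_imp_closed open_Compl)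
  have cw: "continuous_on D (\<lambda>x. w (x $ i))"
  proof (rule continuous_on_compose2[of "{\<alpha><..<\<beta>}" w])
    show "continuous_on {\<alpha><..<\<beta>} w"
      by (intro continuous_at_imp_continuous_on ballI DERIV_isCont[OF wd]) auto
  qed (use DI in \<open>auto intro!: continuous_intros\<close>)
  have ca: "continuous_on A (\<lambda>x. \<bar>\<phi> x\<bar> powr s)" if "0 < s" for A s
    using that by (intro continuous_on_powr' continuous_on_rabs continuous_on_subset[OF c\<phi>] continuous_on_const) auto
  have FD: "((\<lambda>t. F (x + t *\<^sub>R axis i 1)) has_real_derivative F' x) (at 0)" for x
  proof (cases "x \<in> D")
    case True
    have e: "(x + t *\<^sub>R axis i 1) $ i = x $ i + t" for t by (simp add: axis_def)
    have "((\<lambda>t. \<bar>\<phi> (x + t *\<^sub>R axis i 1)\<bar> powr p) has_real_derivative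
        p * \<bar>\<phi> x\<bar> powr (p - 1) * sgn (\<phi> x) * pd i \<phi> x) (at 0)"
      by (rule DERIV_chain2[where g = "\<lambda>t. \<phi> (x + t *\<^sub>R axis i 1)"])
         (use has_real_derivative_abs_powr[OF p_gt_1, of "\<phi> x"] smooth_partial1[OF sm] in auto)
    moreover have "((\<lambda>t. w ((x + t *\<^sub>R axis i 1) $ i)) has_real_derivative w' (x $ i)) (at 0)"
      unfolding e using wd[of "x $ i"] DI[OF True] DERIV_shift[of w "w' (x $ i)" 0 "x $ i"]
      by (simp add: add.commute)
    ultimately have "((\<lambda>t. F (x + t *\<^sub>R axis i 1)) has_real_derivative
        p * \<bar>\<phi> x\<bar> powr (p - 1) * sgn (\<phi> x) * pd i \<phi> x * w ((x + 0 *\<^sub>R axis i 1) $ i) + w' (x $ i) * \<bar>\<phi> (x + 0 *\<^sub>R axis i 1)\<bar> powr p) (at 0)"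
      unfolding F_def by (rule DERIV_mult)
    then show ?thesis by (simp add: F'_def mult.commute)
  next
    case False
    then have x: "x \<notin> K" using K by blast
    show ?thesis
    proof (rule has_field_derivative_transform_within_open[of "\<lambda>_. 0"])
      show "open ((\<lambda>t::real. x + t *\<^sub>R axis i 1) -` (- K))"
        by (intro open_vimage opK continuous_intros)
    qed (use x F0 in auto)
  qed
  \<comment> \<open>\<open>D\<close> and the complement of \<open>K\<close> are open and cover the
    space, so continuity can be checked on each of them.\<close>
  have Fc: "continuous_on UNIV F"
  proof -
    have "continuous_on D F" unfolding F_def using p_gt_1 by (intro continuous_on_mult ca cw) auto
    moreover have "continuous_on (- K) F"
      by (rule continuous_on_eq[OF continuous_on_const[of _ 0]]) (use F0 in auto)
    ultimately have "continuous_on (D \<union> - K) F" by (intro continuous_on_open_Un open_D opK)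
    moreover have "D \<union> - K = UNIV" using K by auto
    ultimately show ?thesis by simp
  qed
  \<comment> \<open>\<open>F'\<close> contains \<open>sgn\<close>; a continuous majorant bounds it
    on \<open>K\<close> without a discussion of its own continuity.\<close>
  define B where "B x = p * \<bar>\<phi> x\<bar> powr (p - 1) * \<bar>pd i \<phi> x\<bar> * \<bar>w (x $ i)\<bar>
      + \<bar>\<phi> x\<bar> powr p * (\<mu> + (p - 1) * \<bar>w (x $ i)\<bar> powr ex.r)" for x
  have lam: "0 \<le> \<mu>" using p_gt_1 by (simp add: \<mu>_def)
  have FB: "\<bar>F' x\<bar> \<le> B x" for x
  proof -
    have "\<bar>F' x\<bar> \<le> \<bar>p * \<bar>\<phi> x\<bar> powr (p - 1) * sgn (\<phi> x) * pd i \<phi> x * w (x $ i)\<bar> + \<bar>\<bar>\<phi> x\<bar> powr p * w' (x $ i)\<bar>"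
      unfolding F'_def by (rule abs_triangle_ineq)
    moreover have "\<bar>p * \<bar>\<phi> x\<bar> powr (p - 1) * sgn (\<phi> x) * pd i \<phi> x * w (x $ i)\<bar> \<le> p * \<bar>\<phi> x\<bar> powr (p - 1) * \<bar>pd i \<phi> x\<bar> * \<bar>w (x $ i)\<bar>"
      using p_gt_1 by (simp add: abs_mult abs_sgn_eq)
    moreover have "\<bar>w' (x $ i)\<bar> \<le> \<mu> + (p - 1) * \<bar>w (x $ i)\<bar> powr ex.r"
      using lam p_gt_1 by (simp add: w'_def abs_le_iff)
    then have "\<bar>\<bar>\<phi> x\<bar> powr p * w' (x $ i)\<bar> \<le> \<bar>\<phi> x\<bar> powr p * (\<mu> + (p - 1) * \<bar>w (x $ i)\<bar> powr ex.r)"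
      by (simp add: abs_mult mult_left_mono)
    ultimately show ?thesis unfolding B_def by linarith
  qed
  have "continuous_on K B"
  proof -
    have cwK: "continuous_on K (\<lambda>x. w (x $ i))" using cw K(2) by (rule continuous_on_subset)
    have cwr: "continuous_on K (\<lambda>x. \<bar>w (x $ i)\<bar> powr ex.r)"
      using ex.r_props(1) by (intro continuous_on_powr' continuous_on_rabs cwK continuous_on_const) auto
    show ?thesis unfolding B_def using p_gt_1
      by (intro continuous_on_add continuous_on_mult continuous_on_const continuous_on_rabs ca cwK cwr
          continuous_on_subset[OF cpd]) auto
  qed
  then have "bounded (B ` K)" by (intro compact_imp_bounded compact_continuous_image K)
  then obtain C where C: "\<forall>x\<in>K. \<bar>B x\<bar> \<le> C" by (auto simp: bounded_iff)
  have F'b: "\<bar>F' x\<bar> \<le> max C 0" for x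
  proof (cases "x \<in> K")
    case True
    then have "B x \<le> C" using C by (auto simp: abs_le_iff)
    then show ?thesis using FB[of x] by (simp add: le_max_iff_disj)
  qed (use F0 in simp)
  have Fs: "F x = 0" if "x \<notin> cball 0 R" for x using that R F0[of x] by auto
  note F'i = integral_partial_derivative[OF FD Fc Fs F'b]
  have pt: "F' x \<le> \<bar>pd i \<phi> x\<bar> powr p - \<mu> * \<bar>\<phi> x\<bar> powr p" for x
  proof -
    define b where "b = \<bar>\<phi> x\<bar> powr (p - 1) * \<bar>w (x $ i)\<bar>"
    have "\<bar>pd i \<phi> x\<bar> * b \<le> \<bar>pd i \<phi> x\<bar> powr p / p + b powr ex.r / ex.r"
      by (rule Youngs_inequality[OF p_gt_1 ex.r_props(1,2)]) (simp_all add: b_def)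
    then have "p * (\<bar>pd i \<phi> x\<bar> * b) \<le> p * (\<bar>pd i \<phi> x\<bar> powr p / p + b powr ex.r / ex.r)"
      using p_gt_1 by (intro mult_left_mono) auto
    also have "\<dots> = \<bar>pd i \<phi> x\<bar> powr p + (p / ex.r) * b powr ex.r"
      using p_gt_1 by (simp add: distrib_left)
    \<comment> \<open>The origin of the coefficient \<open>p - 1\<close> in the Riccati equation:
      the term left by Young's inequality cancels exactly against the one in
      \<open>w'\<close>.\<close>
    also have "p / ex.r = p - 1" using ex.r_props(1,3) by (simp add: field_simps)
    also have "b powr ex.r = \<bar>\<phi> x\<bar> powr p * \<bar>w (x $ i)\<bar> powr ex.r"
      using ex.r_props(3) by (simp add: b_def powr_mult powr_powr)
    finally have Y: "p * (\<bar>pd i \<phi> x\<bar> * b) \<le> \<bar>pd i \<phi> x\<bar> powr p + (p - 1) * (\<bar>\<phi> x\<bar> powr p * \<bar>w (x $ i)\<bar> powr ex.r)" .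
    have "p * \<bar>\<phi> x\<bar> powr (p - 1) * sgn (\<phi> x) * pd i \<phi> x * w (x $ i)
        \<le> \<bar>p * \<bar>\<phi> x\<bar> powr (p - 1) * sgn (\<phi> x) * pd i \<phi> x * w (x $ i)\<bar>" by (rule abs_ge_self)
    also have "\<dots> \<le> p * (\<bar>pd i \<phi> x\<bar> * b)"
      using p_gt_1 by (simp add: b_def abs_mult abs_sgn_eq)
    finally have X: "p * \<bar>\<phi> x\<bar> powr (p - 1) * sgn (\<phi> x) * pd i \<phi> x * w (x $ i) \<le> p * (\<bar>pd i \<phi> x\<bar> * b)" .
    have Z: "\<bar>\<phi> x\<bar> powr p * w' (x $ i) = - \<mu> * \<bar>\<phi> x\<bar> powr p - (p - 1) * (\<bar>\<phi> x\<bar> powr p * \<bar>w (x $ i)\<bar> powr ex.r)"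
      by (simp add: w'_def algebra_simps)
    show ?thesis using X Y Z unfolding F'_def by linarith
  qed
  have m: "integrable M (\<lambda>x. \<bar>\<phi> x\<bar> powr p)" "integrable M (\<lambda>x. \<bar>pd i \<phi> x\<bar> powr p)"
    using Ccinf_memLp[OF \<phi>] by (auto simp: memLp_M)
  have "0 = (\<integral>x. F' x \<partial>lborel)" using F'i by simp
  also have "\<dots> = (\<integral>x. F' x \<partial>M)"
    by (rule integral_M_lborel[symmetric]) (use F'i(1) F0 K in auto)
  also have "\<dots> \<le> (\<integral>x. \<bar>pd i \<phi> x\<bar> powr p - \<mu> * \<bar>\<phi> x\<bar> powr p \<partial>M)"
    using m pt integrable_M_lborel[OF F'i(1)] by (intro integral_mono) auto
  also have "\<dots> = Lint D (\<lambda>x. \<bar>pd i \<phi> x\<bar> powr p) - \<mu> * Lint D (\<lambda>x. \<bar>\<phi> x\<bar> powr p)"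
    using m by (simp add: Lint_M)
  finally have "\<mu> * Lint D (\<lambda>x. \<bar>\<phi> x\<bar> powr p) \<le> Lint D (\<lambda>x. \<bar>pd i \<phi> x\<bar> powr p)" by simp
  moreover have "\<mu> = pi_p p powr p * (p - 1) * (\<beta> - \<alpha>) powr (- p)"
    using ab ex.L_pos by (simp add: \<mu>_def \<kappa>_def powr_divide powr_minus_divide ex.L_eq)
  ultimately show ?thesis by simp
qed

end

section \<open>The generalised cosine and its energy\<close>

context exponent
begin

text \<open>The extremal function on \<open>(- L, L)\<close>; for \<open>p = 2\<close> it is the
  cosine. It undoes the Riccati substitution: \<open>T\<close> equals
  \<open>- \<bar>S'\<bar> powr (p - 1) * sgn S' / S powr (p - 1)\<close>, and this relation is also
  the case of equality in Young's inequality. The \<open>p\<close>-th powers of \<open>S\<close> and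
  \<open>\<bar>S'\<bar>\<close> add up to 1.\<close>

definition S where "S x = (1 + \<bar>T x\<bar> powr r) powr (- 1 / p)"

definition S' where "S' x = - (S x * (\<bar>T x\<bar> powr (r - 1) * sgn (T x)))"

lemma one_plus_T: "1 \<le> 1 + \<bar>T x\<bar> powr r" "0 < 1 + \<bar>T x\<bar> powr r" "1 + \<bar>T x\<bar> powr r \<noteq> 0"
  using powr_ge_zero[of "\<bar>T x\<bar>" r] by linarith+

lemma DERIV_T_powr:
  assumes "- L < x" "x < L"
  shows "((\<lambda>x. 1 + \<bar>T x\<bar> powr r) has_real_derivative
    r * \<bar>T x\<bar> powr (r - 1) * sgn (T x) * ((p - 1) * (1 + \<bar>T x\<bar> powr r))) (at x)"
  using DERIV_add[OF DERIV_const DERIV_chain2[OF has_real_derivative_abs_powr[OF r_props(1)] DERIV_T[OF assms]], of 1]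
  by simp

lemma DERIV_S:
  assumes "- L < x" "x < L"
  shows "(S has_real_derivative S' x) (at x)"
proof -
  let ?u = "1 + \<bar>T x\<bar> powr r"
  have "(S has_real_derivative (- 1 / p) * ?u powr (- 1 / p - 1) * (r * \<bar>T x\<bar> powr (r - 1) * sgn (T x) * ((p - 1) * ?u))) (at x)"
    unfolding S_def[abs_def]
    by (rule DERIV_chain2[where f = "\<lambda>z. z powr (- 1 / p)", OF has_real_derivative_powr DERIV_T_powr[OF assms]])
       (rule one_plus_T)
  moreover have "(- 1 / p) * ?u powr (- 1 / p - 1) * (r * \<bar>T x\<bar> powr (r - 1) * sgn (T x) * ((p - 1) * ?u))
      = - ((p - 1) * r / p) * ((?u powr (- 1 / p - 1) * ?u) * (\<bar>T x\<bar> powr (r - 1) * sgn (T x)))"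
    by simp
  moreover have "?u powr (- 1 / p - 1) * ?u = S x"
    using one_plus_T[of x] by (simp add: S_def powr_diff)
  moreover have "(p - 1) * r / p = 1" using r_props(3) p_gt_1 by simp
  ultimately show ?thesis by (simp add: S'_def)
qed

lemma S_bounds: "0 < S x" "S x \<le> 1"
proof -
  show "0 < S x" using one_plus_T[of x] by (simp add: S_def)
  have "S x \<le> 1 powr (- 1 / p)"
    unfolding S_def using one_plus_T[of x] p_gt_1 by (intro powr_mono2') auto
  then show "S x \<le> 1" by simp
qed

lemma S_powr: "S x powr p = 1 / (1 + \<bar>T x\<bar> powr r)"
proof -
  have "S x powr p = (1 + \<bar>T x\<bar> powr r) powr (- 1)" using p_gt_1 by (simp add: S_def powr_powr)
  then show ?thesis using one_plus_T(2)[of x] by (simp add: powr_minus_divide)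
qed

lemma S'_powr: "\<bar>S' x\<bar> powr p = \<bar>T x\<bar> powr r / (1 + \<bar>T x\<bar> powr r)"
proof (cases "T x = 0")
  case False
  then have "\<bar>S' x\<bar> = S x * \<bar>T x\<bar> powr (r - 1)"
    using S_bounds[of x] by (simp add: S'_def abs_mult abs_sgn_eq)
  then show ?thesis using S_bounds[of x] r_props(5) by (simp add: powr_mult powr_powr S_powr)
qed (use p_gt_1 r_props(1) in \<open>simp add: S'_def\<close>)

lemma S'_bound: "\<bar>S' x\<bar> \<le> 1"
proof (rule ccontr)
  assume "\<not> \<bar>S' x\<bar> \<le> 1"
  then have "1 powr p < \<bar>S' x\<bar> powr p" using p_gt_1 by (intro powr_less_mono2) auto
  then show False using one_plus_T[of x] by (simp add: S'_powr)
qed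

text \<open>The only doubtful points are zeros of \<open>T\<close>, where \<open>1 < r\<close> makes
  \<open>\<bar>u\<bar> powr (r - 1) * sgn u\<close> continuous.\<close>

lemma isCont_S':
  assumes x: "- L < x" "x < L"
  shows "isCont S' x"
proof -
  have "isCont (\<lambda>u. \<bar>u\<bar> powr (r - 1) * sgn u) u" for u :: real
  proof (cases "u = 0")
    case True
    have "((\<lambda>u::real. \<bar>u\<bar> powr (r - 1) * sgn u) \<longlongrightarrow> 0) (at 0)"
    proof (rule Lim_null_comparison)
      show "\<forall>\<^sub>F u::real in at 0. norm (\<bar>u\<bar> powr (r - 1) * sgn u) \<le> \<bar>u\<bar> powr (r - 1)"
        by (simp add: abs_mult abs_sgn_eq)
      have "((\<lambda>u::real. \<bar>u\<bar> powr (r - 1)) \<longlongrightarrow> \<bar>0\<bar> powr (r - 1)) (at 0)"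
        using r_props(1) by (intro tendsto_powr' tendsto_rabs tendsto_ident_at tendsto_const) auto
      then show "((\<lambda>u::real. \<bar>u\<bar> powr (r - 1)) \<longlongrightarrow> 0) (at 0)" by simp
    qed
    then show ?thesis using True by (simp add: isCont_def)
  next
    case False
    then show ?thesis by (intro continuous_intros isCont_sgn) auto
  qed
  then have "isCont (\<lambda>x. \<bar>T x\<bar> powr (r - 1) * sgn (T x)) x"
    by (rule isCont_o2[OF DERIV_isCont[OF DERIV_T[OF x]]])
  then show ?thesis
    unfolding S'_def[abs_def]
    by (intro continuous_minus continuous_mult[OF DERIV_isCont[OF DERIV_S[OF x]]])
qed

text \<open>The function is \<open>T * S powr p\<close>, that is
  \<open>- \<bar>S'\<bar> powr (p - 1) * sgn S' * S\<close>, the boundary term in the integration by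
  parts of the energy. It tends to 0 at both ends of the interval, so integrating its derivative
  compares the two energies.\<close>

lemma DERIV_E:
  assumes x: "- L < x" "x < L"
  shows "((\<lambda>x. T x / (1 + \<bar>T x\<bar> powr r)) has_real_derivative (p - 1) * S x powr p - \<bar>S' x\<bar> powr p) (at x)"
proof -
  let ?u = "1 + \<bar>T x\<bar> powr r"
  have "((\<lambda>x. T x / (1 + \<bar>T x\<bar> powr r)) has_real_derivative
    (((p - 1) * ?u) * ?u - T x * (r * \<bar>T x\<bar> powr (r - 1) * sgn (T x) * ((p - 1) * ?u))) / (?u * ?u)) (at x)"
    by (rule DERIV_divide[OF DERIV_T[OF x] DERIV_T_powr[OF x] one_plus_T(3)])
  moreover have "T x * (r * \<bar>T x\<bar> powr (r - 1) * sgn (T x) * ((p - 1) * ?u)) = ((p - 1) * ?u) * (r * \<bar>T x\<bar> powr r)"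
  proof -
    have "T x * (r * \<bar>T x\<bar> powr (r - 1) * sgn (T x) * ((p - 1) * ?u))
        = ((p - 1) * ?u) * (r * ((T x * sgn (T x)) * \<bar>T x\<bar> powr (r - 1)))" by (simp only: mult_ac)
    also have "T x * sgn (T x) = \<bar>T x\<bar>" by (simp add: abs_sgn)
    also have "\<bar>T x\<bar> * \<bar>T x\<bar> powr (r - 1) = \<bar>T x\<bar> powr r"
      by (cases "T x = 0") (auto simp: powr_diff)
    finally show ?thesis .
  qed
  moreover have "(((p - 1) * ?u) * ?u - ((p - 1) * ?u) * (r * \<bar>T x\<bar> powr r)) / (?u * ?u) = (p - 1) * S x powr p - \<bar>S' x\<bar> powr p"
  proof -
    have "(((p - 1) * ?u) * ?u - ((p - 1) * ?u) * (r * \<bar>T x\<bar> powr r))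
        = ?u * ((p - 1) * (?u - r * \<bar>T x\<bar> powr r))" by (simp only: right_diff_distrib mult_ac)
    then have "(((p - 1) * ?u) * ?u - ((p - 1) * ?u) * (r * \<bar>T x\<bar> powr r)) / (?u * ?u)
        = ((p - 1) * (?u - r * \<bar>T x\<bar> powr r)) / ?u"
      using one_plus_T(3)[of x] by simp
    also have "(p - 1) * (?u - r * \<bar>T x\<bar> powr r) = (p - 1) - ((r - 1) * (p - 1)) * \<bar>T x\<bar> powr r"
      by (simp add: algebra_simps)
    also have "\<dots> = (p - 1) - \<bar>T x\<bar> powr r" by (simp add: r_props(4))
    finally show ?thesis by (simp add: S_powr S'_powr diff_divide_distrib)
  qed
  ultimately show ?thesis by simp
qed

lemma T_at_ends: "filterlim T at_top (at_left L)" "filterlim T at_bot (at_right (- L))"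
proof -
  show "filterlim T at_top (at_left L)"
  proof (rule filterlim_at_top[THEN iffD2, rule_format])
    fix Z
    have "Z \<le> T x" if "H Z < x" "x < L" for x
    proof -
      have "- L < H Z" using H_less_L[of "- Z"] by (simp add: H_minus)
      then show ?thesis using T_mono[of "H Z" x] that by (simp add: T_H)
    qed
    then show "\<forall>\<^sub>F x in at_left L. Z \<le> T x"
      unfolding eventually_at_left_field using H_less_L[of Z] by (intro exI[of _ "H Z"]) auto
  qed
  show "filterlim T at_bot (at_right (- L))"
  proof (rule filterlim_at_bot[THEN iffD2, rule_format])
    fix Z
    have "T x \<le> Z" if "- L < x" "x < H Z" for x
      using T_mono[of x "H Z"] that H_less_L[of Z] by (simp add: T_H)
    moreover have "- L < H Z" using H_less_L[of "- Z"] by (simp add: H_minus)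
    ultimately show "\<forall>\<^sub>F x in at_right (- L). T x \<le> Z"
      unfolding eventually_at_right_field by (intro exI[of _ "H Z"]) auto
  qed
qed

lemma abs_T_at_ends:
  assumes "f = at_left L \<or> f = at_right (- L)"
  shows "filterlim (\<lambda>x. \<bar>T x\<bar>) at_top f"
  using assms
proof
  assume "f = at_left L"
  then show ?thesis
    using T_at_ends(1) by (auto intro!: filterlim_at_top_mono[OF _ always_eventually[OF allI[OF abs_ge_self]]])
next
  assume f: "f = at_right (- L)"
  have "filterlim (\<lambda>x. - T x) at_top f" unfolding f
    using T_at_ends(2) by (simp add: filterlim_uminus_at_top)
  then show ?thesis
    by (rule filterlim_at_top_mono) (auto intro!: always_eventually)
qed

lemma S_at_ends:
  assumes f: "f = at_left L \<or> f = at_right (- L)"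
  shows "(S \<longlongrightarrow> 0) f" "((\<lambda>x. T x / (1 + \<bar>T x\<bar> powr r)) \<longlongrightarrow> 0) f"
proof -
  have lim: "((\<lambda>x. \<bar>T x\<bar> powr (- s)) \<longlongrightarrow> 0) f" if "0 < s" for s
    by (rule tendsto_neg_powr[OF _ abs_T_at_ends[OF f]]) (use that in simp)
  have pos: "\<forall>\<^sub>F x in f. 0 < \<bar>T x\<bar>"
    using abs_T_at_ends[OF f] unfolding filterlim_at_top_dense by blast
  show "(S \<longlongrightarrow> 0) f"
  proof (rule Lim_null_comparison)
    show "((\<lambda>x. \<bar>T x\<bar> powr (- (r / p))) \<longlongrightarrow> 0) f" using r_props(1) p_gt_1 by (intro lim) simp
    show "\<forall>\<^sub>F x in f. norm (S x) \<le> \<bar>T x\<bar> powr (- (r / p))"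
      using pos
    proof eventually_elim
      case (elim x)
      have "S x \<le> (\<bar>T x\<bar> powr r) powr (- 1 / p)"
        unfolding S_def using elim p_gt_1 by (intro powr_mono2') auto
      then show ?case using S_bounds[of x] by (simp add: powr_powr)
    qed
  qed
  show "((\<lambda>x. T x / (1 + \<bar>T x\<bar> powr r)) \<longlongrightarrow> 0) f"
  proof (rule Lim_null_comparison)
    show "((\<lambda>x. \<bar>T x\<bar> powr (- (r - 1))) \<longlongrightarrow> 0) f" using r_props(1) by (intro lim) simp
    show "\<forall>\<^sub>F x in f. norm (T x / (1 + \<bar>T x\<bar> powr r)) \<le> \<bar>T x\<bar> powr (- (r - 1))"
      using pos
    proof eventually_elim
      case (elim x)
      have "norm (T x / (1 + \<bar>T x\<bar> powr r)) = \<bar>T x\<bar> / (1 + \<bar>T x\<bar> powr r)"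
        using one_plus_T[of x] by simp
      also have "\<dots> \<le> \<bar>T x\<bar> / \<bar>T x\<bar> powr r"
        using elim one_plus_T[of x] by (intro divide_left_mono mult_pos_pos) auto
      also have "\<dots> = \<bar>T x\<bar> powr (- (r - 1))" using elim by (simp add: powr_diff)
      finally show ?case .
    qed
  qed
qed

end

subsection \<open>Smooth almost-extremal functions\<close>

lemma integrable_indicator_Ioo:
  fixes a b :: real
  shows "integrable lborel (\<lambda>x. B * indicat_real {a<..<b} x)"
proof -
  have "bounded {a<..<b}"
    by (rule bounded_subset[OF compact_imp_bounded[OF compact_Icc[of a b]]]) auto
  then have "emeasure lborel {a<..<b} < \<infinity>" by (rule emeasure_bounded_finite)
  then show ?thesis by auto
qed

lemma bounded_set_integrable:
  fixes f :: "real \<Rightarrow> real"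
  assumes "continuous_on {a<..<b} f" and bd: "\<And>x. x \<in> {a<..<b} \<Longrightarrow> \<bar>f x\<bar> \<le> B"
  shows "set_integrable lborel {a<..<b} f"
  unfolding set_integrable_def
proof (rule Bochner_Integration.integrable_bound)
  show "integrable lborel (\<lambda>x. B * indicat_real {a<..<b} x)" by (rule integrable_indicator_Ioo)
  show "(\<lambda>x. indicat_real {a<..<b} x *\<^sub>R f x) \<in> borel_measurable lborel"
    using borel_measurable_continuous_on_indicator[OF _ assms(1)] by simp
  show "AE x in lborel. norm (indicat_real {a<..<b} x *\<^sub>R f x) \<le> norm (B * indicat_real {a<..<b} x)"
    using bd by (auto simp: indicator_def intro!: AE_I2 order_trans[OF _ abs_ge_self])
qed

lemma abs_set_integral_le:
  fixes f :: "real \<Rightarrow> real"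
  assumes ab: "a \<le> b" and c: "continuous_on {a<..<b} f" and bd: "\<And>x. x \<in> {a<..<b} \<Longrightarrow> \<bar>f x\<bar> \<le> B"
  shows "\<bar>LINT x:{a<..<b}|lborel. f x\<bar> \<le> B * (b - a)"
proof -
  have "\<bar>LINT x:{a<..<b}|lborel. f x\<bar> \<le> (\<integral>x. \<bar>indicat_real {a<..<b} x *\<^sub>R f x\<bar> \<partial>lborel)"
    unfolding set_lebesgue_integral_def by simp
  also have "\<dots> \<le> (\<integral>x. B * indicat_real {a<..<b} x \<partial>lborel)"
  proof (rule integral_mono)
    show "integrable lborel (\<lambda>x. \<bar>indicat_real {a<..<b} x *\<^sub>R f x\<bar>)"
      using bounded_set_integrable[OF c bd] by (simp add: set_integrable_def)
    show "integrable lborel (\<lambda>x. B * indicat_real {a<..<b} x)" by (rule integrable_indicator_Ioo)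
  qed (use bd in \<open>auto simp: indicator_def\<close>)
  also have "\<dots> = B * (b - a)" using ab by simp
  finally show ?thesis .
qed

lemma bounded_convergence:
  fixes f :: "nat \<Rightarrow> real \<Rightarrow> real"
  assumes c: "\<And>n. continuous_on {a<..<b} (f n)" "continuous_on {a<..<b} g"
    and bd: "\<And>n x. x \<in> {a<..<b} \<Longrightarrow> \<bar>f n x\<bar> \<le> B"
    and lim: "\<And>x. x \<in> {a<..<b} \<Longrightarrow> (\<lambda>n. f n x) \<longlonglongrightarrow> g x"
  shows "(\<lambda>n. LINT x:{a<..<b}|lborel. f n x) \<longlonglongrightarrow> (LINT x:{a<..<b}|lborel. g x)"
  unfolding set_lebesgue_integral_def
proof (rule integral_dominated_convergence)
  show "integrable lborel (\<lambda>x. B * indicat_real {a<..<b} x)" by (rule integrable_indicator_Ioo)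
  show "(\<lambda>x. indicat_real {a<..<b} x *\<^sub>R g x) \<in> borel_measurable lborel"
    using borel_measurable_continuous_on_indicator[OF _ c(2)] by simp
  show "(\<lambda>x. indicat_real {a<..<b} x *\<^sub>R f n x) \<in> borel_measurable lborel" for n
    using borel_measurable_continuous_on_indicator[OF _ c(1)] by simp
  show "AE x in lborel. (\<lambda>n. indicat_real {a<..<b} x *\<^sub>R f n x) \<longlonglongrightarrow> indicat_real {a<..<b} x *\<^sub>R g x"
    using lim by (auto simp: indicator_def intro!: AE_I2)
  show "AE x in lborel. norm (indicat_real {a<..<b} x *\<^sub>R f n x) \<le> B * indicat_real {a<..<b} x" for n
    using bd by (auto simp: indicator_def intro!: AE_I2)
qed

text \<open>Stated with one-sided limits because \<open>S\<close> and \<open>T\<close> are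
  controlled only inside the open interval; boundedness of \<open>f\<close> supplies integrability
  up to the ends.\<close>

lemma FTC_open_interval:
  fixes f F :: "real \<Rightarrow> real"
  assumes ab: "a < b" and D: "\<And>x. x \<in> {a<..<b} \<Longrightarrow> (F has_real_derivative f x) (at x)"
    and c: "\<And>x. x \<in> {a<..<b} \<Longrightarrow> isCont f x"
    and bd: "\<And>x. x \<in> {a<..<b} \<Longrightarrow> \<bar>f x\<bar> \<le> B"
    and lim: "(F \<longlongrightarrow> c1) (at_right a)" "(F \<longlongrightarrow> c2) (at_left b)"
  shows "(LINT x:{a<..<b}|lborel. f x) = c2 - c1"
proof -
  have "(LBINT x=ereal a..ereal b. f x) = c2 - c1"
  proof (rule interval_integral_FTC_integrable)
    show "set_integrable lborel (einterval (ereal a) (ereal b)) f"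
      using bounded_set_integrable[OF continuous_at_imp_continuous_on bd] c by simp
    show "((F \<circ> real_of_ereal) \<longlongrightarrow> c1) (at_right (ereal a))" "((F \<circ> real_of_ereal) \<longlongrightarrow> c2) (at_left (ereal b))"
      using lim by (simp_all add: ereal_tendsto_simps)
  qed (use ab D c in \<open>auto simp: has_real_derivative_iff_has_vector_derivative\<close>)
  then show ?thesis using ab by (simp add: interval_lebesgue_integral_def)
qed

context exponent
begin

lemma isCont_S: "- L < x \<Longrightarrow> x < L \<Longrightarrow> isCont S x"
  by (rule DERIV_isCont[OF DERIV_S])

lemma S_integral:
  assumes "- L < x" "x < L"
  shows "(LINT y:{- L<..<x}|lborel. S' y) = S x"
proof -
  have "(LINT y:{- L<..<x}|lborel. S' y) = S x - 0"
  proof (rule FTC_open_interval)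
    show "(S \<longlongrightarrow> 0) (at_right (- L))" by (rule S_at_ends) simp
    show "(S \<longlongrightarrow> S x) (at_left x)"
      using isCont_S[OF assms] by (simp add: isCont_def filterlim_at_split)
  qed (use assms in \<open>auto intro: DERIV_S isCont_S' S'_bound\<close>)
  then show ?thesis by simp
qed

lemma S'_integral: "(LINT y:{- L<..<L}|lborel. S' y) = 0"
proof -
  have "(LINT y:{- L<..<L}|lborel. S' y) = 0 - 0"
  proof (rule FTC_open_interval)
    show "(S \<longlongrightarrow> 0) (at_right (- L))" "(S \<longlongrightarrow> 0) (at_left L)" by (rule S_at_ends, simp)+
  qed (use L_pos in \<open>auto intro: DERIV_S isCont_S' S'_bound\<close>)
  then show ?thesis by simp
qed

lemma isCont_abs_powr: "isCont f x \<Longrightarrow> isCont (\<lambda>x. \<bar>f x\<bar> powr p) x" for f :: "real \<Rightarrow> real"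
  by (rule isCont_o2[OF _ DERIV_isCont[OF has_real_derivative_abs_powr[OF p_gt_1]]])

lemma abs_powr_le_1: "\<bar>u\<bar> \<le> 1 \<Longrightarrow> \<bar>u\<bar> powr p \<le> 1"
  using powr_mono2[of p "\<bar>u\<bar>" 1] p_gt_1 by simp

lemma S_energy:
  "(LINT y:{- L<..<L}|lborel. \<bar>S' y\<bar> powr p) = (p - 1) * (LINT y:{- L<..<L}|lborel. \<bar>S y\<bar> powr p)"
  "0 < (LINT y:{- L<..<L}|lborel. \<bar>S y\<bar> powr p)"
proof -
  have cS: "isCont (\<lambda>y. \<bar>S y\<bar> powr p) y" "isCont (\<lambda>y. \<bar>S' y\<bar> powr p) y" if "y \<in> {- L<..<L}" for y
    using that by (auto intro!: isCont_abs_powr isCont_S isCont_S')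
  have bS: "\<bar>\<bar>S y\<bar> powr p\<bar> \<le> 1" "\<bar>\<bar>S' y\<bar> powr p\<bar> \<le> 1" for y
    using S_bounds[of y] S'_bound[of y] abs_powr_le_1[of "S y"] abs_powr_le_1[of "S' y"] by auto
  have I: "set_integrable lborel {- L<..<L} (\<lambda>y. \<bar>S y\<bar> powr p)" "set_integrable lborel {- L<..<L} (\<lambda>y. \<bar>S' y\<bar> powr p)"
    using cS bS by (intro bounded_set_integrable[where B = 1] continuous_at_imp_continuous_on ballI; simp)+
  have "(LINT y:{- L<..<L}|lborel. (p - 1) * \<bar>S y\<bar> powr p - \<bar>S' y\<bar> powr p) = 0 - 0"
  proof (rule FTC_open_interval)
    show "((\<lambda>x. T x / (1 + \<bar>T x\<bar> powr r)) \<longlongrightarrow> 0) (at_right (- L))"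
      "((\<lambda>x. T x / (1 + \<bar>T x\<bar> powr r)) \<longlongrightarrow> 0) (at_left L)"
      by (rule S_at_ends, simp)+
    fix y assume y: "y \<in> {- L<..<L}"
    show "((\<lambda>x. T x / (1 + \<bar>T x\<bar> powr r)) has_real_derivative (p - 1) * \<bar>S y\<bar> powr p - \<bar>S' y\<bar> powr p) (at y)"
      using DERIV_E[of y] y S_bounds[of y] by simp
    show "isCont (\<lambda>y. (p - 1) * \<bar>S y\<bar> powr p - \<bar>S' y\<bar> powr p) y"
      by (intro continuous_diff continuous_mult continuous_const cS y)
    have "\<bar>(p - 1) * \<bar>S y\<bar> powr p - \<bar>S' y\<bar> powr p\<bar> \<le> (p - 1) * \<bar>S y\<bar> powr p + \<bar>S' y\<bar> powr p"
      using p_gt_1 by (simp add: abs_le_iff)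
    also have "\<dots> \<le> (p - 1) * 1 + 1"
      using bS p_gt_1 by (intro add_mono mult_left_mono) auto
    finally show "\<bar>(p - 1) * \<bar>S y\<bar> powr p - \<bar>S' y\<bar> powr p\<bar> \<le> p" by simp
  qed (use L_pos in auto)
  then show 1: "(LINT y:{- L<..<L}|lborel. \<bar>S' y\<bar> powr p) = (p - 1) * (LINT y:{- L<..<L}|lborel. \<bar>S y\<bar> powr p)"
    using I by (subst (asm) set_integral_diff) auto
  \<comment> \<open>The two \<open>p\<close>-th powers add up to 1, so together with the first
    identity \<open>p\<close> times the integral equals the length \<open>2 * L\<close>; positivity
    follows.\<close>
  have "(LINT y:{- L<..<L}|lborel. \<bar>S y\<bar> powr p + \<bar>S' y\<bar> powr p) = (LINT y:{- L<..<L}|lborel. 1)"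
  proof (intro arg_cong[where f = "set_lebesgue_integral lborel {- L<..<L}"] ext)
    fix y show "\<bar>S y\<bar> powr p + \<bar>S' y\<bar> powr p = 1"
      using S_bounds[of y] one_plus_T(3)[of y] by (simp add: S_powr S'_powr flip: add_divide_distrib)
  qed
  also have "\<dots> = 2 * L" using L_pos by (simp add: set_lebesgue_integral_def)
  finally have "p * (LINT y:{- L<..<L}|lborel. \<bar>S y\<bar> powr p) = 2 * L"
    using I by (subst (asm) set_integral_add) (auto simp: 1 algebra_simps)
  then show "0 < (LINT y:{- L<..<L}|lborel. \<bar>S y\<bar> powr p)"
    using L_pos p_gt_1 by (metis mult_pos_pos not_one_less_zero order_less_trans zero_less_mult_pos zero_less_numeral zero_less_one)
qed

text \<open>The derivative \<open>h n\<close> of the test function is a smooth compactly supported approximation of \<open>S'\<close>,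
  corrected by a multiple of a fixed bump so that its integral vanishes and hence its primitive
  also has compact support.\<close>
lemma ex_smooth_derivative:
  obtains h :: "nat \<Rightarrow> real \<Rightarrow> real" and B
  where "\<And>n. smooth_real (h n)" "\<And>n. \<exists>l u. - L < l \<and> l < u \<and> u < L \<and> (\<forall>y. y \<notin> {l..u} \<longrightarrow> h n y = 0)"
    "\<And>n. (LINT y:{- L<..<L}|lborel. h n y) = 0" "\<And>n y. \<bar>h n y\<bar> \<le> B"
    "\<And>y. y \<in> {- L<..<L} \<Longrightarrow> (\<lambda>n. h n y) \<longlonglongrightarrow> S' y"
proof -
  \<comment> \<open>The approximation holds on the interval outside which
    \<open>plateau (Suc n) (- L) L\<close> vanishes, so the growth of the polynomial elsewhere is
    harmless. For small \<open>n\<close> this interval may be empty.\<close>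
  have "\<exists>P. real_polynomial_function P \<and>
      (\<forall>y\<in>{- L + 1 / real (Suc n)..L - 1 / real (Suc n)}. \<bar>S' y - P y\<bar> < 1 / real (Suc n))" for n
  proof -
    define d where "d = 1 / real (Suc n)"
    have d: "0 < d" by (simp add: d_def)
    then have "continuous_on {- L + d..L - d} S'"
      by (intro continuous_at_imp_continuous_on ballI isCont_S') auto
    from Stone_Weierstrass_real_polynomial_function[OF compact_Icc this d]
    obtain P where "real_polynomial_function P" "\<And>y. y \<in> {- L + d..L - d} \<Longrightarrow> \<bar>S' y - P y\<bar> < d" by blast
    then show ?thesis unfolding d_def by blast
  qed
  then obtain P where P: "\<And>n. real_polynomial_function (P n)"
    and PS: "\<And>n y. y \<in> {- L + 1 / real (Suc n)..L - 1 / real (Suc n)} \<Longrightarrow> \<bar>S' y - P n y\<bar> < 1 / real (Suc n)"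
    by metis
  define a where "a n y = P n y * plateau (Suc n) (- L) L y" for n y
  have a_smooth: "smooth_real (a n)" for n
    unfolding a_def[abs_def] by (intro smooth_real_mult smooth_plateau smooth_real_polynomial P)
  have a0: "a n y = 0" if "y \<notin> {- L + 1 / real (Suc n)..L - 1 / real (Suc n)}" for n y
    using plateau_support[of "Suc n" y "- L" L] that by (simp add: a_def)
  \<comment> \<open>The bound is 1 for \<open>S'\<close> plus at most 1 for the error of
    approximation.\<close>
  have a_bound: "\<bar>a n y\<bar> \<le> 2" for n y
  proof (cases "y \<in> {- L + 1 / real (Suc n)..L - 1 / real (Suc n)}")
    case True
    have "1 / real (Suc n) \<le> 1" by simp
    then have "\<bar>P n y\<bar> \<le> 2" using PS[OF True] S'_bound[of y] by linarith
    then have "\<bar>P n y\<bar> * \<bar>plateau (Suc n) (- L) L y\<bar> \<le> 2 * 1"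
      using plateau_bounds[of "Suc n" "- L" L y] by (intro mult_mono) auto
    then show ?thesis by (simp add: a_def abs_mult)
  qed (simp add: a0)
  have a_lim: "(\<lambda>n. a n y) \<longlonglongrightarrow> S' y" if y: "y \<in> {- L<..<L}" for y
  proof -
    have inv: "(\<lambda>n. 1 / real (Suc n)) \<longlonglongrightarrow> 0"
      using LIMSEQ_inverse_real_of_nat by (simp add: inverse_eq_divide)
    have "\<forall>\<^sub>F n in sequentially. 1 / real (Suc n) < min (y + L) (L - y)"
      by (rule order_tendstoD(2)[OF inv]) (use y in simp)
    then have "\<forall>\<^sub>F n in sequentially. norm (P n y - S' y) \<le> 1 / real (Suc n)"
    proof eventually_elim
      case (elim n)
      then have "y \<in> {- L + 1 / real (Suc n)..L - 1 / real (Suc n)}" by (auto simp del: of_nat_Suc)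
      from PS[OF this] show ?case by (simp add: abs_minus_commute)
    qed
    from Lim_null_comparison[OF this inv] have "(\<lambda>n. P n y) \<longlonglongrightarrow> S' y" by (rule LIM_zero_cancel)
    from tendsto_mult[OF this LIMSEQ_Suc[OF plateau_tendsto[OF y]]] show ?thesis by (simp add: a_def)
  qed
  have cS': "continuous_on {- L<..<L} S'"
    by (intro continuous_at_imp_continuous_on ballI isCont_S') auto
  have "(\<lambda>n. LINT y:{- L<..<L}|lborel. plateau (Suc n) (- L) L y) \<longlonglongrightarrow> (LINT y:{- L<..<L}|lborel. 1)"
    by (rule bounded_convergence[where B = 1])
       (auto intro!: smooth_real_continuous smooth_plateau LIMSEQ_Suc plateau_tendsto simp: plateau_bounds)
  moreover have "0 < (LINT y:{- L<..<L}|lborel. (1::real))" using L_pos by (simp add: set_lebesgue_integral_def)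
  ultimately have "\<forall>\<^sub>F n in sequentially. 0 < (LINT y:{- L<..<L}|lborel. plateau (Suc n) (- L) L y)"
    by (rule order_tendstoD(1))
  then obtain N0 where N0: "0 < (LINT y:{- L<..<L}|lborel. plateau (Suc N0) (- L) L y)"
    by (auto simp: eventually_sequentially)
  \<comment> \<open>The fixed bump is some plateau with positive integral; it exists because these
    integrals tend to \<open>2 * L\<close>.\<close>
  define \<beta> where "\<beta> = plateau (Suc N0) (- L) L"
  define c where "c = (LINT y:{- L<..<L}|lborel. \<beta> y)"
  have c: "0 < c" using N0 by (simp add: c_def \<beta>_def)
  \<comment> \<open>The multiple of the bump that cancels the integral of \<open>a n\<close>. It
    tends to 0 because \<open>S'\<close> has integral 0, so the correction does not disturb the
    limit.\<close>
  define m where "m n = (LINT y:{- L<..<L}|lborel. a n y) / c" for n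
  have "(\<lambda>n. LINT y:{- L<..<L}|lborel. a n y) \<longlonglongrightarrow> (LINT y:{- L<..<L}|lborel. S' y)"
    by (rule bounded_convergence[where B = 2]) (auto intro: smooth_real_continuous a_smooth cS' a_bound a_lim)
  then have m_lim: "m \<longlonglongrightarrow> 0"
    unfolding m_def[abs_def] S'_integral using tendsto_divide[OF _ tendsto_const[of c]] c by fastforce
  then obtain C where C: "\<And>n. \<bar>m n\<bar> \<le> C"
    using convergent_imp_Bseq[OF convergentI[OF m_lim]] unfolding Bseq_def by auto
  define h where "h n y = a n y + (- m n) * \<beta> y" for n y
  have h_smooth: "smooth_real (h n)" for n
    unfolding h_def[abs_def] \<beta>_def
    by (intro smooth_real_add smooth_real_mult smooth_real_const a_smooth smooth_plateau)
  show thesis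
  proof (rule that[of h "2 + C"])
    show "smooth_real (h n)" for n by (rule h_smooth)
    show "\<exists>l u. - L < l \<and> l < u \<and> u < L \<and> (\<forall>y. y \<notin> {l..u} \<longrightarrow> h n y = 0)" for n
    proof -
      \<comment> \<open>The bound \<open>L / 2\<close> keeps the two end points of the support
        interval apart.\<close>
      define \<delta> where "\<delta> = min (L / 2) (min (1 / real (Suc n)) (1 / real (Suc N0)))"
      have \<delta>: "0 < \<delta>" "\<delta> \<le> L / 2" "\<delta> \<le> 1 / real (Suc n)" "\<delta> \<le> 1 / real (Suc N0)"
        using L_pos by (auto simp: \<delta>_def)
      have "h n y = 0" if "y \<notin> {- L + \<delta>..L - \<delta>}" for y
      proof -
        have "y \<notin> {- L + 1 / real (Suc n)..L - 1 / real (Suc n)}" "y \<notin> {- L + 1 / real (Suc N0)..L - 1 / real (Suc N0)}"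
          using that \<delta> by (auto simp del: of_nat_Suc)
        then show ?thesis using a0 plateau_support[of "Suc N0" y "- L" L] by (simp add: h_def \<beta>_def)
      qed
      then show ?thesis using \<delta> L_pos by (intro exI[of _ "- L + \<delta>"] exI[of _ "L - \<delta>"]) auto
    qed
    have b\<beta>: "\<bar>\<beta> y\<bar> \<le> 1" for y using plateau_bounds[of "Suc N0" "- L" L y] by (simp add: \<beta>_def)
    show "(LINT y:{- L<..<L}|lborel. h n y) = 0" for n
    proof -
      have "set_integrable lborel {- L<..<L} (a n)"
        by (rule bounded_set_integrable[OF smooth_real_continuous[OF a_smooth] a_bound])
      moreover have "set_integrable lborel {- L<..<L} (\<lambda>y. (- m n) * \<beta> y)"
        by (intro set_integrable_mult_right impI bounded_set_integrable[OF smooth_real_continuous b\<beta>])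
           (simp add: \<beta>_def smooth_plateau)
      ultimately have "(LINT y:{- L<..<L}|lborel. h n y) = (LINT y:{- L<..<L}|lborel. a n y) + (- m n) * c"
        unfolding h_def c_def by (simp only: set_integral_add(2) set_integral_mult_right)
      then show ?thesis using c by (simp add: m_def)
    qed
    show "\<bar>h n y\<bar> \<le> 2 + C" for n y
    proof -
      have "\<bar>h n y\<bar> \<le> \<bar>a n y\<bar> + \<bar>m n\<bar> * \<bar>\<beta> y\<bar>"
        unfolding h_def by (metis abs_minus_cancel abs_mult abs_triangle_ineq)
      also have "\<dots> \<le> 2 + C * 1"
        using a_bound C b\<beta> by (intro add_mono mult_mono) (auto intro: order_trans[OF abs_ge_zero])
      finally show ?thesis by simp
    qed
    show "(\<lambda>n. h n y) \<longlonglongrightarrow> S' y" if "y \<in> {- L<..<L}" for y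
      using tendsto_add[OF a_lim[OF that] tendsto_mult[OF tendsto_minus[OF m_lim] tendsto_const[of "\<beta> y"]]]
      by (simp add: h_def)
  qed
qed

text \<open>The primitives of the \<open>h n\<close> converge to \<open>S\<close> and their
  derivatives to \<open>S'\<close>, both boundedly, so the energies converge to those of
  \<open>S\<close>, whose ratio is exactly \<open>p - 1\<close>. The slack \<open>e\<close> turns
  the limit into an inequality for one member of the sequence.\<close>

lemma ex_test_function_L:
  assumes e: "0 < e"
  shows "\<exists>g l u. smooth_real g \<and> - L < l \<and> u < L \<and> (\<forall>y. y \<notin> {l..u} \<longrightarrow> g y = 0) \<and>
    0 < (LINT y:{- L<..<L}|lborel. \<bar>g y\<bar> powr p) \<and>
    (LINT y:{- L<..<L}|lborel. \<bar>deriv g y\<bar> powr p) \<le> (p - 1 + e) * (LINT y:{- L<..<L}|lborel. \<bar>g y\<bar> powr p)"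
proof -
  obtain h B where h: "\<And>n. smooth_real (h n)"
    and supp: "\<And>n. \<exists>l u. - L < l \<and> l < u \<and> u < L \<and> (\<forall>y. y \<notin> {l..u} \<longrightarrow> h n y = 0)"
    and int0: "\<And>n. (LINT y:{- L<..<L}|lborel. h n y) = 0" and B: "\<And>n y. \<bar>h n y\<bar> \<le> B"
    and lim: "\<And>y. y \<in> {- L<..<L} \<Longrightarrow> (\<lambda>n. h n y) \<longlonglongrightarrow> S' y"
    using ex_smooth_derivative by blast
  have hc: "isCont (h n) y" for n y
    by (rule DERIV_isCont[OF smooth_real_deriv(1)[OF h]])
  have "\<exists>G. G (- L) = 0 \<and> (\<forall>y. (G has_real_derivative h n y) (at y))" for n
  proof -
    obtain F where F: "\<And>y. (F has_vector_derivative h n y) (at y)"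
      using einterval_antiderivative[of "-\<infinity>" "\<infinity>" "h n"] hc by auto
    have "((\<lambda>y. F y - F (- L)) has_real_derivative h n y) (at y)" for y
      using F[of y] by (auto simp: has_real_derivative_iff_has_vector_derivative intro!: derivative_eq_intros)
    then show ?thesis by (intro exI[of _ "\<lambda>y. F y - F (- L)"]) auto
  qed
  then obtain G where G0: "\<And>n. G n (- L) = 0" and G: "\<And>n y. (G n has_real_derivative h n y) (at y)"
    by metis
  have Gs: "smooth_real (G n)" for n using smooth_real_iff[OF G] h by blast
  have Gd: "deriv (G n) = h n" for n by (rule ext, rule DERIV_imp_deriv, rule G)
  have Gc: "continuous_on A (G n)" for A n by (rule smooth_real_continuous[OF Gs])
  have Gint: "(LINT y:{- L<..<x}|lborel. h n y) = G n x" if "- L < x" for n x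
  proof -
    have "(LINT y:{- L<..<x}|lborel. h n y) = G n x - G n (- L)"
      by (rule FTC_open_interval[OF that G hc B])
         (use DERIV_isCont[OF G] in \<open>auto simp: isCont_def filterlim_at_split\<close>)
    then show ?thesis by (simp add: G0)
  qed
  have GL: "G n L = 0" for n using Gint[of L n] int0[of n] L_pos by simp
  \<comment> \<open>Off the support of \<open>h n\<close> the primitive is constant: on the left
    with its value at \<open>- L\<close>, on the right with its value at \<open>L\<close>, which is
    0 because \<open>h n\<close> has integral 0.\<close>
  have Gsupp: "\<exists>l u. - L < l \<and> u < L \<and> (\<forall>y. y \<notin> {l..u} \<longrightarrow> G n y = 0)" for n
  proof -
    obtain l u where lu: "- L < l" "l < u" "u < L" "\<And>y. y \<notin> {l..u} \<Longrightarrow> h n y = 0" using supp by metis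
    have const: "G n x = G n y" if "x < y" "\<And>z. x < z \<Longrightarrow> z < y \<Longrightarrow> h n z = 0" for x y
    proof -
      have "(G n has_real_derivative 0) (at z)" if "x < z" "z < y" for z
        using G[of n z] \<open>\<And>z. x < z \<Longrightarrow> z < y \<Longrightarrow> h n z = 0\<close>[OF that] by simp
      from DERIV_isconst_end[OF \<open>x < y\<close> Gc this] show ?thesis by simp
    qed
    have "G n y = 0" if "y \<notin> {l..u}" for y
    proof -
      have "y < l \<or> u < y" using that by auto
      then consider "y < - L" | "y = - L" | "- L < y" "y < l" | "u < y" "y < L" | "y = L" | "L < y"
        by linarith
      then show ?thesis
      proof cases
        case 1
        have "G n y = G n (- L)" by (rule const[OF 1]) (use lu in auto)
        then show ?thesis by (simp add: G0)
      next
        case 3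
        have "G n (- L) = G n y" by (rule const[OF 3(1)]) (use lu 3 in auto)
        then show ?thesis by (simp add: G0)
      next
        case 4
        have "G n y = G n L" by (rule const[OF 4(2)]) (use lu 4 in auto)
        then show ?thesis by (simp add: GL)
      next
        case 6
        have "G n L = G n y" by (rule const[OF 6]) (use lu in auto)
        then show ?thesis by (simp add: GL)
      qed (auto simp: G0 GL)
    qed
    then show ?thesis using lu by blast
  qed
  have B0: "0 \<le> B" using B[of 0 0] by linarith
  have Gb: "\<bar>G n y\<bar> \<le> B * (2 * L)" if "y \<in> {- L<..<L}" for n y
  proof -
    have "\<bar>G n y\<bar> \<le> B * (y - (- L))"
      unfolding Gint[symmetric, of y n, OF that[simplified, THEN conjunct1]]
      by (rule abs_set_integral_le) (use that B smooth_real_continuous[OF h] in auto)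
    also have "\<dots> \<le> B * (2 * L)" using that B0 by (intro mult_left_mono) auto
    finally show ?thesis .
  qed
  have Glim: "(\<lambda>n. G n y) \<longlonglongrightarrow> S y" if y: "y \<in> {- L<..<L}" for y
  proof -
    have "(\<lambda>n. LINT z:{- L<..<y}|lborel. h n z) \<longlonglongrightarrow> (LINT z:{- L<..<y}|lborel. S' z)"
      by (rule bounded_convergence[where B = B])
         (use y B lim smooth_real_continuous[OF h] in \<open>auto intro!: continuous_at_imp_continuous_on isCont_S'\<close>)
    then show ?thesis using y by (simp add: Gint S_integral)
  qed
  let ?I = "\<lambda>f. LINT y:{- L<..<L}|lborel. \<bar>f y\<bar> powr p"
  have conv: "(\<lambda>n. ?I (f n)) \<longlonglongrightarrow> ?I g"
    if fc: "\<And>n y. isCont (f n) y" and gc: "\<And>y. y \<in> {- L<..<L} \<Longrightarrow> isCont g y"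
      and fb: "\<And>n y. y \<in> {- L<..<L} \<Longrightarrow> \<bar>f n y\<bar> \<le> C" and fl: "\<And>y. y \<in> {- L<..<L} \<Longrightarrow> (\<lambda>n. f n y) \<longlonglongrightarrow> g y"
    for f :: "nat \<Rightarrow> real \<Rightarrow> real" and g C
  proof (rule bounded_convergence[where B = "C powr p"])
    show "continuous_on {- L<..<L} (\<lambda>y. \<bar>f n y\<bar> powr p)" for n
      by (intro continuous_at_imp_continuous_on ballI isCont_abs_powr fc)
    show "continuous_on {- L<..<L} (\<lambda>y. \<bar>g y\<bar> powr p)"
      by (intro continuous_at_imp_continuous_on ballI isCont_abs_powr gc)
    show "\<bar>\<bar>f n y\<bar> powr p\<bar> \<le> C powr p" if "y \<in> {- L<..<L}" for n y
      using fb[OF that] p_gt_1 by (simp add: powr_mono2)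
    show "(\<lambda>n. \<bar>f n y\<bar> powr p) \<longlonglongrightarrow> \<bar>g y\<bar> powr p" if "y \<in> {- L<..<L}" for y
      using fl[OF that] p_gt_1 by (intro tendsto_powr' tendsto_rabs tendsto_const) auto
  qed
  have 1: "(\<lambda>n. ?I (h n)) \<longlonglongrightarrow> ?I S'"
    by (rule conv[OF hc _ B lim]) (auto intro: isCont_S')
  have 2: "(\<lambda>n. ?I (G n)) \<longlonglongrightarrow> ?I S"
    by (rule conv[OF DERIV_isCont[OF G] _ Gb Glim]) (auto intro: isCont_S)
  \<comment> \<open>In the limit this difference equals \<open>- e * ?I S\<close>, a strict gap that
    absorbs the error for large \<open>n\<close>.\<close>
  have "(\<lambda>n. ?I (h n) - (p - 1 + e) * ?I (G n)) \<longlonglongrightarrow> ?I S' - (p - 1 + e) * ?I S"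
    by (intro tendsto_diff tendsto_mult tendsto_const 1 2)
  moreover have "?I S' - (p - 1 + e) * ?I S < 0"
    using S_energy e by (simp add: distrib_right)
  ultimately have "\<forall>\<^sub>F n in sequentially. ?I (h n) - (p - 1 + e) * ?I (G n) < 0"
    by (rule order_tendstoD(2))
  moreover have "\<forall>\<^sub>F n in sequentially. 0 < ?I (G n)"
    by (rule order_tendstoD(1)[OF 2 S_energy(2)])
  ultimately have "\<forall>\<^sub>F n in sequentially. ?I (h n) \<le> (p - 1 + e) * ?I (G n) \<and> 0 < ?I (G n)"
    by eventually_elim auto
  then obtain n where "?I (h n) \<le> (p - 1 + e) * ?I (G n)" "0 < ?I (G n)"
    by (auto simp: eventually_sequentially)
  moreover obtain l u where "- L < l" "u < L" "\<And>y. y \<notin> {l..u} \<Longrightarrow> G n y = 0" using Gsupp by blast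
  ultimately show ?thesis using Gs[of n] by (intro exI[of _ "G n"] exI[of _ l] exI[of _ u]) (auto simp: Gd)
qed

lemma deriv_eq_0_outside:
  assumes "smooth_real g" "\<And>y. y \<notin> {l..u} \<Longrightarrow> g y = 0" "y \<notin> {l..u}"
  shows "deriv g y = 0"
proof -
  have "(g has_real_derivative 0) (at y)"
    by (rule has_field_derivative_transform_within_open[of "\<lambda>_. 0" _ _ "- {l..u}"]) (use assms in auto)
  then show ?thesis by (rule DERIV_imp_deriv)
qed

text \<open>Rescaling from \<open>(- L, L)\<close>: the substitution divides both integrals by
  \<open>\<kappa>\<close> and gives the derivative an extra factor \<open>\<kappa> powr p\<close>,
  so the error is taken as \<open>e / \<kappa> powr p\<close> beforehand.\<close>

lemma ex_test_function:
  assumes ab: "\<alpha> < \<beta>" and e: "0 < e"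
  shows "\<exists>g l u. smooth_real g \<and> \<alpha> < l \<and> u < \<beta> \<and> (\<forall>y. y \<notin> {l..u} \<longrightarrow> g y = 0) \<and>
    0 < (\<integral>y. \<bar>g y\<bar> powr p \<partial>lborel) \<and>
    (\<integral>y. \<bar>deriv g y\<bar> powr p \<partial>lborel)
      \<le> (pi_p p powr p * (p - 1) * (\<beta> - \<alpha>) powr (- p) + e) * (\<integral>y. \<bar>g y\<bar> powr p \<partial>lborel)"
proof -
  define \<kappa> where "\<kappa> = pi_p p / (\<beta> - \<alpha>)"
  have k: "0 < \<kappa>" using ab L_pos by (simp add: \<kappa>_def L_eq)
  have kp: "\<kappa> powr p = pi_p p powr p * (\<beta> - \<alpha>) powr (- p)"
    using ab L_pos by (simp add: \<kappa>_def powr_divide powr_minus_divide L_eq)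
  \<comment> \<open>The shift that sends the midpoint of \<open>(\<alpha>, \<beta>)\<close> to
    0.\<close>
  define b where "b = - \<kappa> * ((\<alpha> + \<beta>) / 2)"
  have "0 < e / \<kappa> powr p" using e k by simp
  from ex_test_function_L[OF this] obtain g l u where g: "smooth_real g" and lu: "- L < l" "u < L"
    and supp: "\<And>y. y \<notin> {l..u} \<Longrightarrow> g y = 0"
    and pos: "0 < (LINT y:{- L<..<L}|lborel. \<bar>g y\<bar> powr p)"
    and le: "(LINT y:{- L<..<L}|lborel. \<bar>deriv g y\<bar> powr p)
      \<le> (p - 1 + e / \<kappa> powr p) * (LINT y:{- L<..<L}|lborel. \<bar>g y\<bar> powr p)" by metis
  have full: "(LINT y:{- L<..<L}|lborel. \<bar>f y\<bar> powr p) = (\<integral>y. \<bar>f y\<bar> powr p \<partial>lborel)"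
    if f: "\<And>y. y \<notin> {l..u} \<Longrightarrow> f y = 0" for f :: "real \<Rightarrow> real"
  proof -
    have "f y = 0" if y: "y \<notin> {- L<..<L}" for y by (rule f) (use y lu in auto)
    then show ?thesis
      unfolding set_lebesgue_integral_def
      by (intro Bochner_Integration.integral_cong refl) (auto simp: indicator_def)
  qed
  note dsupp = deriv_eq_0_outside[OF g supp]
  have fg: "(LINT y:{- L<..<L}|lborel. \<bar>g y\<bar> powr p) = (\<integral>y. \<bar>g y\<bar> powr p \<partial>lborel)"
    by (rule full[OF supp])
  have fdg: "(LINT y:{- L<..<L}|lborel. \<bar>deriv g y\<bar> powr p) = (\<integral>y. \<bar>deriv g y\<bar> powr p \<partial>lborel)"
    by (rule full[OF dsupp])
  define f where "f y = g (\<kappa> * y + b)" for y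
  have f: "smooth_real f" unfolding f_def[abs_def] by (rule smooth_real_affine[OF g])
  have fd: "deriv f y = \<kappa> * deriv g (\<kappa> * y + b)" for y
  proof (rule DERIV_imp_deriv)
    have "((\<lambda>y. \<kappa> * y + b) has_real_derivative \<kappa>) (at y)" by (auto intro!: derivative_eq_intros)
    from DERIV_chain2[OF smooth_real_deriv(1)[OF g] this]
    show "(f has_real_derivative \<kappa> * deriv g (\<kappa> * y + b)) (at y)" unfolding f_def by (simp add: mult.commute)
  qed
  have sub: "(\<integral>y. \<bar>w (\<kappa> * y + b)\<bar> powr p \<partial>lborel) = (\<integral>y. \<bar>w y\<bar> powr p \<partial>lborel) / \<kappa>" for w :: "real \<Rightarrow> real"
    using lborel_integral_real_affine[of \<kappa> "\<lambda>y. \<bar>w y\<bar> powr p" b] k by (simp add: add.commute)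
  have I: "(\<integral>y. \<bar>f y\<bar> powr p \<partial>lborel) = (\<integral>y. \<bar>g y\<bar> powr p \<partial>lborel) / \<kappa>"
    unfolding f_def by (rule sub)
  have "(\<integral>y. \<bar>deriv f y\<bar> powr p \<partial>lborel) = \<kappa> powr p * ((\<integral>y. \<bar>deriv g y\<bar> powr p \<partial>lborel) / \<kappa>)"
    unfolding fd sub[symmetric] using k by (simp add: abs_mult powr_mult)
  also have "\<dots> \<le> \<kappa> powr p * (((p - 1 + e / \<kappa> powr p) * (\<integral>y. \<bar>g y\<bar> powr p \<partial>lborel)) / \<kappa>)"
  proof -
    have "(\<integral>y. \<bar>deriv g y\<bar> powr p \<partial>lborel) \<le> (p - 1 + e / \<kappa> powr p) * (\<integral>y. \<bar>g y\<bar> powr p \<partial>lborel)"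
      using le unfolding fg fdg .
    with k show ?thesis by (intro mult_left_mono divide_right_mono) auto
  qed
  also have "\<dots> = (\<kappa> powr p * (p - 1) + e) * (\<integral>y. \<bar>f y\<bar> powr p \<partial>lborel)"
    using k unfolding I by (simp add: field_simps)
  finally have "(\<integral>y. \<bar>deriv f y\<bar> powr p \<partial>lborel)
      \<le> (pi_p p powr p * (p - 1) * (\<beta> - \<alpha>) powr (- p) + e) * (\<integral>y. \<bar>f y\<bar> powr p \<partial>lborel)"
    by (simp add: kp mult_ac)
  moreover have "0 < (\<integral>y. \<bar>f y\<bar> powr p \<partial>lborel)"
    using pos k unfolding I fg by simp
  moreover have "\<forall>y. y \<notin> {(l - b) / \<kappa>..(u - b) / \<kappa>} \<longrightarrow> f y = 0"
    using supp k by (auto simp: f_def field_simps)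
  moreover have "\<alpha> < (l - b) / \<kappa>" "(u - b) / \<kappa> < \<beta>"
  proof -
    have "\<kappa> * (\<beta> - \<alpha>) = 2 * L" using ab by (simp add: \<kappa>_def L_eq)
    then show "\<alpha> < (l - b) / \<kappa>" "(u - b) / \<kappa> < \<beta>"
      using lu k by (auto simp: b_def field_simps)
  qed
  ultimately show ?thesis using f by blast
qed

end

subsection \<open>Lower bounds from disjointly supported functions\<close>

text \<open>Serves both the embedding \<open>I\<close> itself and the inclusion of the span of bumps
  into \<open>W0_space\<close>, which is why the constant \<open>C\<close> and the two spaces are
  arbitrary.\<close>

lemma emb_fspace:
  assumes X: "function_space D V N" and Y: "function_space D V' N'"
    and sub: "V \<subseteq> V'" and le: "\<forall>f\<in>V. N' f \<le> C * N f"
  defines "I \<equiv> emb (fspace D V N) (fspace D V' N')"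
  shows "I \<in> bop (fspace D V N) (fspace D V' N')"
    and "f \<in> V \<Longrightarrow> I (cls D f) = cls D f"
    and "x \<in> vcarrier (fspace D V N) \<Longrightarrow> vnorm (fspace D V' N') (I x) \<le> C * vnorm (fspace D V N) x"
proof -
  show If: "I (cls D f) = cls D f" if "f \<in> V" for f using that by (simp add: I_def emb_def)
  have In: "vnorm (fspace D V' N') (I (cls D f)) \<le> C * vnorm (fspace D V N) (cls D f)" if "f \<in> V" for f
    using that sub le by (simp add: If function_space.norm_rep[OF X] function_space.norm_rep[OF Y] subset_eq)
  then show "vnorm (fspace D V' N') (I x) \<le> C * vnorm (fspace D V N) x" if "x \<in> vcarrier (fspace D V N)" for x
    using that by auto
  have "\<forall>x\<in>cls D ` V. vnorm (fspace D V' N') (I x) \<le> C * vnorm (fspace D V N) x" using In by blast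
  moreover have "I (cls D (\<lambda>x. f x + g x)) = cls D (\<lambda>x. f x + g x)" if "f \<in> V" "g \<in> V" for f g
    by (rule If[OF function_space.add_mem[OF X that]])
  moreover have "I (cls D (\<lambda>x. c * f x)) = cls D (\<lambda>x. c * f x)" if "f \<in> V" for f c
    by (rule If[OF function_space.scale_mem[OF X that]])
  moreover have "I x = cls D (\<lambda>_. 0)" if "x \<notin> cls D ` V" for x using that by (simp add: I_def emb_def)
  ultimately show "I \<in> bop (fspace D V N) (fspace D V' N')"
    unfolding bop_def using sub by (auto simp: If simp del: fspace_simps(3))
qed

lemma opnorm_nonneg:
  assumes X: "function_space D V N" and Y: "function_space D V' N'"
    and T: "T \<in> bop (fspace D V N) (fspace D V' N')"
  shows "0 \<le> opnorm (fspace D V N) (fspace D V' N') T"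
proof -
  obtain C where C: "\<And>x. x \<in> vcarrier (fspace D V N) \<Longrightarrow> vnorm (fspace D V' N') (T x) \<le> C * vnorm (fspace D V N) x"
    using T unfolding bop_def by blast
  have nnX: "0 \<le> vnorm (fspace D V N) x" if "x \<in> vcarrier (fspace D V N)" for x
    using that function_space.norm_nonneg[OF X function_space.rep_mem[OF X]] by auto
  have z: "cls D (\<lambda>_. 0) \<in> vcarrier (fspace D V N)" using function_space.zero_mem[OF X] by simp
  have "vnorm (fspace D V N) (cls D (\<lambda>_. 0)) = 0"
    using function_space.norm_zero_iff[OF X function_space.zero_mem[OF X]]
    by (simp add: function_space.norm_rep[OF X] function_space.zero_mem[OF X])
  then have le: "vnorm (fspace D V' N') (T (cls D (\<lambda>_. 0))) \<le> opnorm (fspace D V N) (fspace D V' N') T"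
    by (intro le_opnorm[OF C nnX z]) simp_all
  have "T (cls D (\<lambda>_. 0)) \<in> vcarrier (fspace D V' N')" using T z unfolding bop_def by blast
  then have "0 \<le> vnorm (fspace D V' N') (T (cls D (\<lambda>_. 0)))"
    using function_space.norm_nonneg[OF Y function_space.rep_mem[OF Y]] by auto
  with le show ?thesis by simp
qed

lemma opnorm_fspace_le:
  assumes X: "function_space D V N" and C: "0 \<le> C"
    and T: "\<And>x. x \<in> vcarrier (fspace D V N) \<Longrightarrow> vnorm Y (T x) \<le> C * vnorm (fspace D V N) x"
  shows "opnorm (fspace D V N) Y T \<le> C"
proof (rule opnorm_le[OF C T])
  show "cls D (\<lambda>_. 0) \<in> vcarrier (fspace D V N)" using function_space.zero_mem[OF X] by simp
  have "vnorm (fspace D V N) (cls D (\<lambda>_. 0)) = 0"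
    using function_space.norm_zero_iff[OF X function_space.zero_mem[OF X]]
    by (simp add: function_space.norm_rep[OF X] function_space.zero_mem[OF X])
  then show "vnorm (fspace D V N) (cls D (\<lambda>_. 0)) \<le> 1" by simp
qed

lemma strict_snum_op:
  assumes s: "strict_snum s" and b: "banach X" "banach Y" and T: "T \<in> bop X Y"
  shows "s 1 X Y T = opnorm X Y T"
    and "1 \<le> m \<Longrightarrow> s (Suc m) X Y T \<le> s m X Y T"
    and "1 \<le> m \<Longrightarrow> 0 \<le> s m X Y T"
    and "1 \<le> m \<Longrightarrow> banach W \<Longrightarrow> banach Z \<Longrightarrow> A \<in> bop W X \<Longrightarrow> B \<in> bop Y Z \<Longrightarrow>
      s m W Z (B \<circ> T \<circ> A) \<le> opnorm Y Z B * s m X Y T * opnorm W X A"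
proof -
  note P = s[unfolded strict_snum_def, THEN conjunct1, THEN spec, THEN spec, THEN spec, THEN mp,
      OF conjI[OF b(1) conjI[OF b(2) T]]]
  show "s 1 X Y T = opnorm X Y T" by (rule P[THEN conjunct1])
  note P2 = P[THEN conjunct2, THEN conjunct1, THEN spec, THEN mp]
  show "s (Suc m) X Y T \<le> s m X Y T" if "1 \<le> m" by (rule P2[OF that, THEN conjunct1])
  show "0 \<le> s m X Y T" if "1 \<le> m" by (rule P2[OF that, THEN conjunct2])
  note P4 = P[THEN conjunct2, THEN conjunct2, THEN conjunct2, THEN conjunct1, THEN spec, THEN mp]
  show "s m W Z (B \<circ> T \<circ> A) \<le> opnorm Y Z B * s m X Y T * opnorm W X A"
    if "1 \<le> m" "banach W" "banach Z" "A \<in> bop W X" "B \<in> bop Y Z"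
    using P4[OF that(1), THEN spec, THEN spec, THEN spec, THEN spec, THEN mp,
        OF conjI[OF that(2) conjI[OF that(3) conjI[OF that(4) that(5)]]]] .
qed

lemma strict_snum_id:
  assumes "strict_snum s" "banach E" "1 \<le> m" "dim_ge E m"
  shows "s m E E (idop E) = 1"
  using assms(1)[unfolded strict_snum_def, THEN conjunct2, THEN spec, THEN spec, THEN mp,
      OF conjI[OF assms(2) conjI[OF assms(3,4)]]] .

section \<open>Disjoint bumps and the projection onto their span\<close>

lemma sum_disjoint_powr:
  fixes h :: "nat \<Rightarrow> 'a \<Rightarrow> real"
  assumes dis: "disjoint_family A" and h: "\<And>j. x \<notin> A j \<Longrightarrow> h j x = 0"
  shows "\<bar>\<Sum>j<m. c j * h j x\<bar> powr p = (\<Sum>j<m. \<bar>c j\<bar> powr p * \<bar>h j x\<bar> powr p)"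
proof (cases "\<exists>k<m. x \<in> A k")
  case True
  then obtain k where k: "k < m" "x \<in> A k" by blast
  have z: "h j x = 0" if "j \<noteq> k" for j
    using that dis k h[of j] unfolding disjoint_family_on_def by blast
  have "(\<Sum>j<m. c j * h j x) = (\<Sum>j\<in>{k}. c j * h j x)"
    by (rule sum.mono_neutral_right) (use k z in auto)
  moreover have "(\<Sum>j<m. \<bar>c j\<bar> powr p * \<bar>h j x\<bar> powr p) = (\<Sum>j\<in>{k}. \<bar>c j\<bar> powr p * \<bar>h j x\<bar> powr p)"
    by (rule sum.mono_neutral_right) (use k z in auto)
  ultimately show ?thesis by (simp add: abs_mult powr_mult)
next
  case False
  then have "\<And>j. j < m \<Longrightarrow> h j x = 0" using h by blast
  then show ?thesis by simp
qed

text \<open>Almost extremal functions normalised in \<open>L^p\<close>. Later \<open>\<rho>\<close>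
  is \<open>1 + \<Lambda> + e\<close> with arbitrarily small \<open>e\<close>, and
  \<open>(1 + \<Lambda>) powr (- 1 / p)\<close> is the norm to be found. The partial derivatives are
  localised as well, so that energies of combinations split.\<close>

locale bump_family = Lp_domain D p for D :: "(real^'n::finite) set" and p +
  fixes f :: "nat \<Rightarrow> real^'n \<Rightarrow> real" and A :: "nat \<Rightarrow> (real^'n) set" and \<rho> :: real
  assumes f_Ccinf: "\<And>j. Ccinf D (f j)"
    and f_norm: "\<And>j. Lint D (\<lambda>x. \<bar>f j x\<bar> powr p) = 1"
    and f_energy: "\<And>j. Lint D (\<lambda>x. \<bar>f j x\<bar> powr p) + (\<Sum>i\<in>UNIV. Lint D (\<lambda>x. \<bar>pd i (f j) x\<bar> powr p)) \<le> \<rho>"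
    and disj: "disjoint_family A" and A_sets: "\<And>j. A j \<in> sets borel"
    and f_supp: "\<And>j x. x \<notin> A j \<Longrightarrow> f j x = 0" "\<And>j x i. x \<notin> A j \<Longrightarrow> pd i (f j) x = 0"
begin

lemma rho_ge_1: "1 \<le> \<rho>"
proof -
  have "0 \<le> (\<Sum>i\<in>UNIV. Lint D (\<lambda>x. \<bar>pd i (f 0) x\<bar> powr p))" by (intro sum_nonneg) (simp add: Lint_M)
  then show ?thesis using f_energy[of 0] f_norm[of 0] by linarith
qed

definition comb :: "nat \<Rightarrow> (nat \<Rightarrow> real) \<Rightarrow> real^'n \<Rightarrow> real" where
  "comb m c x = (\<Sum>j<m. c j * f j x)"

lemma Lint_disjoint_sum:
  assumes h: "\<And>j. memLp D p (h j)" "\<And>j x. x \<notin> A j \<Longrightarrow> h j x = 0"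
  shows "Lint D (\<lambda>x. \<bar>\<Sum>j<m. c j * h j x\<bar> powr p) = (\<Sum>j<m. \<bar>c j\<bar> powr p * Lint D (\<lambda>x. \<bar>h j x\<bar> powr p))"
proof -
  have "integrable M (\<lambda>x. \<bar>h j x\<bar> powr p)" for j using h(1) by (simp add: memLp_M)
  moreover have "\<bar>\<Sum>j<m. c j * h j x\<bar> powr p = (\<Sum>j<m. \<bar>c j\<bar> powr p * \<bar>h j x\<bar> powr p)" for x
    by (rule sum_disjoint_powr[OF disj h(2)])
  ultimately show ?thesis by (simp add: Lint_M Bochner_Integration.integral_sum)
qed

lemma comb_energy: "Lpnorm D p (comb m c) powr p = (\<Sum>j<m. \<bar>c j\<bar> powr p)"
  unfolding Lpnorm_powr comb_def
  by (subst Lint_disjoint_sum) (simp_all add: Ccinf_memLp f_Ccinf f_supp f_norm)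

lemma comb_W0_grad: "W0_grad (comb m c) (\<lambda>i x. \<Sum>j<m. c j * pd i (f j) x)"
proof (induction m)
  case 0
  have "W0_grad (\<lambda>_. 0) (\<lambda>i. pd i (\<lambda>_. 0))" by (rule W0_grad_Ccinf[OF Ccinf_zero])
  moreover have "pd i (\<lambda>_. 0) = (\<lambda>_. 0)" for i :: 'n by (auto intro!: ext pd_eqI)
  ultimately show ?case by (simp add: comb_def[abs_def])
next
  case (Suc m)
  from W0_grad_combine[OF this W0_grad_Ccinf[OF f_Ccinf[of m]], of 1 "c m"]
  show ?case by (simp add: comb_def[abs_def])
qed

lemma comb_memLp: "memLp D p (comb m c)"
  by (rule has_weak_grad_memLp(1)[OF W0_gradD(1)[OF comb_W0_grad]])

text \<open>Disjointness turns both norms into \<open>l^p\<close> sums over the coefficients, so the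
  energy bound of single bumps carries over to their combinations with the same constant.\<close>

lemma comb_W0_norm: "W0_norm (comb m c) \<le> \<rho> powr (1 / p) * Lpnorm D p (comb m c)"
proof -
  let ?G = "\<lambda>i x. \<Sum>j<m. c j * pd i (f j) x"
  have "W0_norm (comb m c) = W1p_norm D p (comb m c) ?G"
    by (rule W0_norm_eq[OF W0_gradD(1)[OF comb_W0_grad]])
  also have "\<dots> powr p = (\<Sum>j<m. \<bar>c j\<bar> powr p * Lint D (\<lambda>x. \<bar>f j x\<bar> powr p))
      + (\<Sum>i\<in>UNIV. \<Sum>j<m. \<bar>c j\<bar> powr p * Lint D (\<lambda>x. \<bar>pd i (f j) x\<bar> powr p))"
    unfolding W1p_norm_powr comb_def
    by (subst (1 2) Lint_disjoint_sum) (simp_all add: Ccinf_memLp f_Ccinf f_supp)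
  also have "\<dots> = (\<Sum>j<m. \<bar>c j\<bar> powr p * (Lint D (\<lambda>x. \<bar>f j x\<bar> powr p) + (\<Sum>i\<in>UNIV. Lint D (\<lambda>x. \<bar>pd i (f j) x\<bar> powr p))))"
    by (subst sum.swap) (simp add: distrib_left sum.distrib sum_distrib_left)
  also have "\<dots> \<le> (\<Sum>j<m. \<bar>c j\<bar> powr p * \<rho>)"
    by (intro sum_mono mult_left_mono f_energy) auto
  also have "\<dots> = \<rho> * Lpnorm D p (comb m c) powr p"
    by (simp add: comb_energy sum_distrib_left mult.commute)
  finally have "(W0_norm (comb m c) powr p) powr (1 / p) \<le> (\<rho> * Lpnorm D p (comb m c) powr p) powr (1 / p)"
    using p_gt_1 by (intro powr_mono2) auto
  then show ?thesis
    using rho_ge_1 p_gt_1 Lpnorm_nonneg[of "comb m c"]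
    by (simp add: powr_norm powr_mult W0_norm_def W1p_norm_nonneg)
qed

text \<open>The norming functional of \<open>f j\<close>: it has norm 1 in \<open>L^q\<close>, pairs
  with \<open>f j\<close> to 1, and lives on the same set \<open>A j\<close>.\<close>

definition dual :: "nat \<Rightarrow> real^'n \<Rightarrow> real" where
  "dual j x = \<bar>f j x\<bar> powr (p - 1) * sgn (f j x)"

lemma dual_facts:
  shows dual_measurable: "dual j \<in> borel_measurable M"
    and dual_powr: "\<bar>dual j x\<bar> powr q = \<bar>f j x\<bar> powr p"
    and f_dual: "f j x * dual j x = \<bar>f j x\<bar> powr p"
    and dual_supp: "x \<notin> A j \<Longrightarrow> dual j x = 0"
proof -
  have [measurable]: "f j \<in> borel_measurable M" using Ccinf_memLp(1)[OF f_Ccinf] by (simp add: memLp_M)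
  show "dual j \<in> borel_measurable M" unfolding dual_def[abs_def] by measurable
  have "(p - 1) * q = p" using p_gt_1 by (simp add: q_def)
  then show "\<bar>dual j x\<bar> powr q = \<bar>f j x\<bar> powr p"
    by (cases "f j x = 0") (simp_all add: dual_def abs_mult abs_sgn_eq powr_powr)
  show "f j x * dual j x = \<bar>f j x\<bar> powr p"
  proof (cases "f j x = 0")
    case False
    have "f j x * dual j x = \<bar>f j x\<bar> * \<bar>f j x\<bar> powr (p - 1)" by (simp add: dual_def abs_sgn mult_ac)
    also have "\<dots> = \<bar>f j x\<bar> powr p" using False by (simp add: powr_diff)
    finally show ?thesis .
  qed (simp add: dual_def)
  show "x \<notin> A j \<Longrightarrow> dual j x = 0" using f_supp by (simp add: dual_def)
qed

definition coef :: "nat \<Rightarrow> (real^'n \<Rightarrow> real) \<Rightarrow> real" where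
  "coef j u = Lint D (\<lambda>x. u x * dual j x)"

lemma A_memLp:
  assumes u: "memLp D p u"
  shows "memLp D p (\<lambda>x. indicator (A j) x * u x)"
    and "integrable M (\<lambda>x. indicator (A j) x * \<bar>u x\<bar> powr p)"
    and "\<bar>indicator (A j) x * u x\<bar> powr p = indicator (A j) x * \<bar>u x\<bar> powr p"
proof -
  have [measurable]: "(indicator (A j) :: real^'n \<Rightarrow> real) \<in> borel_measurable M"
    using A_sets by (intro borel_measurable_M) simp
  have [measurable]: "u \<in> borel_measurable M" using u by (simp add: memLp_M)
  show eq: "\<bar>indicator (A j) x * u x\<bar> powr p = indicator (A j) x * \<bar>u x\<bar> powr p" for x
    by (simp add: indicator_def)
  show i: "integrable M (\<lambda>x. indicator (A j) x * \<bar>u x\<bar> powr p)"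
  proof (rule Bochner_Integration.integrable_bound)
    show "integrable M (\<lambda>x. \<bar>u x\<bar> powr p)" using u by (simp add: memLp_M)
    show "AE x in M. norm (indicator (A j) x * \<bar>u x\<bar> powr p) \<le> norm (\<bar>u x\<bar> powr p)"
      by (intro AE_I2) (simp add: indicator_def)
  qed measurable
  show "memLp D p (\<lambda>x. indicator (A j) x * u x)"
    unfolding memLp_M eq using i by simp
qed

text \<open>Hoelder's inequality is applied to the part of \<open>u\<close> on \<open>A j\<close>,
  where the functional lives. The localised bound is what later keeps the sum over \<open>j\<close>
  below the full norm of \<open>u\<close>.\<close>

lemma dual_integrable:
  assumes u: "memLp D p u"
  shows "integrable M (\<lambda>x. u x * dual j x)"
    and "\<bar>coef j u\<bar> powr p \<le> (\<integral>x. indicator (A j) x * \<bar>u x\<bar> powr p \<partial>M)"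
proof -
  have d: "integrable M (\<lambda>x. \<bar>dual j x\<bar> powr q)"
    unfolding dual_powr using Ccinf_memLp(1)[OF f_Ccinf] by (simp add: memLp_M)
  note H = Holder_inequality[OF p_gt_1 q_conj _ dual_measurable _ d]
  show "integrable M (\<lambda>x. u x * dual j x)"
    by (rule H(1)) (use u in \<open>simp_all add: memLp_M\<close>)
  have "coef j u = (\<integral>x. (indicator (A j) x * u x) * dual j x \<partial>M)"
    unfolding coef_def Lint_M
    by (intro Bochner_Integration.integral_cong refl) (auto simp: indicator_def dual_supp)
  also have "\<bar>\<dots>\<bar> \<le> (\<integral>x. \<bar>indicator (A j) x * u x\<bar> powr p \<partial>M) powr (1 / p) * (\<integral>x. \<bar>dual j x\<bar> powr q \<partial>M) powr (1 / q)"
    by (rule H(2)) (use A_memLp(1)[OF u, of j] in \<open>simp_all add: memLp_M\<close>)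
  also have "(\<integral>x. \<bar>dual j x\<bar> powr q \<partial>M) = 1"
    unfolding dual_powr using f_norm[of j] by (simp add: Lint_M)
  finally have "\<bar>coef j u\<bar> \<le> (\<integral>x. indicator (A j) x * \<bar>u x\<bar> powr p \<partial>M) powr (1 / p)"
    by (simp add: A_memLp(3)[OF u])
  then have "\<bar>coef j u\<bar> powr p \<le> ((\<integral>x. indicator (A j) x * \<bar>u x\<bar> powr p \<partial>M) powr (1 / p)) powr p"
    using p_gt_1 by (intro powr_mono2) auto
  then show "\<bar>coef j u\<bar> powr p \<le> (\<integral>x. indicator (A j) x * \<bar>u x\<bar> powr p \<partial>M)"
    by (subst (asm) powr_norm(1)) (auto intro!: integral_nonneg_AE)
qed

lemma coef_combine:
  assumes "memLp D p u" "memLp D p v"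
  shows "coef j (\<lambda>x. \<alpha> * u x + \<beta> * v x) = \<alpha> * coef j u + \<beta> * coef j v"
proof -
  have "coef j (\<lambda>x. \<alpha> * u x + \<beta> * v x) = Lint D (\<lambda>x. \<alpha> * (u x * dual j x) + \<beta> * (v x * dual j x))"
    unfolding coef_def by (simp add: algebra_simps)
  also have "\<dots> = \<alpha> * coef j u + \<beta> * coef j v"
    unfolding coef_def by (intro Lint_combine dual_integrable assms)
  finally show ?thesis .
qed

lemma coef_AE:
  assumes u: "memLp D p u" and uv: "AE x in M. u x = v x"
  shows "coef j u = coef j v"
  unfolding coef_def Lint_M
proof (rule integral_cong_AE)
  note [measurable] = dual_measurable
  have [measurable]: "u \<in> borel_measurable M" "v \<in> borel_measurable M"
    using u AE_memLp[OF u uv] by (auto simp: memLp_M)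
  show "(\<lambda>x. u x * dual j x) \<in> borel_measurable M" "(\<lambda>x. v x * dual j x) \<in> borel_measurable M" by measurable
  show "AE x in M. u x * dual j x = v x * dual j x" using uv by eventually_elim simp
qed

lemma coef_f: "coef j (f k) = (if j = k then 1 else 0)"
proof (cases "j = k")
  case True
  then show ?thesis using f_norm[of k] by (simp add: coef_def f_dual)
next
  case False
  have "(\<lambda>x. f k x * dual j x) = (\<lambda>_. 0)"
    using False disj f_supp(1)[of _ k] dual_supp[of _ j] unfolding disjoint_family_on_def by fastforce
  then show ?thesis using False by (simp only: coef_def Lint_M) simp
qed

lemma coef_comb: "coef j (comb m c) = (if j < m then c j else 0)"
proof (induction m)
  case 0
  show ?case by (simp add: coef_def comb_def Lint_M)
next
  case (Suc m)
  have "comb (Suc m) c = (\<lambda>x. 1 * comb m c x + c m * f m x)" by (auto simp: comb_def)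
  then have "coef j (comb (Suc m) c) = coef j (\<lambda>x. 1 * comb m c x + c m * f m x)" by (simp only:)
  also have "\<dots> = 1 * coef j (comb m c) + c m * coef j (f m)"
    by (intro coef_combine comb_memLp Ccinf_memLp f_Ccinf)
  finally show ?case by (auto simp: Suc coef_f less_Suc_eq)
qed

definition proj :: "nat \<Rightarrow> (real^'n \<Rightarrow> real) \<Rightarrow> real^'n \<Rightarrow> real" where
  "proj m u = comb m (\<lambda>j. coef j u)"

lemma proj_comb: "proj m (comb m c) = comb m c"
  by (auto simp: proj_def comb_def[abs_def] coef_comb[unfolded comb_def[abs_def]] intro!: ext sum.cong)

lemma proj_AE: "memLp D p u \<Longrightarrow> AE x in M. u x = v x \<Longrightarrow> proj m u = proj m v"
  using coef_AE[of u v] by (simp add: proj_def)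

lemma proj_combine:
  assumes "memLp D p u" "memLp D p v"
  shows "proj m (\<lambda>x. \<alpha> * u x + \<beta> * v x) = (\<lambda>x. \<alpha> * proj m u x + \<beta> * proj m v x)"
  unfolding proj_def comb_def coef_combine[OF assms] sum_distrib_left sum.distrib[symmetric]
  by (intro ext sum.cong refl) (simp add: algebra_simps)

text \<open>The localised bounds on the coefficients add up without loss over the disjoint sets
  \<open>A j\<close>. The exact constant 1 matters, since any larger one would spoil the sharp lower
  bound.\<close>

lemma proj_norm:
  assumes u: "memLp D p u"
  shows "Lpnorm D p (proj m u) \<le> Lpnorm D p u"
proof -
  have "Lpnorm D p (proj m u) powr p = (\<Sum>j<m. \<bar>coef j u\<bar> powr p)"
    unfolding proj_def by (rule comb_energy)
  also have "\<dots> \<le> (\<Sum>j<m. \<integral>x. indicator (A j) x * \<bar>u x\<bar> powr p \<partial>M)"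
    by (intro sum_mono dual_integrable u)
  also have "\<dots> = (\<integral>x. (\<Sum>j<m. indicator (A j) x * \<bar>u x\<bar> powr p) \<partial>M)"
    by (rule Bochner_Integration.integral_sum[symmetric]) (rule A_memLp(2)[OF u])
  also have "\<dots> \<le> (\<integral>x. \<bar>u x\<bar> powr p \<partial>M)"
  proof (rule integral_mono)
    show "integrable M (\<lambda>x. \<Sum>j<m. indicator (A j) x * \<bar>u x\<bar> powr p)"
      by (intro Bochner_Integration.integrable_sum A_memLp(2)[OF u])
    show "integrable M (\<lambda>x. \<bar>u x\<bar> powr p)" using u by (simp add: memLp_M)
    fix x
    have "(\<Sum>j<m. indicator (A j) x :: real) = indicator (\<Union>j<m. A j) x"
      using disj by (intro indicator_UN_disjoint[symmetric]) (auto simp: disjoint_family_on_def)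
    also have "\<dots> \<le> 1" by (simp add: indicator_def)
    finally have "(\<Sum>j<m. indicator (A j) x :: real) * \<bar>u x\<bar> powr p \<le> 1 * \<bar>u x\<bar> powr p"
      by (intro mult_right_mono) auto
    then show "(\<Sum>j<m. indicator (A j) x * \<bar>u x\<bar> powr p) \<le> \<bar>u x\<bar> powr p"
      by (simp add: sum_distrib_right)
  qed
  also have "\<dots> = Lpnorm D p u powr p" by (simp add: Lpnorm_powr Lint_M)
  finally have "(Lpnorm D p (proj m u) powr p) powr (1 / p) \<le> (Lpnorm D p u powr p) powr (1 / p)"
    by (rule powr_mono2[rotated 2]) (use p_gt_1 in auto)
  then show ?thesis by (simp only: powr_norm(2)[OF Lpnorm_nonneg])
qed

text \<open>All functions that agree with a combination almost everywhere belong to it, as a class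
  distinguishes no representative.\<close>

definition span_fun :: "nat \<Rightarrow> (real^'n \<Rightarrow> real) set" where
  "span_fun m = {u. \<exists>c. AE x in M. comb m c x = u x}"

lemma span_fun_memLp: "u \<in> span_fun m \<Longrightarrow> memLp D p u"
  using AE_memLp[OF comb_memLp] by (auto simp: span_fun_def)

lemma comb_span_fun: "comb m c \<in> span_fun m"
  by (auto simp: span_fun_def)

lemma comb_combine: "(\<lambda>x. \<alpha> * comb m c x + \<beta> * comb m d x) = comb m (\<lambda>j. \<alpha> * c j + \<beta> * d j)"
  unfolding comb_def sum_distrib_left sum.distrib[symmetric]
  by (intro ext sum.cong refl) (simp add: algebra_simps)

lemma proj_span_fun:
  assumes "u \<in> span_fun m"
  shows "AE x in M. proj m u x = u x"
proof -
  obtain c where c: "AE x in M. comb m c x = u x" using assms by (auto simp: span_fun_def)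
  have "proj m u = comb m c" using proj_AE[OF comb_memLp c, of m] proj_comb by simp
  with c show ?thesis by simp
qed

lemma span_fun_combine:
  assumes "u \<in> span_fun m" "v \<in> span_fun m"
  shows "(\<lambda>x. \<alpha> * u x + \<beta> * v x) \<in> span_fun m"
proof -
  obtain c d where c: "AE x in M. comb m c x = u x" and d: "AE x in M. comb m d x = v x"
    using assms by (auto simp: span_fun_def)
  have "AE x in M. comb m (\<lambda>j. \<alpha> * c j + \<beta> * d j) x = \<alpha> * u x + \<beta> * v x"
    unfolding comb_combine[symmetric] using c d by eventually_elim simp
  then show ?thesis unfolding span_fun_def by blast
qed

lemma span_function_space: "function_space D (span_fun m) (Lpnorm D p)"
proof -
  interpret L: function_space D "{f. memLp D p f}" "Lpnorm D p" by (rule Lp_function_space)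
  have mem: "u \<in> {f. memLp D p f}" if "u \<in> span_fun m" for u using span_fun_memLp[OF that] by simp
  show ?thesis
  proof
    have "comb m (\<lambda>_. 0) = (\<lambda>_. 0)" by (auto simp: comb_def)
    then show "(\<lambda>_. 0) \<in> span_fun m" using comb_span_fun[of m "\<lambda>_. 0"] by simp
    show "(\<lambda>x. u x + v x) \<in> span_fun m" if "u \<in> span_fun m" "v \<in> span_fun m" for u v
      using span_fun_combine[OF that, of 1 1] by simp
    show "(\<lambda>x. c * u x) \<in> span_fun m" if "u \<in> span_fun m" for u c
      using span_fun_combine[OF that that, of c 0] by simp
    show "v \<in> span_fun m" if u: "u \<in> span_fun m" and uv: "eq_on_AE D u v" for u v
    proof -
      obtain c where c: "AE x in M. comb m c x = u x" using u unfolding span_fun_def by blast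
      have uv: "AE x in M. u x = v x" using uv by (simp add: AE_M)
      have "AE x in M. comb m c x = v x" using c uv by eventually_elim simp
      then show ?thesis unfolding span_fun_def by blast
    qed
    show "\<exists>g\<in>span_fun m. (\<lambda>j. Lpnorm D p (\<lambda>x. h j x - g x)) \<longlonglongrightarrow> 0"
      if V: "\<And>j. h j \<in> span_fun m"
        and C: "\<And>e. 0 < e \<Longrightarrow> \<exists>N. \<forall>j\<ge>N. \<forall>k\<ge>N. Lpnorm D p (\<lambda>x. h j x - h k x) < e" for h :: "nat \<Rightarrow> _"
    proof -
      note hm = span_fun_memLp[OF V]
      obtain g where g: "memLp D p g" and lim: "(\<lambda>j. Lpnorm D p (\<lambda>x. h j x - g x)) \<longlonglongrightarrow> 0"
        using Lpnorm_complete[OF hm C] by blast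
      \<comment> \<open>Members of the span are fixed by the contraction \<open>proj m\<close>, so
        the projected limit is at least as close to the sequence as the limit in \<open>L^p\<close>;
        this proves completeness without compactness.\<close>
      have le: "Lpnorm D p (\<lambda>x. h j x - proj m g x) \<le> Lpnorm D p (\<lambda>x. h j x - g x)" for j
      proof -
        have "proj m (\<lambda>x. h j x - g x) = (\<lambda>x. proj m (h j) x - proj m g x)"
          using proj_combine[OF hm[of j] g, of m 1 "-1"] by simp
        moreover have "Lpnorm D p (\<lambda>x. h j x - proj m g x) = Lpnorm D p (\<lambda>x. proj m (h j) x - proj m g x)"
        proof (rule L.AE_norm)
          show "(\<lambda>x. proj m (h j) x - proj m g x) \<in> {f. memLp D p f}"
            by (simp add: memLp_diff comb_memLp proj_def)
          have "AE x in M. proj m (h j) x - proj m g x = h j x - proj m g x"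
            using proj_span_fun[OF V[of j]] by eventually_elim simp
          then show "eq_on_AE D (\<lambda>x. proj m (h j) x - proj m g x) (\<lambda>x. h j x - proj m g x)" by (simp add: AE_M)
        qed
        ultimately show ?thesis using proj_norm[OF memLp_diff[OF hm[of j] g], of m] by simp
      qed
      have "(\<lambda>j. Lpnorm D p (\<lambda>x. h j x - proj m g x)) \<longlonglongrightarrow> 0"
        by (rule Lim_null_comparison[OF _ lim]) (simp add: le Lpnorm_nonneg)
      then show ?thesis using comb_span_fun unfolding proj_def by blast
    qed
  qed (use mem L.AE_norm L.norm_nonneg L.norm_zero_iff L.norm_scale L.norm_triangle in blast)+
qed

lemma span_W0:
  assumes "u \<in> span_fun m"
  shows "u \<in> {u. \<exists>G. W0_grad u G}" and "W0_norm u \<le> \<rho> powr (1 / p) * Lpnorm D p u"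
proof -
  interpret W: function_space D "{u. \<exists>G. W0_grad u G}" W0_norm by (rule W0_function_space)
  obtain c where "AE x in M. comb m c x = u x" using assms by (auto simp: span_fun_def)
  then have c: "eq_on_AE D (comb m c) u" by (simp add: AE_M)
  have V: "comb m c \<in> {u. \<exists>G. W0_grad u G}" using comb_W0_grad by blast
  show "u \<in> {u. \<exists>G. W0_grad u G}" by (rule W.AE_mem[OF V c])
  have "W0_norm u = W0_norm (comb m c)" by (rule W.AE_norm[OF V c])
  also have "\<dots> \<le> \<rho> powr (1 / p) * Lpnorm D p (comb m c)" by (rule comb_W0_norm)
  also have "Lpnorm D p (comb m c) = Lpnorm D p u"
    using function_space.AE_norm[OF Lp_function_space _ c] comb_memLp by simp
  finally show "W0_norm u \<le> \<rho> powr (1 / p) * Lpnorm D p u" .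
qed

lemma Lpnorm_le_W0_norm: "\<forall>u\<in>{u. \<exists>G. W0_grad u G}. Lpnorm D p u \<le> 1 * W0_norm u"
  using W0_norm_eq[OF W0_gradD(1)] Lpnorm_le_W1p by auto

text \<open>Off the carrier the value is zero because \<open>bop\<close> prescribes it; on the
  carrier the representative does not matter, since \<open>proj\<close> sees a function only through
  integrals.\<close>

definition proj_op :: "nat \<Rightarrow> (real^'n \<Rightarrow> real) set \<Rightarrow> (real^'n \<Rightarrow> real) set" where
  "proj_op m C = (if C \<in> vcarrier (Lp_space D p) then cls D (proj m (rep C)) else cls D (\<lambda>_. 0))"

lemma proj_op_cls: "memLp D p u \<Longrightarrow> proj_op m (cls D u) = cls D (proj m u)"
proof -
  assume u: "memLp D p u"
  have "AE x in M. u x = rep (cls D u) x" using rep_cls[of D u] by (simp add: AE_M eq_commute)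
  from proj_AE[OF u this] show ?thesis using u by (simp add: proj_op_def Lp_space_eq)
qed

lemma proj_op_bound:
  assumes "C \<in> vcarrier (Lp_space D p)"
  shows "vnorm (fspace D (span_fun m) (Lpnorm D p)) (proj_op m C) \<le> 1 * vnorm (Lp_space D p) C"
proof -
  obtain u where u: "memLp D p u" "C = cls D u" using assms by (auto simp: Lp_space_eq)
  have "Lpnorm D p (rep (cls D (proj m u))) = Lpnorm D p (proj m u)"
    by (rule function_space.norm_rep[OF span_function_space[of m]]) (simp add: proj_def comb_span_fun)
  moreover have "Lpnorm D p (rep (cls D u)) = Lpnorm D p u"
    by (rule function_space.norm_rep[OF Lp_function_space]) (simp add: u)
  ultimately show ?thesis using proj_norm[OF u(1)] u by (simp add: Lp_space_eq proj_op_cls)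
qed

lemma proj_op_bop: "proj_op m \<in> bop (Lp_space D p) (fspace D (span_fun m) (Lpnorm D p))"
proof -
  have "\<forall>x\<in>vcarrier (Lp_space D p). vnorm (fspace D (span_fun m) (Lpnorm D p)) (proj_op m x) \<le> 1 * vnorm (Lp_space D p) x"
    using proj_op_bound by blast
  then have bd: "\<exists>K. \<forall>x\<in>vcarrier (Lp_space D p). vnorm (fspace D (span_fun m) (Lpnorm D p)) (proj_op m x) \<le> K * vnorm (Lp_space D p) x"
    by blast
  have add: "proj_op m (cls D (\<lambda>x. u x + v x)) = cls D (\<lambda>x. proj m u x + proj m v x)"
    if "memLp D p u" "memLp D p v" for u v
    using proj_combine[OF that, of m 1 1] memLp_add[OF that] by (simp add: proj_op_cls)
  have scale: "proj_op m (cls D (\<lambda>x. c * u x)) = cls D (\<lambda>x. c * proj m u x)" if "memLp D p u" for u c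
    using proj_combine[OF that that, of m c 0] memLp_scale[OF that] by (simp add: proj_op_cls)
  have mem: "cls D (proj m u) \<in> vcarrier (fspace D (span_fun m) (Lpnorm D p))" for u
    by (simp add: proj_def comb_span_fun)
  show ?thesis
    unfolding bop_def mem_Collect_eq
  proof (intro conjI bd ballI allI impI)
    fix C assume "C \<in> vcarrier (Lp_space D p)"
    then obtain u where u: "memLp D p u" "C = cls D u" by (auto simp: Lp_space_eq)
    show "proj_op m C \<in> vcarrier (fspace D (span_fun m) (Lpnorm D p))"
      using mem u by (simp only: proj_op_cls)
    show "proj_op m (vscale (Lp_space D p) c C) = vscale (fspace D (span_fun m) (Lpnorm D p)) c (proj_op m C)" for c
      using u by (simp add: Lp_space_eq scale proj_op_cls)
    fix C' assume "C' \<in> vcarrier (Lp_space D p)"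
    then obtain v where v: "memLp D p v" "C' = cls D v" by (auto simp: Lp_space_eq)
    show "proj_op m (vadd (Lp_space D p) C C') = vadd (fspace D (span_fun m) (Lpnorm D p)) (proj_op m C) (proj_op m C')"
      using u v by (simp add: Lp_space_eq add proj_op_cls)
  qed (simp add: proj_op_def)
qed

lemma lincomb_f: "lincomb (fspace D V N) c (\<lambda>i. cls D (f i)) m = cls D (comb m c)"
  by (induction m) (simp_all add: comb_def[abs_def])

text \<open>The functionals \<open>coef i\<close> recover the coefficients of a combination and do
  not see null sets, so a combination in the zero class has only zero coefficients.\<close>

lemma dim_span: "dim_ge (fspace D (span_fun m) (Lpnorm D p)) m"
  unfolding dim_ge_def indep_def
proof (intro exI[of _ "\<lambda>i. cls D (f i)"] conjI allI impI)
  fix i assume i: "i < m"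
  have "comb m (\<lambda>j. if j = i then 1 else 0) = f i"
    using i by (auto simp: comb_def fun_eq_iff if_distrib[of "\<lambda>c. c * _"] sum.delta cong: if_cong)
  then have "f i \<in> span_fun m" using comb_span_fun by metis
  then show "cls D (f i) \<in> vcarrier (fspace D (span_fun m) (Lpnorm D p))" by simp
next
  fix c i assume "lincomb (fspace D (span_fun m) (Lpnorm D p)) c (\<lambda>i. cls D (f i)) m = vzero (fspace D (span_fun m) (Lpnorm D p))"
    and i: "i < m"
  then have "AE x in M. comb m c x = 0" by (simp add: lincomb_f cls_eq_iff AE_M)
  then have "coef i (comb m c) = coef i (\<lambda>_. 0)" by (intro coef_AE comb_memLp)
  then show "c i = 0" using i by (simp add: coef_comb) (simp add: coef_def Lint_M)
qed

text \<open>Inclusion of the span, embedding and projection compose to the identity of a space of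
  dimension at least \<open>m\<close>, on which a strict s-number is 1. The projection contributes
  norm at most 1 and the inclusion at most \<open>\<rho> powr (1 / p)\<close>. A factorisation of
  this kind is also what the isomorphism numbers measure.\<close>

lemma snum_lower_bound:
  assumes s: "strict_snum s" and m: "m \<ge> 1"
  shows "1 \<le> \<rho> powr (1 / p) * s m (W0_space D p) (Lp_space D p) (emb (W0_space D p) (Lp_space D p))"
proof -
  let ?W = "W0_space D p" and ?L = "Lp_space D p" and ?G = "fspace D (span_fun m) (Lpnorm D p)"
  let ?I = "emb ?W ?L" and ?B = "emb ?G ?W" and ?A = "proj_op m"
  have bG: "banach ?G" by (rule function_space.banach_fspace[OF span_function_space])
  note I = emb_fspace[OF W0_function_space Lp_function_space W0_subset_Lp Lpnorm_le_W0_norm,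
      folded W0_space_eq Lp_space_eq]
  have sub: "span_fun m \<subseteq> {u. \<exists>G. W0_grad u G}" using span_W0(1) by blast
  have "\<forall>u\<in>span_fun m. W0_norm u \<le> \<rho> powr (1 / p) * Lpnorm D p u" using span_W0(2) by blast
  note B = emb_fspace[OF span_function_space W0_function_space sub this, folded W0_space_eq]
  have AIB: "?A \<circ> ?I \<circ> ?B = idop ?G"
  proof
    fix x
    show "(?A \<circ> ?I \<circ> ?B) x = idop ?G x"
    proof (cases "x \<in> vcarrier ?G")
      case True
      then obtain u where u: "u \<in> span_fun m" "x = cls D u" by auto
      have "cls D (proj m u) = cls D u"
        using proj_span_fun[OF u(1)] by (simp add: cls_eq_iff AE_M)
      moreover have "?I (cls D u) = cls D u" by (rule I(2)[OF span_W0(1)[OF u(1)]])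
      moreover have "?B (cls D u) = cls D u" by (rule B(2)[OF u(1)])
      ultimately show ?thesis
        using u(2) True proj_op_cls[OF span_fun_memLp[OF u(1)], of m] by (simp add: idop_def)
    next
      case False
      \<comment> \<open>Equality of operators is equality of functions, so the composition has to
        agree with \<open>idop\<close> off the carrier as well; there both give the class of
        0.\<close>
      have z: "(\<lambda>_. 0) \<in> {u. \<exists>G. W0_grad u G}" by (rule function_space.zero_mem[OF W0_function_space])
      have "proj m (\<lambda>_. 0) = (\<lambda>_. 0)"
        using proj_combine[OF memLp_zero memLp_zero, of m 0 0] by simp
      then have "?A (cls D (\<lambda>_. 0)) = cls D (\<lambda>_. 0)" by (simp add: proj_op_cls memLp_zero)
      moreover have "?B x = cls D (\<lambda>_. 0)" using False by (simp add: emb_def W0_space_eq)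
      ultimately show ?thesis using False I(2)[OF z] by (simp add: idop_def)
    qed
  qed
  have props: "0 \<le> s m ?W ?L ?I" "s m ?G ?G (?A \<circ> ?I \<circ> ?B) \<le> opnorm ?L ?G ?A * s m ?W ?L ?I * opnorm ?G ?W ?B"
    by (rule strict_snum_op(3)[OF s banach_W0 banach_Lp I(1) m],
        rule strict_snum_op(4)[OF s banach_W0 banach_Lp I(1) m bG bG B(1) proj_op_bop])
  have "s m ?G ?G (idop ?G) = 1"
    by (rule strict_snum_id[OF s bG m dim_span])
  then have "1 \<le> opnorm ?L ?G ?A * s m ?W ?L ?I * opnorm ?G ?W ?B" using props(2) unfolding AIB by simp
  also have "\<dots> \<le> (1 * s m ?W ?L ?I) * \<rho> powr (1 / p)"
  proof (intro mult_mono)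
    show "opnorm ?L ?G ?A \<le> 1"
      unfolding Lp_space_eq
      by (rule opnorm_fspace_le[OF Lp_function_space]) (use proj_op_bound in \<open>simp_all add: Lp_space_eq\<close>)
    show "opnorm ?G ?W ?B \<le> \<rho> powr (1 / p)"
      by (rule opnorm_fspace_le[OF span_function_space _ B(3)]) simp
    show "0 \<le> opnorm ?G ?W ?B"
      using opnorm_nonneg[OF span_function_space W0_function_space] B(1) by (simp add: W0_space_eq)
  qed (use props in auto)
  finally show ?thesis by (simp add: mult.commute)
qed

section \<open>Finite coverings of the image of the unit ball\<close>

lemma A_norm_tendsto_0:
  assumes u: "memLp D p u"
  shows "(\<lambda>n. Lpnorm D p (\<lambda>x. indicator (A n) x * u x)) \<longlonglongrightarrow> 0"
proof -
  have "(\<lambda>n. \<integral>x. indicator (A n) x * \<bar>u x\<bar> powr p \<partial>M) \<longlonglongrightarrow> (\<integral>x. 0 \<partial>M)"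
  proof (rule integral_dominated_convergence)
    show "integrable M (\<lambda>x. \<bar>u x\<bar> powr p)" using u by (simp add: memLp_M)
    show "(\<lambda>x. indicator (A n) x * \<bar>u x\<bar> powr p) \<in> borel_measurable M" for n
      using A_memLp(2)[OF u] by (rule borel_measurable_integrable)
    \<comment> \<open>A point lies in at most one of the disjoint sets, so at each point the
      sequence is eventually 0.\<close>
    show "AE x in M. (\<lambda>n. indicator (A n) x * \<bar>u x\<bar> powr p) \<longlonglongrightarrow> 0"
    proof (intro AE_I2 tendsto_eventually)
      fix x
      show "\<forall>\<^sub>F n in sequentially. indicator (A n) x * \<bar>u x\<bar> powr p = 0"
      proof (cases "\<exists>k. x \<in> A k")
        case True
        then obtain k where k: "x \<in> A k" by blast
        have "x \<notin> A n" if "Suc k \<le> n" for n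
          using that k disj unfolding disjoint_family_on_def by (metis UNIV_I disjoint_iff not_less_eq_eq order_refl)
        then show ?thesis by (intro eventually_sequentiallyI[of "Suc k"]) simp
      qed simp
    qed
    show "AE x in M. norm (indicator (A n) x * \<bar>u x\<bar> powr p) \<le> \<bar>u x\<bar> powr p" for n
      by (intro AE_I2) (simp add: indicator_def)
  qed simp
  then have "(\<lambda>n. (\<integral>x. indicator (A n) x * \<bar>u x\<bar> powr p \<partial>M) powr (1 / p)) \<longlonglongrightarrow> 0 powr (1 / p)"
    using p_gt_1 by (intro tendsto_powr' tendsto_const) (auto intro!: always_eventually integral_nonneg_AE)
  then show ?thesis by (simp add: Lpnorm_def Lint_M A_memLp(3)[OF u])
qed

text \<open>Scaled by \<open>\<rho> powr (- 1 / p)\<close> the bumps lie in the unit ball. On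
  \<open>A n\<close> with \<open>n\<close> large each of the finitely many centres is small in norm,
  so its distance to the \<open>n\<close>-th scaled bump is almost the norm of that bump or
  larger.\<close>

lemma cover_lower_bound:
  fixes y :: "nat \<Rightarrow> (real^'n \<Rightarrow> real) set"
  assumes y: "\<forall>j<N. y j \<in> vcarrier (Lp_space D p)"
    and cover: "\<forall>x\<in>vcarrier (W0_space D p). vnorm (W0_space D p) x \<le> 1 \<longrightarrow>
      (\<exists>j<N. vnorm (Lp_space D p) (vsub (Lp_space D p) (emb (W0_space D p) (Lp_space D p) x) (y j)) \<le> e)"
  shows "\<rho> powr (- 1 / p) \<le> e"
proof -
  interpret W: function_space D "{u. \<exists>G. W0_grad u G}" W0_norm by (rule W0_function_space)
  define z where "z j = rep (y j)" for j
  have z: "memLp D p (z j)" "y j = cls D (z j)" if jN: "j < N" for j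
  proof -
    obtain u where u: "memLp D p u" "y j = cls D u" using y jN by (auto simp: Lp_space_eq)
    show "memLp D p (z j)"
      using function_space.rep_mem[OF Lp_function_space, of u] u by (simp add: z_def)
    show "y j = cls D (z j)" using rep_cls[of D u] u by (simp add: z_def cls_eq_iff eq_commute)
  qed
  define t where "t = \<rho> powr (- 1 / p)"
  have t: "0 < t" using rho_ge_1 by (simp add: t_def)
  define g where "g n x = t * f n x" for n x
  have gm: "memLp D p (g n)" for n unfolding g_def[abs_def] by (intro memLp_scale Ccinf_memLp f_Ccinf)
  have gW: "g n \<in> {u. \<exists>G. W0_grad u G}" for n
    unfolding g_def[abs_def] using W0_grad_Ccinf[OF f_Ccinf] by (intro W.scale_mem) blast
  have gnorm: "W0_norm (g n) \<le> 1" for n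
  proof -
    have "W0_norm (g n) = \<bar>t\<bar> * W0_norm (f n)"
      unfolding g_def[abs_def] using W0_grad_Ccinf[OF f_Ccinf] by (intro W.norm_scale) blast
    also have "W0_norm (f n) = W1p_norm D p (f n) (\<lambda>i. pd i (f n))"
      by (rule W0_norm_eq[OF has_weak_grad_Ccinf[OF f_Ccinf]])
    also have "\<dots> \<le> \<rho> powr (1 / p)"
      unfolding W1p_norm_def by (rule powr_mono2[OF _ energy_nonneg f_energy]) (use p_gt_1 in simp)
    then have "\<bar>t\<bar> * W1p_norm D p (f n) (\<lambda>i. pd i (f n)) \<le> t * \<rho> powr (1 / p)"
      using t by simp
    also have "\<dots> = 1" using rho_ge_1 by (simp add: t_def flip: powr_add)
    finally show ?thesis .
  qed
  \<comment> \<open>The centre belonging to the \<open>n\<close>-th bump depends on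
    \<open>n\<close>; summing over all centres gives one bound that can be sent to the
    limit.\<close>
  have le: "t \<le> e + (\<Sum>j<N. Lpnorm D p (\<lambda>x. indicator (A n) x * z j x))" for n
  proof -
    have "vnorm (W0_space D p) (cls D (g n)) \<le> 1" using gW gnorm by (simp add: W0_space_eq)
    moreover have c: "cls D (g n) \<in> vcarrier (W0_space D p)" using gW by (simp add: W0_space_eq)
    ultimately obtain j where j: "j < N"
      and "vnorm (Lp_space D p) (vsub (Lp_space D p) (emb (W0_space D p) (Lp_space D p) (cls D (g n))) (y j)) \<le> e"
      using cover by blast
    then have le: "Lpnorm D p (\<lambda>x. g n x - z j x) \<le> e"
      using c function_space.norm_rep[OF Lp_function_space, of "\<lambda>x. g n x - z j x"] memLp_diff[OF gm z(1)[OF j]]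
      by (simp add: emb_def Lp_space_eq z(2))
    let ?d = "\<lambda>x. indicator (A n) x * (g n x - z j x)" and ?w = "\<lambda>x. indicator (A n) x * z j x"
    have dm: "memLp D p ?d" "memLp D p ?w" using A_memLp(1) memLp_diff[OF gm z(1)[OF j]] z(1)[OF j] by blast+
    have "t = Lpnorm D p (g n)"
    proof -
      have "Lpnorm D p (f n) = 1" using f_norm[of n] by (simp add: Lpnorm_def)
      then show ?thesis
        unfolding g_def[abs_def]
        using function_space.norm_scale[OF Lp_function_space, of "f n" t] t Ccinf_memLp(1)[OF f_Ccinf] by simp
    qed
    also have "g n = (\<lambda>x. ?d x + ?w x)"
      by (rule ext) (auto simp: indicator_def g_def f_supp)
    also have "Lpnorm D p (\<lambda>x. ?d x + ?w x) \<le> Lpnorm D p ?d + Lpnorm D p ?w" by (rule Lpnorm_triangle[OF dm])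
    also have "Lpnorm D p ?d \<le> Lpnorm D p (\<lambda>x. g n x - z j x)"
      unfolding Lpnorm_def Lint_M using p_gt_1 dm(1) memLp_diff[OF gm z(1)[OF j]]
      by (intro powr_mono2 integral_mono) (auto simp: memLp_M indicator_def intro!: integral_nonneg_AE)
    also have "\<dots> \<le> e" by (rule le)
    also have "Lpnorm D p ?w \<le> (\<Sum>j<N. Lpnorm D p (\<lambda>x. indicator (A n) x * z j x))"
      using j by (intro member_le_sum[of j "{..<N}" "\<lambda>j. Lpnorm D p (\<lambda>x. indicator (A n) x * z j x)"]) (auto simp: Lpnorm_nonneg)
    finally show ?thesis by simp
  qed
  have "(\<lambda>n. e + (\<Sum>j<N. Lpnorm D p (\<lambda>x. indicator (A n) x * z j x))) \<longlonglongrightarrow> e + (\<Sum>j<N. 0)"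
    by (intro tendsto_add tendsto_const tendsto_sum A_norm_tendsto_0) (simp add: z)
  then have "t \<le> e + (\<Sum>j<N. 0)"
    by (rule LIMSEQ_le_const) (use le in blast)
  then show ?thesis by (simp add: t_def)
qed

end

subsection \<open>Products of almost-extremal functions\<close>

text \<open>The product formula is available over \<open>Basis\<close>; \<open>ix\<close> translates
  basis vectors back into coordinates, and nonnegativity lets the computation run in
  \<open>ennreal\<close>.\<close>

lemma lborel_integral_prod:
  fixes h :: "'n::finite \<Rightarrow> real \<Rightarrow> real"
  assumes int: "\<And>i. integrable lborel (h i)" and nn: "\<And>i y. 0 \<le> h i y"
  shows "(\<integral>x. (\<Prod>i\<in>UNIV. h i (x $ i)) \<partial>(lborel :: (real^'n) measure)) = (\<Prod>i\<in>UNIV. \<integral>y. h i y \<partial>lborel)"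
proof -
  define ix :: "real^'n \<Rightarrow> 'n" where "ix b = (THE i. b = axis i 1)" for b
  have ix: "ix (axis i 1) = i" for i by (simp add: ix_def axis_eq_axis)
  have bij: "bij_betw (\<lambda>i. axis i 1 :: real^'n) UNIV Basis"
    by (auto simp: bij_betw_def inj_on_def axis_eq_axis Basis_vec_def)
  have hm [measurable]: "h i \<in> borel_measurable borel" for i using int[of i] by auto
  have "(\<integral>\<^sup>+x. (\<Prod>i\<in>UNIV. ennreal (h i (x $ i))) \<partial>(lborel :: (real^'n) measure))
      = (\<integral>\<^sup>+x. (\<Prod>b\<in>Basis. ennreal (h (ix b) (x \<bullet> b))) \<partial>lborel)"
    by (intro nn_integral_cong) (simp add: prod.reindex_bij_betw[OF bij, symmetric] ix inner_axis)
  also have "\<dots> = (\<Prod>b\<in>(Basis :: (real^'n) set). \<integral>\<^sup>+y. ennreal (h (ix b) y) \<partial>lborel)"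
    by (rule nn_integral_lborel_prod) auto
  also have "\<dots> = (\<Prod>i\<in>UNIV. \<integral>\<^sup>+y. ennreal (h i y) \<partial>lborel)"
    by (simp add: prod.reindex_bij_betw[OF bij, symmetric] ix)
  also have "\<dots> = (\<Prod>i\<in>UNIV. ennreal (\<integral>y. h i y \<partial>lborel))"
    using int nn by (intro prod.cong refl nn_integral_eq_integral) auto
  also have "\<dots> = ennreal (\<Prod>i\<in>UNIV. \<integral>y. h i y \<partial>lborel)"
    using nn by (intro prod_ennreal) auto
  finally have e: "(\<integral>\<^sup>+x. ennreal (\<Prod>i\<in>UNIV. h i (x $ i)) \<partial>(lborel :: (real^'n) measure)) = ennreal (\<Prod>i\<in>UNIV. \<integral>y. h i y \<partial>lborel)"
    using nn by (simp add: prod_ennreal)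
  have c: "(\<lambda>x::real^'n. x $ i) \<in> borel_measurable borel" for i
    by (intro borel_measurable_continuous_onI continuous_intros)
  have m: "(\<lambda>x::real^'n. \<Prod>i\<in>UNIV. h i (x $ i)) \<in> borel_measurable lborel"
    using measurable_compose[OF c hm] by (intro borel_measurable_prod) simp
  have "(\<integral>x. (\<Prod>i\<in>UNIV. h i (x $ i)) \<partial>(lborel :: (real^'n) measure)) = enn2real (ennreal (\<Prod>i\<in>UNIV. \<integral>y. h i y \<partial>lborel))"
    using nn m unfolding e[symmetric] by (intro integral_eq_nn_integral) (auto intro!: AE_I2 prod_nonneg)
  then show ?thesis using nn by (simp add: prod_nonneg)
qed

section \<open>The slab, with \<open>K\<close> the set of unbounded directions, and the sharp
  inequality on it\<close>

definition slab :: "'n::finite set \<Rightarrow> ('n \<Rightarrow> real) \<Rightarrow> ('n \<Rightarrow> real) \<Rightarrow> (real^'n) set" where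
  "slab K a b = {x. \<forall>i. i \<notin> K \<longrightarrow> a i < x $ i \<and> x $ i < b i}"

lemma open_slab: "open (slab K a b)"
proof -
  have "slab K a b = (\<Inter>i\<in>-K. {x. a i < x $ i} \<inter> {x. x $ i < b i})" by (auto simp: slab_def)
  also have "open \<dots>"
    by (intro open_INT finite ballI open_Int open_Collect_less continuous_intros)
  finally show ?thesis .
qed

locale slab_problem =
  fixes p :: real and K :: "'n::finite set" and a b :: "'n \<Rightarrow> real"
  assumes p_gt_1': "1 < p" and K_ne: "K \<noteq> {}" and ab: "\<And>i. i \<notin> K \<Longrightarrow> a i < b i"
begin

sublocale Lp_domain "slab K a b" p
  by unfold_locales (rule open_slab p_gt_1')+

abbreviation "D \<equiv> slab K a b"

definition \<Lambda> where "\<Lambda> = pi_p p powr p * (p - 1) * (\<Sum>i\<in>- K. (b i - a i) powr (- p))"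

lemma Lambda_nonneg: "0 \<le> \<Lambda>"
  unfolding \<Lambda>_def using p_gt_1 by (intro mult_nonneg_nonneg sum_nonneg) auto

text \<open>The one-dimensional inequalities of the bounded directions are added up. The derivatives
  along \<open>K\<close> are merely dropped; this does not lose sharpness, since bumps stretched
  along \<open>K\<close> make them arbitrarily small.\<close>

lemma Lpnorm_le_opt_Ccinf:
  assumes \<phi>: "Ccinf D \<phi>"
  shows "Lpnorm D p \<phi> \<le> (1 + \<Lambda>) powr (- 1 / p) * W1p_norm D p \<phi> (\<lambda>i. pd i \<phi>)"
proof -
  let ?E = "Lint D (\<lambda>x. \<bar>\<phi> x\<bar> powr p)"
  have "(1 + \<Lambda>) * ?E = ?E + (\<Sum>i\<in>- K. pi_p p powr p * (p - 1) * (b i - a i) powr (- p) * ?E)"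
    by (simp add: \<Lambda>_def distrib_right sum_distrib_left sum_distrib_right)
  also have "\<dots> \<le> ?E + (\<Sum>i\<in>- K. Lint D (\<lambda>x. \<bar>pd i \<phi> x\<bar> powr p))"
    by (intro add_left_mono sum_mono Friedrichs_Ccinf \<phi> ab) (auto simp: slab_def)
  also have "\<dots> \<le> ?E + (\<Sum>i\<in>UNIV. Lint D (\<lambda>x. \<bar>pd i \<phi> x\<bar> powr p))"
    by (intro add_left_mono sum_mono2) (auto simp: Lint_M)
  finally have "((1 + \<Lambda>) * ?E) powr (1 / p) \<le> W1p_norm D p \<phi> (\<lambda>i. pd i \<phi>)"
    unfolding W1p_norm_def
    by (rule powr_mono2[rotated 2]) (use p_gt_1 Lambda_nonneg in \<open>auto simp: Lint_M\<close>)
  then have "(1 + \<Lambda>) powr (- 1 / p) * ((1 + \<Lambda>) powr (1 / p) * Lpnorm D p \<phi>)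
      \<le> (1 + \<Lambda>) powr (- 1 / p) * W1p_norm D p \<phi> (\<lambda>i. pd i \<phi>)"
    using Lambda_nonneg by (intro mult_left_mono) (auto simp: powr_mult Lpnorm_def Lint_M)
  moreover have "(1 + \<Lambda>) powr (- 1 / p) * (1 + \<Lambda>) powr (1 / p) = 1"
    using Lambda_nonneg by (simp flip: powr_add)
  ultimately show ?thesis by (simp only: mult.assoc[symmetric] mult_1)
qed

text \<open>Both sides are continuous in the Sobolev norm, and test functions are dense by the
  definition of the carrier.\<close>

lemma Lpnorm_le_opt: "\<forall>u\<in>{u. \<exists>G. W0_grad u G}. Lpnorm D p u \<le> (1 + \<Lambda>) powr (- 1 / p) * W0_norm u"
proof
  fix u assume "u \<in> {u. \<exists>G. W0_grad u G}"
  then obtain G where G: "W0_grad u G" by blast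
  note Gw = W0_gradD(1)[OF G]
  let ?c = "(1 + \<Lambda>) powr (- 1 / p)"
  have "Lpnorm D p u \<le> ?c * W1p_norm D p u G + e" if e: "0 < e" for e
  proof -
    \<comment> \<open>The approximation costs \<open>d\<close> on the left-hand side and
      \<open>?c * d\<close> on the right.\<close>
    define d where "d = e / (1 + ?c)"
    have c0: "0 \<le> ?c" by simp
    have d: "0 < d" using e by (simp add: d_def add_pos_nonneg)
    obtain \<phi> where \<phi>: "Ccinf D \<phi>" and lt: "W1p_norm D p (\<lambda>x. u x - \<phi> x) (\<lambda>i x. G i x - pd i \<phi> x) < d"
      using W0_gradD(2)[OF G d] by blast
    note m = has_weak_grad_memLp[OF Gw] Ccinf_memLp[OF \<phi>]
    have "Lpnorm D p u = Lpnorm D p (\<lambda>x. (u x - \<phi> x) + \<phi> x)" by simp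
    also have "\<dots> \<le> Lpnorm D p (\<lambda>x. u x - \<phi> x) + Lpnorm D p \<phi>"
      by (intro Lpnorm_triangle memLp_diff m)
    also have "Lpnorm D p (\<lambda>x. u x - \<phi> x) \<le> d"
      using Lpnorm_le_W1p[of "\<lambda>x. u x - \<phi> x" "\<lambda>i x. G i x - pd i \<phi> x"] lt by simp
    also have "Lpnorm D p \<phi> \<le> ?c * W1p_norm D p \<phi> (\<lambda>i. pd i \<phi>)" by (rule Lpnorm_le_opt_Ccinf[OF \<phi>])
    also have "W1p_norm D p \<phi> (\<lambda>i. pd i \<phi>) \<le> W1p_norm D p u G + d"
    proof -
      have "W1p_norm D p (\<lambda>x. 1 * u x + (-1) * (u x - \<phi> x)) (\<lambda>i x. 1 * G i x + (-1) * (G i x - pd i \<phi> x))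
        \<le> \<bar>1\<bar> * W1p_norm D p u G + \<bar>-1\<bar> * W1p_norm D p (\<lambda>x. u x - \<phi> x) (\<lambda>i x. G i x - pd i \<phi> x)"
        by (intro W1p_norm_combine memLp_diff m)
      then show ?thesis using lt by simp
    qed
    finally have "Lpnorm D p u \<le> d + ?c * (W1p_norm D p u G + d)" by (simp add: mult_left_mono)
    also have "\<dots> = ?c * W1p_norm D p u G + (1 + ?c) * d" by (simp add: algebra_simps)
    also have "(1 + ?c) * d = e"
    proof -
      have "(1 + z) * (e / (1 + z)) = e" if "0 \<le> z" for z :: real using that by simp
      then show ?thesis unfolding d_def using c0 by blast
    qed
    finally show ?thesis .
  qed
  then have "Lpnorm D p u \<le> ?c * W1p_norm D p u G" by (rule field_le_epsilon)
  then show "Lpnorm D p u \<le> ?c * W0_norm u" by (simp add: W0_norm_eq[OF Gw])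
qed

text \<open>Along \<open>K\<close> an interval of any length \<open>\<beta>\<close> is allowed, and
  its sharp constant decays like \<open>\<beta> powr (- p)\<close>. Half of \<open>e\<close> is
  spent on that constant and half on the approximation.\<close>

lemma ex_profile:
  assumes e: "0 < e"
  shows "\<exists>g l u. smooth_real g \<and> (i \<notin> K \<longrightarrow> a i < l \<and> u < b i) \<and> (\<forall>y. y \<notin> {l..u} \<longrightarrow> g y = 0) \<and>
    0 < (\<integral>y. \<bar>g y\<bar> powr p \<partial>lborel) \<and>
    (\<integral>y. \<bar>deriv g y\<bar> powr p \<partial>lborel)
      \<le> ((if i \<in> K then 0 else pi_p p powr p * (p - 1) * (b i - a i) powr (- p)) + e) * (\<integral>y. \<bar>g y\<bar> powr p \<partial>lborel)"
proof (cases "i \<in> K")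
  case False
  then show ?thesis using ex.ex_test_function[OF ab[OF False] e] by simp
next
  case True
  let ?C = "pi_p p powr p * (p - 1)"
  have "((\<lambda>\<beta>::real. ?C * \<beta> powr (- p)) \<longlongrightarrow> ?C * 0) at_top"
    using p_gt_1 by (intro tendsto_mult tendsto_const tendsto_neg_powr filterlim_ident) auto
  then have "\<forall>\<^sub>F \<beta>::real in at_top. ?C * \<beta> powr (- p) < e / 2"
    using e by (intro order_tendstoD(2)) auto
  then have "\<forall>\<^sub>F \<beta>::real in at_top. 0 < \<beta> \<and> ?C * \<beta> powr (- p) < e / 2"
    using eventually_gt_at_top[of 0] by eventually_elim simp
  then obtain \<beta> :: real where \<beta>: "0 < \<beta>" "?C * \<beta> powr (- p) < e / 2"
    using eventually_happens[of _ "at_top :: real filter"] by auto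
  have "0 < e / 2" using e by simp
  from ex.ex_test_function[OF \<beta>(1) this] obtain g l u where g: "smooth_real g" "\<forall>y. y \<notin> {l..u} \<longrightarrow> g y = 0"
    "0 < (\<integral>y. \<bar>g y\<bar> powr p \<partial>lborel)"
    "(\<integral>y. \<bar>deriv g y\<bar> powr p \<partial>lborel) \<le> (?C * (\<beta> - 0) powr (- p) + e / 2) * (\<integral>y. \<bar>g y\<bar> powr p \<partial>lborel)"
    by blast
  note g(4)
  also have "(?C * (\<beta> - 0) powr (- p) + e / 2) * (\<integral>y. \<bar>g y\<bar> powr p \<partial>lborel) \<le> e * (\<integral>y. \<bar>g y\<bar> powr p \<partial>lborel)"
    using \<beta> g(3) by (intro mult_right_mono) auto
  finally show ?thesis using True g by (intro exI[of _ g] exI[of _ l] exI[of _ u]) simp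
qed

text \<open>The energy of a product factorises, and a partial derivative changes a single factor.
  The energy ratio in direction \<open>i\<close> is therefore that of the one-dimensional profile,
  at most \<open>c i + e0\<close>, and these ratios add up to \<open>\<Lambda> + e\<close>.\<close>

lemma ex_bump_family:
  assumes e: "0 < e"
  shows "\<exists>f A. bump_family D p f A (1 + \<Lambda> + e)"
proof -
  define e0 where "e0 = e / real CARD('n)"
  have e0: "0 < e0" using e by (simp add: e0_def)
  define c where "c i = (if i \<in> K then 0 else pi_p p powr p * (p - 1) * (b i - a i) powr (- p))" for i
  have c_sum: "(\<Sum>i\<in>UNIV. c i) = \<Lambda>"
  proof -
    have "(\<Sum>i\<in>UNIV. c i) = (\<Sum>i\<in>- K. c i)" by (rule sum.mono_neutral_right) (auto simp: c_def)
    then show ?thesis by (simp add: \<Lambda>_def c_def sum_distrib_left)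
  qed
  have "\<forall>i. \<exists>g l u. smooth_real g \<and> (i \<notin> K \<longrightarrow> a i < l \<and> u < b i) \<and> (\<forall>y. y \<notin> {l..u} \<longrightarrow> g y = 0) \<and>
    0 < (\<integral>y. \<bar>g y\<bar> powr p \<partial>lborel) \<and>
    (\<integral>y. \<bar>deriv g y\<bar> powr p \<partial>lborel) \<le> (c i + e0) * (\<integral>y. \<bar>g y\<bar> powr p \<partial>lborel)"
    unfolding c_def using ex_profile[OF e0] by blast
  then obtain g l u where g: "\<And>i. smooth_real (g i)" and lu: "\<And>i. i \<notin> K \<Longrightarrow> a i < l i \<and> u i < b i"
    and supp: "\<And>i y. y \<notin> {l i..u i} \<Longrightarrow> g i y = 0" and pos: "\<And>i. 0 < (\<integral>y. \<bar>g i y\<bar> powr p \<partial>lborel)"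
    and le: "\<And>i. (\<integral>y. \<bar>deriv (g i) y\<bar> powr p \<partial>lborel) \<le> (c i + e0) * (\<integral>y. \<bar>g i y\<bar> powr p \<partial>lborel)"
    by metis
  obtain k where k: "k \<in> K" using K_ne by blast
  \<comment> \<open>Larger than the width of the support, so that translates by different multiples
    of \<open>w\<close> in the unbounded direction \<open>k\<close> are disjoint.\<close>
  define w where "w = \<bar>u k - l k\<bar> + 1"
  define t where "t j i = (if i = k then real j * w else 0)" for j :: nat and i
  define h where "h j i y = g i (y - t j i)" for j i y
  have h: "smooth_real (h j i)" for j i
    using smooth_real_affine[OF g[of i], of 1 "- t j i"] by (simp add: h_def[abs_def])
  have hd: "deriv (h j i) y = deriv (g i) (y - t j i)" for j i y
  proof (rule DERIV_imp_deriv)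
    have "((\<lambda>y. y - t j i) has_real_derivative 1) (at y)" by (auto intro!: derivative_eq_intros)
    from DERIV_chain2[OF smooth_real_deriv(1)[OF g] this]
    show "(h j i has_real_derivative deriv (g i) (y - t j i)) (at y)" unfolding h_def[abs_def] by simp
  qed
  have hsupp: "h j i y = 0" if "y \<notin> {l i + t j i..u i + t j i}" for j i y
    unfolding h_def by (rule supp) (use that in auto)
  have intg: "integrable lborel (\<lambda>y. \<bar>v y\<bar> powr p)"
    if v: "smooth_real v" and z: "\<And>y. y \<notin> {\<alpha>..\<beta>} \<Longrightarrow> v y = 0" for v :: "real \<Rightarrow> real" and \<alpha> \<beta>
  proof (rule integrable_compact_support[OF _ compact_Icc])
    show "continuous_on UNIV (\<lambda>y. \<bar>v y\<bar> powr p)"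
      using p_gt_1 by (intro continuous_on_powr' continuous_on_rabs smooth_real_continuous[OF v] continuous_on_const) auto
    show "\<bar>v y\<bar> powr p = 0" if "y \<notin> {\<alpha>..\<beta>}" for y using z[OF that] by simp
  qed
  have hdsupp: "deriv (h j i) y = 0" if "y \<notin> {l i + t j i..u i + t j i}" for j i y
    by (rule ex.deriv_eq_0_outside[OF h hsupp that])
  have sm': "smooth_real (if i = i' then deriv (h j i) else h j i)" for i i' j
    using h smooth_real_deriv(2)[OF h] by simp
  have shift: "(\<integral>y. \<bar>v (y - s)\<bar> powr p \<partial>lborel) = (\<integral>y. \<bar>v y\<bar> powr p \<partial>lborel)"
    if "smooth_real v" for v :: "real \<Rightarrow> real" and s
  proof -
    have [measurable]: "v \<in> borel_measurable borel"
      by (intro borel_measurable_continuous_onI smooth_real_continuous that)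
    show ?thesis using lborel_integral_shift[of "\<lambda>y. \<bar>v y\<bar> powr p" "- s"] by simp
  qed
  define I where "I i = (\<integral>y. \<bar>g i y\<bar> powr p \<partial>lborel)" for i
  have hI: "(\<integral>y. \<bar>h j i y\<bar> powr p \<partial>lborel) = I i" for j i
    unfolding h_def I_def by (rule shift[OF g])
  have hdI: "(\<integral>y. \<bar>deriv (h j i) y\<bar> powr p \<partial>lborel) \<le> (c i + e0) * I i" for j i
    unfolding hd shift[OF smooth_real_deriv(2)[OF g]] I_def by (rule le)
  define Q where "Q = (\<Prod>i\<in>UNIV. I i)"
  have Q: "0 < Q" unfolding Q_def I_def using pos by (intro prod_pos) auto
  define F where "F j x = (\<Prod>i\<in>UNIV. h j i (x $ i))" for j and x :: "real^'n"
  have F: "Ccinf D (F j)" for j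
    unfolding F_def[abs_def]
  proof (rule Ccinf_prod[OF h hsupp])
    fix x :: "real^'n" assume x: "\<And>i. l i + t j i \<le> x $ i \<and> x $ i \<le> u i + t j i"
    \<comment> \<open>The translation acts in a direction of \<open>K\<close> only, so the bounded
      coordinates keep their place in the support of the profiles.\<close>
    have "a i < x $ i \<and> x $ i < b i" if "i \<notin> K" for i
      using x[of i] lu[OF that] that k by (auto simp: t_def split: if_splits)
    then show "x \<in> D" by (simp add: slab_def)
  qed
  define A where "A j = {x :: real^'n. l k + real j * w \<le> x $ k \<and> x $ k \<le> u k + real j * w}" for j :: nat
  have Aclosed: "closed (A j)" for j
    unfolding A_def by (intro closed_Collect_conj closed_Collect_le continuous_intros)
  have Fsupp: "F j x = 0" if "x \<notin> A j" for j x
  proof -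
    have "h j k (x $ k) = 0" using that by (intro hsupp) (auto simp: A_def t_def)
    then show ?thesis unfolding F_def by (intro prod_zero) auto
  qed
  have Fpd: "pd i (F j) x = (\<Prod>i'\<in>UNIV. (if i' = i then deriv (h j i') else h j i') (x $ i'))" for i j x
    unfolding F_def[abs_def] smooth_prod(2)[OF h] ..
  have Lint_F: "Lint D (\<lambda>x. \<bar>\<Prod>i\<in>UNIV. v i (x $ i)\<bar> powr p) = (\<Prod>i\<in>UNIV. \<integral>y. \<bar>v i y\<bar> powr p \<partial>lborel)"
    if v: "\<And>i. smooth_real (v i)" and vs: "\<And>i y. y \<notin> {l i + t j i..u i + t j i} \<Longrightarrow> v i y = 0"
      and z: "\<And>x. x \<notin> D \<Longrightarrow> (\<Prod>i\<in>UNIV. v i (x $ i)) = 0" for v j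
  proof -
    have c: "continuous_on UNIV (\<lambda>x::real^'n. \<Prod>i\<in>UNIV. v i (x $ i))"
      by (rule smooth_continuous[OF smooth_prod(1)[OF v]])
    have "Lint D (\<lambda>x. \<bar>\<Prod>i\<in>UNIV. v i (x $ i)\<bar> powr p) = (\<integral>x. \<bar>\<Prod>i\<in>UNIV. v i (x $ i)\<bar> powr p \<partial>lborel)"
      unfolding Lint_M
      by (rule integral_M_lborel)
         (use borel_measurable_continuous_onI[OF c] z in auto)
    also have "\<dots> = (\<integral>x. (\<Prod>i\<in>UNIV. \<bar>v i (x $ i)\<bar> powr p) \<partial>lborel)"
      by (simp add: abs_prod prod_powr_distrib)
    also have "\<dots> = (\<Prod>i\<in>UNIV. \<integral>y. \<bar>v i y\<bar> powr p \<partial>lborel)"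
      by (rule lborel_integral_prod) (auto intro: intg[OF v vs])
    finally show ?thesis .
  qed
  have F_energy: "Lint D (\<lambda>x. \<bar>F j x\<bar> powr p) = Q" for j
  proof -
    obtain C where C: "C \<subseteq> D" "\<And>x. x \<notin> C \<Longrightarrow> F j x = 0" using Ccinf_support[OF F[of j]] by metis
    have "Lint D (\<lambda>x. \<bar>F j x\<bar> powr p) = (\<Prod>i\<in>UNIV. \<integral>y. \<bar>h j i y\<bar> powr p \<partial>lborel)"
      unfolding F_def by (rule Lint_F[OF h hsupp]) (use C in \<open>auto simp: F_def\<close>)
    then show ?thesis by (simp add: hI Q_def)
  qed
  have F_pd_energy: "Lint D (\<lambda>x. \<bar>pd i (F j) x\<bar> powr p) \<le> (c i + e0) * Q" for i j
  proof -
    obtain C where C: "C \<subseteq> D" "\<And>x i. x \<notin> C \<Longrightarrow> pd i (F j) x = 0" using Ccinf_support[OF F[of j]] by metis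
    have "Lint D (\<lambda>x. \<bar>pd i (F j) x\<bar> powr p)
        = (\<Prod>i'\<in>UNIV. \<integral>y. \<bar>(if i' = i then deriv (h j i') else h j i') y\<bar> powr p \<partial>lborel)"
      unfolding Fpd
    proof (rule Lint_F[OF sm'])
      show "(if i' = i then deriv (h j i') else h j i') y = 0" if "y \<notin> {l i' + t j i'..u i' + t j i'}" for i' y
        using hsupp[OF that] hdsupp[OF that] by (cases "i' = i") simp_all
      show "(\<Prod>i'\<in>UNIV. (if i' = i then deriv (h j i') else h j i') (x $ i')) = 0" if "x \<notin> D" for x
        using C(2)[of x i] C(1) that unfolding Fpd by blast
    qed
    also have "\<dots> = (\<integral>y. \<bar>deriv (h j i) y\<bar> powr p \<partial>lborel) * (\<Prod>i'\<in>UNIV - {i}. I i')"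
    proof -
      have "(\<Prod>i'\<in>UNIV - {i}. \<integral>y. \<bar>(if i' = i then deriv (h j i') else h j i') y\<bar> powr p \<partial>lborel) = (\<Prod>i'\<in>UNIV - {i}. I i')"
        by (intro prod.cong refl) (auto simp: hI)
      then show ?thesis by (subst prod.remove[of _ i]) auto
    qed
    also have "\<dots> \<le> ((c i + e0) * I i) * (\<Prod>i'\<in>UNIV - {i}. I i')"
      by (intro mult_right_mono hdI prod_nonneg) (simp add: I_def)
    also have "\<dots> = (c i + e0) * Q" unfolding Q_def by (subst (2) prod.remove[of _ i]) auto
    finally show ?thesis .
  qed
  \<comment> \<open>Normalises the \<open>L^p\<close> norm; one factor serves for all translates,
    because \<open>Q\<close> does not depend on \<open>j\<close>.\<close>
  define N where "N = Q powr (- 1 / p)"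
  have N: "N powr p * Q = 1"
  proof -
    have "N powr p = Q powr (- 1)" using p_gt_1 by (simp add: N_def powr_powr)
    then show ?thesis using Q by (simp add: powr_minus)
  qed
  have N0: "0 \<le> N" by (simp add: N_def)
  \<comment> \<open>Written as a linear combination to fit \<open>Ccinf_combine\<close> and
    \<open>pd_combine\<close>.\<close>
  define f where "f j x = N * F j x + 0 * F j x" for j x
  have f: "f j x = N * F j x" for j x by (simp add: f_def)
  have fpd: "pd i (f j) x = N * pd i (F j) x" for i j x
    using pd_combine[OF Ccinf_smooth[OF F[of j]] Ccinf_smooth[OF F[of j]], of i N 0 x] by (simp add: f_def[abs_def])
  have scale: "Lint D (\<lambda>x. \<bar>N * v x\<bar> powr p) = N powr p * Lint D (\<lambda>x. \<bar>v x\<bar> powr p)" for v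
    using N0 by (simp add: Lint_M abs_mult powr_mult)
  have "bump_family D p f A (1 + \<Lambda> + e)"
  proof
    show "Ccinf D (f j)" for j unfolding f_def[abs_def] by (intro Ccinf_combine F)
    show f1: "Lint D (\<lambda>x. \<bar>f j x\<bar> powr p) = 1" for j unfolding f scale F_energy by (rule N)
    show "Lint D (\<lambda>x. \<bar>f j x\<bar> powr p) + (\<Sum>i\<in>UNIV. Lint D (\<lambda>x. \<bar>pd i (f j) x\<bar> powr p)) \<le> 1 + \<Lambda> + e" for j
    proof -
      have "(\<Sum>i\<in>UNIV. Lint D (\<lambda>x. \<bar>pd i (f j) x\<bar> powr p)) \<le> (\<Sum>i\<in>(UNIV :: 'n set). N powr p * ((c i + e0) * Q))"
        unfolding fpd scale by (intro sum_mono mult_left_mono F_pd_energy) auto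
      also have "\<dots> = (\<Sum>i\<in>(UNIV :: 'n set). (N powr p * Q) * (c i + e0))" by (simp add: mult_ac)
      also have "\<dots> = \<Lambda> + e" unfolding N by (simp add: sum.distrib c_sum e0_def)
      finally show ?thesis by (simp add: f1)
    qed
    show "disjoint_family A"
      unfolding disjoint_family_on_def
    proof (intro ballI impI)
      have lt: "A m \<inter> A n = {}" if "m < n" for m n :: nat
      proof -
        have "real (m + 1) * w \<le> real n * w" using that by (intro mult_right_mono) (auto simp: w_def)
        then have "real m * w + w \<le> real n * w" by (simp add: algebra_simps)
        moreover have "u k - l k < w" by (simp add: w_def)
        ultimately show ?thesis by (auto simp: A_def)
      qed
      fix m n :: nat assume "m \<noteq> n"
      then show "A m \<inter> A n = {}" using lt[of m n] lt[of n m] by (auto simp: neq_iff)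
    qed
    show "A j \<in> sets borel" for j using Aclosed by (rule borel_closed)
    show "f j x = 0" if "x \<notin> A j" for j x using Fsupp[OF that] by (simp add: f)
    show "pd i (f j) x = 0" if "x \<notin> A j" for j x i
      using pd_eq_0[of "A j" "F j", OF Fsupp Aclosed that] by (simp add: fpd)
  qed
  then show ?thesis by blast
qed

end

section \<open>Entropy numbers and the final comparison\<close>

lemma entropy_eqI:
  assumes c: "0 < c" and z: "z \<in> vcarrier Y"
    and lower: "\<And>e (y :: nat \<Rightarrow> _). \<forall>j<2^(m-1). y j \<in> vcarrier Y \<Longrightarrow>
      \<forall>x\<in>vcarrier X. vnorm X x \<le> 1 \<longrightarrow> (\<exists>j<2^(m-1). vnorm Y (vsub Y (T x) (y j)) \<le> e) \<Longrightarrow> c \<le> e"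
    and upper: "\<And>x. x \<in> vcarrier X \<Longrightarrow> vnorm X x \<le> 1 \<Longrightarrow> vnorm Y (vsub Y (T x) z) \<le> c"
  shows "entropy m X Y T = c"
  unfolding entropy_def
proof (rule cInf_eq_minimum)
  \<comment> \<open>The infimum is attained with the single centre \<open>z\<close>; the number
    \<open>2^(m-1)\<close> of centres is at least 1 for every \<open>m\<close>.\<close>
  show "c \<in> {\<epsilon>. \<epsilon> > 0 \<and> (\<exists>y::nat \<Rightarrow> 'a. (\<forall>j<2^(m-1). y j \<in> vcarrier Y) \<and>
          (\<forall>x\<in>vcarrier X. vnorm X x \<le> 1 \<longrightarrow> (\<exists>j<2^(m-1). vnorm Y (vsub Y (T x) (y j)) \<le> \<epsilon>)))}"
    using c z upper by (auto intro!: exI[of _ "\<lambda>_. z"] exI[of _ "0::nat"])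
  fix e assume "e \<in> {\<epsilon>. \<epsilon> > 0 \<and> (\<exists>y::nat \<Rightarrow> 'a. (\<forall>j<2^(m-1). y j \<in> vcarrier Y) \<and>
          (\<forall>x\<in>vcarrier X. vnorm X x \<le> 1 \<longrightarrow> (\<exists>j<2^(m-1). vnorm Y (vsub Y (T x) (y j)) \<le> \<epsilon>)))}"
  then show "c \<le> e" using lower by blast
qed

context slab_problem
begin

abbreviation "W \<equiv> W0_space D p"
abbreviation "L \<equiv> Lp_space D p"
abbreviation "I \<equiv> emb W L"
abbreviation "opt \<equiv> (1 + \<Lambda>) powr (- 1 / p)"

lemmas emb_W0_Lp = emb_fspace[OF W0_function_space Lp_function_space _ Lpnorm_le_opt, folded W0_space_eq Lp_space_eq]

lemma I_bop: "I \<in> bop W L"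
  by (rule emb_W0_Lp(1)[OF W0_subset_Lp])

lemma opnorm_I_le: "opnorm W L I \<le> opt"
  unfolding W0_space_eq
  by (rule opnorm_fspace_le[OF W0_function_space])
     (use emb_W0_Lp(3)[OF W0_subset_Lp] in \<open>simp_all only: W0_space_eq powr_ge_zero\<close>)

text \<open>The s-number and the covering radius do not depend on the bumps, so the error
  \<open>e\<close> in the energy of the bumps can be sent to 0 in both lower bounds.\<close>

lemma tendsto_opt: "((\<lambda>e. (1 + \<Lambda> + e) powr t) \<longlongrightarrow> (1 + \<Lambda>) powr t) (at_right 0)"
proof -
  have "((\<lambda>e. (1 + \<Lambda> + e) powr t) \<longlongrightarrow> (1 + \<Lambda> + 0) powr t) (at_right 0)"
    using Lambda_nonneg by (intro tendsto_powr tendsto_add tendsto_const tendsto_ident_at) auto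
  then show ?thesis by simp
qed

lemma opt_le_snum:
  assumes s: "strict_snum s" and m: "m \<ge> 1"
  shows "opt \<le> s m W L I"
proof -
  have "1 \<le> (1 + \<Lambda> + e) powr (1 / p) * s m W L I" if pos: "0 < e" for e
  proof -
    obtain f A where "bump_family D p f A (1 + \<Lambda> + e)" using ex_bump_family[OF pos] by blast
    from bump_family.snum_lower_bound[OF this s m] show ?thesis .
  qed
  then have ev: "\<forall>\<^sub>F e in at_right 0. 1 \<le> (1 + \<Lambda> + e) powr (1 / p) * s m W L I"
    by (auto simp: eventually_at_right_less intro: eventually_mono[OF eventually_at_right_less])
  have "1 \<le> (1 + \<Lambda>) powr (1 / p) * s m W L I"
    by (rule tendsto_lowerbound[OF tendsto_mult[OF tendsto_opt tendsto_const] ev]) simp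
  then have "opt * 1 \<le> opt * ((1 + \<Lambda>) powr (1 / p) * s m W L I)" by (intro mult_left_mono) auto
  also have "\<dots> = (opt * (1 + \<Lambda>) powr (1 / p)) * s m W L I" by (simp only: mult.assoc)
  also have "opt * (1 + \<Lambda>) powr (1 / p) = 1" using Lambda_nonneg by (simp flip: powr_add)
  finally show ?thesis by simp
qed

lemma snum_le_opnorm:
  assumes s: "strict_snum s" and m: "m \<ge> 1"
  shows "s m W L I \<le> opnorm W L I"
  using m
proof (induction m rule: nat_induct_at_least)
  case base
  show ?case using strict_snum_op(1)[OF s banach_W0 banach_Lp I_bop] by simp
next
  case (Suc n)
  then show ?case using strict_snum_op(2)[OF s banach_W0 banach_Lp I_bop, of n] by simp
qed

text \<open>One ball around 0 of radius \<open>opt\<close> already covers the image of the unit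
  ball, and further centres do not help, since the covering bound holds for any finite number of
  them.\<close>

lemma entropy_eq: "entropy m W L I = opt"
proof (rule entropy_eqI)
  show "0 < opt" using Lambda_nonneg by simp
  show "cls D (\<lambda>_. 0) \<in> vcarrier L" by (simp add: Lp_space_eq memLp_zero)
  show "vnorm L (vsub L (I x) (cls D (\<lambda>_. 0))) \<le> opt" if x: "x \<in> vcarrier W" "vnorm W x \<le> 1" for x
  proof -
    obtain u where u: "u \<in> {u. \<exists>G. W0_grad u G}" "x = cls D u" using x(1) by (auto simp: W0_space_eq)
    have "vsub L (I x) (cls D (\<lambda>_. 0)) = I x"
      using emb_W0_Lp(2)[OF W0_subset_Lp u(1)] by (simp add: u(2) Lp_space_eq)
    then have "vnorm L (vsub L (I x) (cls D (\<lambda>_. 0))) \<le> opt * vnorm W x"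
      using emb_W0_Lp(3)[OF W0_subset_Lp x(1)] by simp
    also have "\<dots> \<le> opt * 1" using x(2) by (intro mult_left_mono) auto
    finally show ?thesis by simp
  qed
  fix e and y :: "nat \<Rightarrow> (real^'n \<Rightarrow> real) set" assume y: "\<forall>j<2^(m-1). y j \<in> vcarrier L"
    and cover: "\<forall>x\<in>vcarrier W. vnorm W x \<le> 1 \<longrightarrow> (\<exists>j<2^(m-1). vnorm L (vsub L (I x) (y j)) \<le> e)"
  have "(1 + \<Lambda> + d) powr (- 1 / p) \<le> e" if pos: "0 < d" for d
  proof -
    obtain f A where "bump_family D p f A (1 + \<Lambda> + d)" using ex_bump_family[OF pos] by blast
    from bump_family.cover_lower_bound[OF this y cover] show ?thesis .
  qed
  then have ev: "\<forall>\<^sub>F d in at_right 0. (1 + \<Lambda> + d) powr (- 1 / p) \<le> e"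
    by (auto intro: eventually_mono[OF eventually_at_right_less])
  show "opt \<le> e" by (rule tendsto_upperbound[OF tendsto_opt ev]) simp
qed

end

theorem mainTheorem5:
  fixes p :: real and K :: "'n::finite set" and a b :: "'n \<Rightarrow> real"
    and s :: "nat \<Rightarrow> (real^'n \<Rightarrow> real) set nspace \<Rightarrow> (real^'n \<Rightarrow> real) set nspace
              \<Rightarrow> ((real^'n \<Rightarrow> real) set \<Rightarrow> (real^'n \<Rightarrow> real) set) \<Rightarrow> real"
    and m :: nat
  assumes hp: "p > 1"
    and hK: "K \<noteq> {}" "K \<noteq> UNIV"
    and hab: "\<forall>i. i \<notin> K \<longrightarrow> a i < b i"
    and hs: "strict_snum s"
    and hm: "m \<ge> 1"
  defines "D \<equiv> {x :: real^'n. \<forall>i. i \<notin> K \<longrightarrow> a i < x $ i \<and> x $ i < b i}"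
  defines "W \<equiv> W0_space D p" and "L \<equiv> Lp_space D p"
  defines "I \<equiv> emb W L"
  shows "banach W \<and> banach L \<and> I \<in> bop W L \<and>
         s m W L I = opnorm W L I \<and>
         entropy m W L I = opnorm W L I \<and>
         opnorm W L I = (1 + pi_p p powr p * (p - 1) * (\<Sum>i\<in>- K. (b i - a i) powr (- p))) powr (- 1 / p) \<and>
         (\<lambda>j. entropy j W L I) \<longlonglongrightarrow> opnorm W L I"
proof -
  interpret P: slab_problem p K a b
    by unfold_locales (use hp hK hab in auto)
  have D: "D = slab K a b" by (simp add: D_def slab_def)
  have lower: "P.opt \<le> s m P.W P.L P.I" by (rule P.opt_le_snum[OF hs hm])
  have upper: "s m P.W P.L P.I \<le> opnorm P.W P.L P.I" by (rule P.snum_le_opnorm[OF hs hm])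
  \<comment> \<open>The chain from \<open>opt\<close> through the s-number and the operator norm
    back to \<open>opt\<close> closes up; the lower bound for the operator norm is thus obtained
    from the s-number.\<close>
  have opn: "opnorm P.W P.L P.I = P.opt" using lower upper P.opnorm_I_le by linarith
  have "s m P.W P.L P.I = opnorm P.W P.L P.I" using lower upper opn by linarith
  \<comment> \<open>The entropy number is the same for every index, the index 0 included, so the
    sequence is constant.\<close>
  moreover have "(\<lambda>j. entropy j P.W P.L P.I) \<longlonglongrightarrow> opnorm P.W P.L P.I"
    unfolding P.entropy_eq opn by (rule tendsto_const)
  ultimately show ?thesis
    unfolding I_def W_def L_def D
    using P.banach_W0 P.banach_Lp P.I_bop P.entropy_eq opn by (simp add: P.\<Lambda>_def)
qed

end
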